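(* Let $d\ge 1$, $a<b$ real numbers, and $\Omega=[a,b]^{\mathbb{Z}^d}$. Let $J:\mathbb{Z}^d\to[0,\infty)$ be symmetric ($J(x)=J(-x)$ for all $x$) and summable, with $J(0)=0$ and $0<\|J\|:=\sum_{x\in\mathbb{Z}^d}J(x)<\infty$. Let $\Gamma=\{\mu^{\Lambda,\gamma}:\Lambda\subset\mathbb{Z}^d \text{ finite},\ \gamma\in\Omega\}$ be the family of specifications $$\mu^{\Lambda,\gamma}(d\eta_\Lambda)=\frac{1}{Z^{\Lambda,\gamma}}\exp\left(-H^\Lambda(\eta_\Lambda\gamma_{\Lambda^c})\right)d\eta_\Lambda \quad\text{on } [a,b]^\Lambda$$ induced by the Hamiltonian $$H^\Lambda(\eta)=\frac12\sum_{\{x,y\}\not\subset\Lambda^c}J(y-x)\,(\eta(x)-\eta(y))^2 .$$ Then there exists a unique Gibbs measure compatible with $\Gamma$.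
   Context: $\Omega=[a,b]^{\mathbb{Z}^d}$ carries the product topology and its Borel $\sigma$-algebra. The sum in $H^\Lambda$ runs over unordered pairs $\{x,y\}$ of sites of $\mathbb{Z}^d$ with at least one of $x,y$ in $\Lambda$ (each pair counted once). $d\eta_\Lambda$ is Lebesgue measure on $[a,b]^\Lambda$, and $Z^{\Lambda,\gamma}$ is the constant making $\mu^{\Lambda,\gamma}$ a probability measure. The juxtaposition $\eta_\Lambda\gamma_{\Lambda^c}\in\Omega$ equals $\eta(x)$ for $x\in\Lambda$ and $\gamma(x)$ for $x\in\Lambda^c$. A Gibbs measure compatible with $\Gamma$ is a Borel probability measure $\mu$ on $\Omega$ satisfying the DLR equations: for every finite $\Lambda\subset\mathbb{Z}^d$ and every continuous $f:\Omega\to\mathbb{R}$, $$\int\mu(d\gamma)\int\mu^{\Lambda,\gamma}(d\eta_\Lambda)\,f(\eta_\Lambda\gamma_{\Lambda^c})=\int\mu(d\eta)\,f(\eta).$$ *)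

theory Defs
  imports "HOL-Probability.Probability"
begin

type_synonym 'd site = "int ^ 'd"

type_synonym 'd configuration = "'d site \<Rightarrow> real"

definition configurations :: "real \<Rightarrow> real \<Rightarrow> ('d::finite) configuration set" where
  "configurations a b = (UNIV \<rightarrow>\<^sub>E {a..b})"

text \<open>
  An unordered pair of sites is a two-element set \<open>e\<close>. The description below is well defined
  because \<open>J\<close> is even in all uses, so that the value does not depend on the order in
  which the two elements of \<open>e\<close> are listed; see the lemma that follows.
\<close>

definition pair_interaction ::
    "('d::finite site \<Rightarrow> real) \<Rightarrow> 'd configuration \<Rightarrow> 'd site set \<Rightarrow> real" where
  "pair_interaction J \<eta> e = (THE r. \<exists>x y. e = {x, y} \<and> r = J (y - x) * (\<eta> x - \<eta> y)\<^sup>2)"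

lemma pair_interaction_eq:
  assumes "\<And>x. J x = J (- x)"
  shows "pair_interaction J \<eta> {x, y} = J (y - x) * (\<eta> x - \<eta> y)\<^sup>2"
  unfolding pair_interaction_def
proof (rule the_equality)
  show "\<exists>x' y'. {x, y} = {x', y'} \<and>
      J (y - x) * (\<eta> x - \<eta> y)\<^sup>2 = J (y' - x') * (\<eta> x' - \<eta> y')\<^sup>2"
    by blast
next
  fix r
  assume "\<exists>x' y'. {x, y} = {x', y'} \<and> r = J (y' - x') * (\<eta> x' - \<eta> y')\<^sup>2"
  moreover have "J (x - y) = J (y - x)"
    using assms[of "x - y"] by simp
  ultimately show "r = J (y - x) * (\<eta> x - \<eta> y)\<^sup>2"
    by (auto simp: doubleton_eq_iff power2_commute)
qed

definition hamiltonian ::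
    "('d::finite site \<Rightarrow> real) \<Rightarrow> 'd site set \<Rightarrow> 'd configuration \<Rightarrow> real" where
  "hamiltonian J \<Lambda> \<eta> =
     1 / 2 * (\<Sum>\<^sub>\<infinity>e\<in>{e. card e = 2 \<and> \<not> e \<subseteq> - \<Lambda>}. pair_interaction J \<eta> e)"

definition lebesgue_box :: "real \<Rightarrow> real \<Rightarrow> 'd::finite site set \<Rightarrow> 'd configuration measure" where
  "lebesgue_box a b \<Lambda> = (\<Pi>\<^sub>M x\<in>\<Lambda>. restrict_space lborel {a..b})"

text \<open>
  Note the argument order: \<open>override_on \<gamma> \<eta> \<Lambda>\<close> equals \<open>\<eta>\<close> on \<open>\<Lambda>\<close> and
  \<open>\<gamma>\<close> off \<open>\<Lambda>\<close>.
\<close>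

definition partition_function ::
    "real \<Rightarrow> real \<Rightarrow> ('d::finite site \<Rightarrow> real) \<Rightarrow> 'd site set \<Rightarrow> 'd configuration \<Rightarrow> real" where
  "partition_function a b J \<Lambda> \<gamma> =
     (\<integral>\<eta>. exp (- hamiltonian J \<Lambda> (override_on \<gamma> \<eta> \<Lambda>)) \<partial>lebesgue_box a b \<Lambda>)"

definition gibbs_specification ::
    "real \<Rightarrow> real \<Rightarrow> ('d::finite site \<Rightarrow> real) \<Rightarrow> 'd site set \<Rightarrow> 'd configuration
      \<Rightarrow> 'd configuration measure" where
  "gibbs_specification a b J \<Lambda> \<gamma> =
     density (lebesgue_box a b \<Lambda>)
       (\<lambda>\<eta>. ennreal (exp (- hamiltonian J \<Lambda> (override_on \<gamma> \<eta> \<Lambda>))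
                       / partition_function a b J \<Lambda> \<gamma>))"

text \<open>
  On functions, \<open>borel\<close> is generated by the product topology, so the restricted space
  carries the Borel sets of the subspace topology of the configuration space.
\<close>

definition gibbs_measure ::
    "real \<Rightarrow> real \<Rightarrow> ('d::finite site set \<Rightarrow> 'd configuration \<Rightarrow> 'd configuration measure)
      \<Rightarrow> 'd configuration measure \<Rightarrow> bool" where
  "gibbs_measure a b G \<mu> \<longleftrightarrow>
     prob_space \<mu> \<and>
     sets \<mu> = sets (restrict_space borel (configurations a b)) \<and>
     (\<forall>\<Lambda> f. finite \<Lambda> \<longrightarrow> continuous_on (configurations a b) f \<longrightarrow>
        (\<integral>\<gamma>. (\<integral>\<eta>. f (override_on \<gamma> \<eta> \<Lambda>) \<partial>G \<Lambda> \<gamma>) \<partial>\<mu>) = (\<integral>\<eta>. (f \<eta> :: real) \<partial>\<mu>))"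

end

theory Submission
  imports Defs
begin

text \<open>
  The interaction is a convex quadratic, so the spin at a site \<open>x\<close>, conditioned on all the others, is
  a Gaussian of precision \<open>\<beta> = \<parallel>J\<parallel>\<close> truncated to \<open>[a, b]\<close>, centred at the \<open>J\<close>-weighted
  average of its neighbours. Write \<open>E\<^sub>m f\<close> for its mean when the centre is \<open>m\<close>. Then
  \<open>d/dm E\<^sub>m f = \<beta> Cov\<^sub>m(f, s)\<close>, which for a 1-Lipschitz \<open>f\<close> is at most
  \<open>\<beta> E\<^sub>m (s - m)\<^sup>2\<close>. For the untruncated Gaussian that is \<open>1\<close>; truncation leaves a boundary
  term in the integration by parts, and as the spins are bounded this term keeps the quantity at most
  \<open>c = 1 - exp (- \<beta> (b - a)\<^sup>2 / 2) < 1\<close> for every \<open>m \<in> [a, b]\<close>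
  (\<open>truncated_gaussian_mean_contraction\<close>). This is Dobrushin's contraction condition in the
  Wasserstein distance, at every temperature and in every dimension.

  The test functions are those with a summable family of Lipschitz weights, one weight per site
  (\<open>weighted_lipschitz\<close>). Resampling the spin at \<open>x\<close> removes the weight at \<open>x\<close> and gives back at
  most the fraction \<open>c\<close> of it, spread over the other sites (\<open>weighted_lipschitz_gibbs_average\<close>).
  A state invariant under resampling can be resampled site after site, so two such states differ on
  a test function by at most \<open>(b - a) c\<^sup>n\<close> times the total weight, for every \<open>n\<close>. The lemma
  \<open>asymptotic_agreement\<close> states this for families of states that are invariant under each resampling
  only eventually along a filter, and serves twice.

  For uniqueness it is applied to two fixed Gibbs measures: they agree on all test functions, and
  these determine a measure (\<open>quasilocal_determines_measure\<close>).

  For existence it is applied to pairs of Gibbs distributions in growing finite volumes with a fixed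
  boundary condition. By consistency of the specification (\<open>gibbs_average_consistent\<close>) they are
  eventually invariant, hence their integrals of any test function form a Cauchy sequence. To realise
  the limiting functional by a measure, note that the marginal on a finite set of sites has as its
  density the mean of the conditional density given the outside, which is itself a test function of
  the outside. So the marginal densities converge pointwise and boundedly, their limits form a
  consistent family, and Kolmogorov's theorem supplies the measure (\<open>weak_limit_exists\<close>). The DLR
  equations pass to the limit on test functions, because averaging over a finite volume maps test
  functions to test functions, and extend to continuous functions by the Stone-Weierstrass theorem.
\<close>

section \<open>Functions with summable Lipschitz weights\<close>

lemma configurations_iff: "\<eta> \<in> configurations a b \<longleftrightarrow> (\<forall>x. a \<le> \<eta> x \<and> \<eta> x \<le> b)"
  unfolding configurations_def by (auto simp: PiE_def Pi_def)

locale harmonic_crystal =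
  fixes a b :: real and J :: "int ^ 'd::finite \<Rightarrow> real"
  assumes a_less_b: "a < b"
    and J_nonneg: "\<And>x. J x \<ge> 0"
    and J_even: "\<And>x. J x = J (- x)"
    and J_zero: "J 0 = 0"
    and J_summable: "J summable_on UNIV"
    and J_mass_pos: "0 < (\<Sum>\<^sub>\<infinity>x. J x)"
begin

abbreviation \<Omega> :: "'d configuration set" where
  "\<Omega> \<equiv> configurations a b"

text \<open>
  The weights refine Dobrushin's vector of oscillations to Lipschitz constants: resampling spins acts on
  them linearly, and bounded spins turn a small total weight into a small oscillation.
\<close>
definition weighted_lipschitz :: "('d site \<Rightarrow> real) \<Rightarrow> ('d configuration \<Rightarrow> real) \<Rightarrow> bool" where
  "weighted_lipschitz L f \<longleftrightarrow>
     (\<forall>z. 0 \<le> L z) \<and> L summable_on UNIV \<and>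
     (\<forall>\<eta>\<in>\<Omega>. \<forall>\<eta>'\<in>\<Omega>. \<bar>f \<eta> - f \<eta>'\<bar> \<le> (\<Sum>\<^sub>\<infinity>z. L z * \<bar>\<eta> z - \<eta>' z\<bar>))"

definition quasilocal :: "('d configuration \<Rightarrow> real) \<Rightarrow> bool" where
  "quasilocal f \<longleftrightarrow> (\<exists>L. weighted_lipschitz L f)"

lemma diff_le: "\<eta> \<in> \<Omega> \<Longrightarrow> \<eta>' \<in> \<Omega> \<Longrightarrow> \<bar>\<eta> z - \<eta>' z\<bar> \<le> b - a"
  by (auto simp: configurations_iff abs_le_iff) (smt (verit, best))+

lemma weighted_summable:
  assumes "\<eta> \<in> \<Omega>" "\<eta>' \<in> \<Omega>" "\<And>z. 0 \<le> L z" "L summable_on A"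
  shows "(\<lambda>z. L z * \<bar>\<eta> z - \<eta>' z\<bar>) summable_on A"
proof (rule summable_on_comparison_test)
  show "(\<lambda>z. L z * (b - a)) summable_on A"
    by (rule summable_on_cmult_left) fact
qed (use assms diff_le in \<open>auto intro!: mult_left_mono\<close>)

lemma weighted_sum_le:
  assumes "\<eta> \<in> \<Omega>" "\<eta>' \<in> \<Omega>" "\<And>z. 0 \<le> L z" "L summable_on A"
  shows "(\<Sum>\<^sub>\<infinity>z\<in>A. L z * \<bar>\<eta> z - \<eta>' z\<bar>) \<le> (b - a) * (\<Sum>\<^sub>\<infinity>z\<in>A. L z)"
proof -
  have "(\<Sum>\<^sub>\<infinity>z\<in>A. L z * \<bar>\<eta> z - \<eta>' z\<bar>) \<le> (\<Sum>\<^sub>\<infinity>z\<in>A. L z * (b - a))"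
    using assms diff_le[OF assms(1,2)]
    by (intro infsum_mono weighted_summable summable_on_cmult_left) (auto intro!: mult_left_mono)
  then show ?thesis by (simp add: infsum_cmult_left' mult.commute)
qed

lemma weighted_sum_mono:
  assumes "\<eta> \<in> \<Omega>" "\<eta>' \<in> \<Omega>" "\<And>z. 0 \<le> L z" "\<And>z. L z \<le> L' z" "L' summable_on UNIV"
  shows "(\<Sum>\<^sub>\<infinity>z. L z * \<bar>\<eta> z - \<eta>' z\<bar>) \<le> (\<Sum>\<^sub>\<infinity>z. L' z * \<bar>\<eta> z - \<eta>' z\<bar>)"
proof (rule infsum_mono)
  have "L summable_on UNIV"
    using assms by (intro summable_on_comparison_test[OF assms(5)]) auto
  then show "(\<lambda>z. L z * \<bar>\<eta> z - \<eta>' z\<bar>) summable_on UNIV"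
    using assms by (intro weighted_summable) auto
  show "(\<lambda>z. L' z * \<bar>\<eta> z - \<eta>' z\<bar>) summable_on UNIV"
    using assms by (intro weighted_summable) (auto intro: order_trans)
qed (use assms in \<open>auto intro!: mult_right_mono\<close>)

lemma weighted_sum_add:
  assumes "\<eta> \<in> \<Omega>" "\<eta>' \<in> \<Omega>" "\<And>z. 0 \<le> L z" "L summable_on UNIV" "\<And>z. 0 \<le> K z" "K summable_on UNIV"
  shows "(\<Sum>\<^sub>\<infinity>z. (L z + K z) * \<bar>\<eta> z - \<eta>' z\<bar>) =
    (\<Sum>\<^sub>\<infinity>z. L z * \<bar>\<eta> z - \<eta>' z\<bar>) + (\<Sum>\<^sub>\<infinity>z. K z * \<bar>\<eta> z - \<eta>' z\<bar>)"
  unfolding distrib_right using assms by (intro infsum_add weighted_summable)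

lemma weighted_sum_cmult:
  fixes L :: "'d site \<Rightarrow> real"
  shows "(\<Sum>\<^sub>\<infinity>z. (c * L z) * \<bar>\<eta> z - \<eta>' z\<bar>) = c * (\<Sum>\<^sub>\<infinity>z. L z * \<bar>\<eta> z - \<eta>' z\<bar>)"
  by (simp add: mult.assoc infsum_cmult_right')

lemma weighted_lipschitzI:
  assumes "\<And>z. 0 \<le> L z" "L summable_on UNIV"
    "\<And>\<eta> \<eta>'. \<eta> \<in> \<Omega> \<Longrightarrow> \<eta>' \<in> \<Omega> \<Longrightarrow> \<bar>f \<eta> - f \<eta>'\<bar> \<le> (\<Sum>\<^sub>\<infinity>z. L z * \<bar>\<eta> z - \<eta>' z\<bar>)"
  shows "weighted_lipschitz L f"
  using assms unfolding weighted_lipschitz_def by auto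

lemma weighted_lipschitzD:
  assumes "weighted_lipschitz L f"
  shows "0 \<le> L z" "L summable_on UNIV"
    "\<eta> \<in> \<Omega> \<Longrightarrow> \<eta>' \<in> \<Omega> \<Longrightarrow> \<bar>f \<eta> - f \<eta>'\<bar> \<le> (\<Sum>\<^sub>\<infinity>z. L z * \<bar>\<eta> z - \<eta>' z\<bar>)"
  using assms unfolding weighted_lipschitz_def by auto

lemma weighted_lipschitz_oscillation:
  assumes "weighted_lipschitz L f" "\<eta> \<in> \<Omega>" "\<eta>' \<in> \<Omega>"
  shows "\<bar>f \<eta> - f \<eta>'\<bar> \<le> (b - a) * (\<Sum>\<^sub>\<infinity>z. L z)"
  using weighted_lipschitzD(3)[OF assms] weighted_sum_le[OF assms(2,3), of L UNIV]
    weighted_lipschitzD(1,2)[OF assms(1)] by auto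

lemma const_in: "(\<lambda>_. a) \<in> \<Omega>"
  using a_less_b by (auto simp: configurations_iff)

lemma quasilocal_bounded:
  assumes "quasilocal f"
  obtains B where "0 < B" "\<And>\<eta>. \<eta> \<in> \<Omega> \<Longrightarrow> \<bar>f \<eta>\<bar> \<le> B"
proof -
  obtain L where L: "weighted_lipschitz L f" using assms unfolding quasilocal_def by auto
  show ?thesis
  proof (rule that[of "\<bar>f (\<lambda>_. a)\<bar> + (b - a) * (\<Sum>\<^sub>\<infinity>z. L z) + 1"])
    have "0 \<le> (\<Sum>\<^sub>\<infinity>z. L z)" using weighted_lipschitzD(1)[OF L] by (intro infsum_nonneg) auto
    then show "0 < \<bar>f (\<lambda>_. a)\<bar> + (b - a) * (\<Sum>\<^sub>\<infinity>z. L z) + 1" using a_less_b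
      by (smt (verit) mult_nonneg_nonneg)
  qed (use weighted_lipschitz_oscillation[OF L _ const_in] in \<open>smt (verit)\<close>)
qed

lemma quasilocal_const: "quasilocal (\<lambda>_. c)"
  unfolding quasilocal_def by (intro exI[of _ "\<lambda>_. 0"] weighted_lipschitzI) auto

text \<open>
  All closure properties below instantiate this one: the Lipschitz weights of \<open>h\<close> may be taken to be
  \<open>C * L z + D * K z\<close>.
\<close>
lemma quasilocal_dominated:
  assumes f: "quasilocal f" and g: "quasilocal g" and "0 \<le> C" "0 \<le> D"
    and le: "\<And>\<eta> \<eta>'. \<eta> \<in> \<Omega> \<Longrightarrow> \<eta>' \<in> \<Omega> \<Longrightarrow> \<bar>h \<eta> - h \<eta>'\<bar> \<le> C * \<bar>f \<eta> - f \<eta>'\<bar> + D * \<bar>g \<eta> - g \<eta>'\<bar>"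
  shows "quasilocal h"
proof -
  obtain L K where L: "weighted_lipschitz L f" and K: "weighted_lipschitz K g"
    using f g unfolding quasilocal_def by auto
  note L' = weighted_lipschitzD[OF L] and K' = weighted_lipschitzD[OF K]
  have "weighted_lipschitz (\<lambda>z. C * L z + D * K z) h"
  proof (rule weighted_lipschitzI)
    show "(\<lambda>z. C * L z + D * K z) summable_on UNIV"
      using L' K' by (intro summable_on_add summable_on_cmult_right)
    fix \<eta> \<eta>' assume \<eta>: "\<eta> \<in> \<Omega>" "\<eta>' \<in> \<Omega>"
    have "(\<Sum>\<^sub>\<infinity>z. (C * L z + D * K z) * \<bar>\<eta> z - \<eta>' z\<bar>) =
      C * (\<Sum>\<^sub>\<infinity>z. L z * \<bar>\<eta> z - \<eta>' z\<bar>) + D * (\<Sum>\<^sub>\<infinity>z. K z * \<bar>\<eta> z - \<eta>' z\<bar>)"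
      using L' K' \<eta> assms
      by (subst weighted_sum_add) (auto simp: weighted_sum_cmult intro!: summable_on_cmult_right)
    then show "\<bar>h \<eta> - h \<eta>'\<bar> \<le> (\<Sum>\<^sub>\<infinity>z. (C * L z + D * K z) * \<bar>\<eta> z - \<eta>' z\<bar>)"
      using le[OF \<eta>] L'(3)[OF \<eta>] K'(3)[OF \<eta>] assms(3,4)
      by (smt (verit, best) mult_left_mono)
  qed (use L' K' assms in auto)
  then show ?thesis unfolding quasilocal_def by auto
qed

lemma quasilocal_add: "quasilocal f \<Longrightarrow> quasilocal g \<Longrightarrow> quasilocal (\<lambda>\<eta>. f \<eta> + g \<eta>)"
  by (rule quasilocal_dominated[of f g 1 1]) auto

lemma quasilocal_compose:
  assumes "quasilocal f" "0 \<le> C"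
    "\<And>\<eta> \<eta>'. \<eta> \<in> \<Omega> \<Longrightarrow> \<eta>' \<in> \<Omega> \<Longrightarrow> \<bar>u (f \<eta>) - u (f \<eta>')\<bar> \<le> C * \<bar>f \<eta> - f \<eta>'\<bar>"
  shows "quasilocal (\<lambda>\<eta>. u (f \<eta>))"
  by (rule quasilocal_dominated[OF assms(1) assms(1), of C 0]) (use assms in auto)

lemma quasilocal_cong:
  assumes "quasilocal f" "\<And>\<eta>. \<eta> \<in> \<Omega> \<Longrightarrow> g \<eta> = f \<eta>"
  shows "quasilocal g"
  using assms unfolding quasilocal_def weighted_lipschitz_def by auto

lemma quasilocal_mult:
  assumes f: "quasilocal f" and g: "quasilocal g"
  shows "quasilocal (\<lambda>\<eta>. f \<eta> * g \<eta>)"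
proof -
  obtain B where B: "0 < B" "\<And>\<eta>. \<eta> \<in> \<Omega> \<Longrightarrow> \<bar>f \<eta>\<bar> \<le> B" using quasilocal_bounded[OF f] by blast
  obtain C where C: "0 < C" "\<And>\<eta>. \<eta> \<in> \<Omega> \<Longrightarrow> \<bar>g \<eta>\<bar> \<le> C" using quasilocal_bounded[OF g] by blast
  show ?thesis
  proof (rule quasilocal_dominated[OF f g, of C B])
    fix \<eta> \<eta>' assume \<eta>: "\<eta> \<in> \<Omega>" "\<eta>' \<in> \<Omega>"
    have "f \<eta> * g \<eta> - f \<eta>' * g \<eta>' = (f \<eta> - f \<eta>') * g \<eta> + f \<eta>' * (g \<eta> - g \<eta>')"
      by (simp add: algebra_simps)
    also have "\<bar>\<dots>\<bar> \<le> \<bar>f \<eta> - f \<eta>'\<bar> * \<bar>g \<eta>\<bar> + \<bar>f \<eta>'\<bar> * \<bar>g \<eta> - g \<eta>'\<bar>"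
      by (metis abs_mult abs_triangle_ineq)
    also have "\<dots> \<le> \<bar>f \<eta> - f \<eta>'\<bar> * C + B * \<bar>g \<eta> - g \<eta>'\<bar>"
      using B C \<eta> by (intro add_mono mult_left_mono mult_right_mono) auto
    finally show "\<bar>f \<eta> * g \<eta> - f \<eta>' * g \<eta>'\<bar> \<le> C * \<bar>f \<eta> - f \<eta>'\<bar> + B * \<bar>g \<eta> - g \<eta>'\<bar>"
      by (simp add: mult.commute)
  qed (use B C in auto)
qed

lemma quasilocal_coordinate: "quasilocal (\<lambda>\<eta>. \<eta> x)"
proof -
  have "weighted_lipschitz (\<lambda>z. if z = x then 1 else 0) (\<lambda>\<eta>. \<eta> x)"
  proof (rule weighted_lipschitzI)
    show "(\<lambda>z. if z = x then 1 else 0 :: real) summable_on UNIV"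
      by (rule finite_nonzero_values_imp_summable_on) auto
    fix \<eta> \<eta>' :: "'d configuration"
    have "(\<Sum>\<^sub>\<infinity>z. (if z = x then 1 else 0) * \<bar>\<eta> z - \<eta>' z\<bar>) = (\<Sum>\<^sub>\<infinity>z\<in>{x}. \<bar>\<eta> z - \<eta>' z\<bar>)"
      by (rule infsum_cong_neutral) auto
    then show "\<bar>\<eta> x - \<eta>' x\<bar> \<le> (\<Sum>\<^sub>\<infinity>z. (if z = x then 1 else 0) * \<bar>\<eta> z - \<eta>' z\<bar>)" by simp
  qed auto
  then show ?thesis unfolding quasilocal_def by auto
qed

lemma summable_tail:
  fixes L :: "'d site \<Rightarrow> real"
  assumes "\<And>z. 0 \<le> L z" "L summable_on UNIV" "0 < \<epsilon>"
  obtains F where "finite F" "(\<Sum>\<^sub>\<infinity>z\<in>-F. L z) \<le> \<epsilon>"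
proof -
  obtain F where F: "finite F" "dist (sum L F) (infsum L UNIV) \<le> \<epsilon>"
    using infsum_finite_approximation[OF assms(2,3)] by auto
  have "infsum L (F \<union> -F) = infsum L F + infsum L (-F)"
    using assms F by (intro infsum_Un_disjoint) (auto intro: summable_on_subset)
  then show ?thesis using F by (intro that[of F]) (auto simp: dist_real_def)
qed

text \<open>
  Truncating the sum to finitely many sites costs at most the diameter of the spin space times the
  remaining weight; this is what makes quasilocal functions uniform limits of local ones.
\<close>
lemma weighted_sum_split:
  assumes "\<eta> \<in> \<Omega>" "\<eta>' \<in> \<Omega>" "\<And>z. 0 \<le> L z" "L summable_on UNIV" "finite F"
  shows "(\<Sum>\<^sub>\<infinity>z. L z * \<bar>\<eta> z - \<eta>' z\<bar>) \<le> (\<Sum>z\<in>F. L z * \<bar>\<eta> z - \<eta>' z\<bar>) + (b - a) * (\<Sum>\<^sub>\<infinity>z\<in>-F. L z)"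
proof -
  have "(\<Sum>\<^sub>\<infinity>z\<in>F \<union> -F. L z * \<bar>\<eta> z - \<eta>' z\<bar>) =
      (\<Sum>\<^sub>\<infinity>z\<in>F. L z * \<bar>\<eta> z - \<eta>' z\<bar>) + (\<Sum>\<^sub>\<infinity>z\<in>-F. L z * \<bar>\<eta> z - \<eta>' z\<bar>)"
    using assms by (intro infsum_Un_disjoint weighted_summable) (auto intro: summable_on_subset)
  moreover have "(\<Sum>\<^sub>\<infinity>z\<in>-F. L z * \<bar>\<eta> z - \<eta>' z\<bar>) \<le> (b - a) * (\<Sum>\<^sub>\<infinity>z\<in>-F. L z)"
    using assms by (intro weighted_sum_le) (auto intro: summable_on_subset)
  ultimately show ?thesis using assms(5) by simp
qed

text \<open>
  A finite set of sites carries all but \<open>\<epsilon>\<close> of the total weight, and convergence in the product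
  topology controls each of its coordinates.
\<close>
lemma quasilocal_continuous:
  assumes "quasilocal f"
  shows "continuous_on \<Omega> f"
  unfolding continuous_on_def
proof
  fix \<eta> assume \<eta>: "\<eta> \<in> \<Omega>"
  obtain L where "weighted_lipschitz L f" using assms unfolding quasilocal_def by auto
  note L = weighted_lipschitzD[OF this]
  show "(f \<longlongrightarrow> f \<eta>) (at \<eta> within \<Omega>)"
  proof (rule tendstoI)
    fix \<epsilon> :: real assume \<epsilon>: "0 < \<epsilon>"
    obtain F where F: "finite F" "(\<Sum>\<^sub>\<infinity>z\<in>-F. L z) \<le> \<epsilon> / (2 * (b - a))"
      using summable_tail[OF L(1,2), of "\<epsilon> / (2 * (b - a))"] \<epsilon> a_less_b by auto
    have coord: "((\<lambda>\<eta>'. \<eta>' z) \<longlongrightarrow> \<eta> z) (at \<eta> within \<Omega>)" for z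
    proof -
      have "continuous_on UNIV (\<lambda>\<eta>' :: 'd configuration. \<eta>' z)"
        by (rule continuous_on_product_coordinates)
      then have "continuous_on \<Omega> (\<lambda>\<eta>' :: 'd configuration. \<eta>' z)"
        by (rule continuous_on_subset) simp
      then show ?thesis using \<eta> by (auto simp: continuous_on_def)
    qed
    have "((\<lambda>\<eta>'. \<Sum>z\<in>F. L z * \<bar>\<eta>' z - \<eta> z\<bar>) \<longlongrightarrow> (\<Sum>z\<in>F. L z * \<bar>\<eta> z - \<eta> z\<bar>)) (at \<eta> within \<Omega>)"
      by (intro tendsto_intros coord)
    then have "((\<lambda>\<eta>'. \<Sum>z\<in>F. L z * \<bar>\<eta>' z - \<eta> z\<bar>) \<longlongrightarrow> 0) (at \<eta> within \<Omega>)" by simp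
    then have "\<forall>\<^sub>F \<eta>' in at \<eta> within \<Omega>. (\<Sum>z\<in>F. L z * \<bar>\<eta>' z - \<eta> z\<bar>) < \<epsilon> / 2"
      using \<epsilon> by (intro order_tendstoD(2)) auto
    moreover have "\<forall>\<^sub>F \<eta>' in at \<eta> within \<Omega>. \<eta>' \<in> \<Omega>"
      by (simp add: eventually_at_filter)
    ultimately show "\<forall>\<^sub>F \<eta>' in at \<eta> within \<Omega>. dist (f \<eta>') (f \<eta>) < \<epsilon>"
    proof eventually_elim
      case (elim \<eta>')
      have "(b - a) * (\<Sum>\<^sub>\<infinity>z\<in>-F. L z) \<le> (b - a) * (\<epsilon> / (2 * (b - a)))"
        using F a_less_b by (intro mult_left_mono) auto
      also have "\<dots> = \<epsilon> / 2" using a_less_b by (simp add: field_simps)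
      finally have "\<bar>f \<eta>' - f \<eta>\<bar> < \<epsilon>"
        using L(3)[OF elim(2) \<eta>] weighted_sum_split[OF elim(2) \<eta> L(1,2) F(1)] elim(1) by linarith
      then show ?case by (simp add: dist_real_def)
    qed
  qed
qed

lemma quasilocal_measurable: "quasilocal f \<Longrightarrow> f \<in> borel_measurable (restrict_space borel \<Omega>)"
  by (intro borel_measurable_continuous_on_restrict quasilocal_continuous)

end

section \<open>The truncated Gaussian\<close>

text \<open>
  Since \<open>(- (s - m) * u s)' = \<beta> * (s - m)\<^sup>2 * u s - u s\<close>, the defect between \<open>\<beta>\<close> times the
  second moment and the mass is the boundary term \<open>(b - m) * u b + (m - a) * u a\<close>. As \<open>m\<close> lies in
  the interval, this is at least \<open>b - a\<close> times the smallest possible value of \<open>u\<close>, whereas the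
  mass is at most \<open>b - a\<close>.
\<close>
lemma truncated_gaussian_second_moment:
  fixes a b m \<beta> :: real
  assumes ab: "a < b" and \<beta>: "0 < \<beta>" and m: "m \<in> {a..b}"
  defines "u \<equiv> \<lambda>s. exp (- (\<beta> / 2) * (s - m)\<^sup>2)"
  shows "\<beta> * integral {a..b} (\<lambda>s. (s - m)\<^sup>2 * u s)
    \<le> (1 - exp (- \<beta> * (b - a)\<^sup>2 / 2)) * integral {a..b} u"
proof -
  define \<epsilon> where "\<epsilon> = exp (- \<beta> * (b - a)\<^sup>2 / 2)"
  have u_cont: "continuous_on S u" for S unfolding u_def by (intro continuous_intros)
  have u_int: "u integrable_on {a..b}" by (intro integrable_continuous_interval u_cont)
  have q_int: "(\<lambda>s. (s - m)\<^sup>2 * u s) integrable_on {a..b}"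
    by (intro integrable_continuous_interval continuous_intros u_cont)
  have ftc: "((\<lambda>s. \<beta> * ((s - m)\<^sup>2 * u s) - u s) has_integral (- (b - m) * u b) - (- (a - m) * u a)) {a..b}"
  proof (rule fundamental_theorem_of_calculus)
    fix s
    have "((\<lambda>s. - (s - m) * u s) has_real_derivative \<beta> * ((s - m)\<^sup>2 * u s) - u s) (at s within {a..b})"
      unfolding u_def
      by (rule derivative_eq_intros refl | simp add: power2_eq_square algebra_simps)+
    then show "((\<lambda>s. - (s - m) * u s) has_vector_derivative \<beta> * ((s - m)\<^sup>2 * u s) - u s) (at s within {a..b})"
      by (simp add: has_real_derivative_iff_has_vector_derivative)
  qed (use ab in simp)
  have "((\<lambda>s. \<beta> * ((s - m)\<^sup>2 * u s) - u s) has_integral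
      \<beta> * integral {a..b} (\<lambda>s. (s - m)\<^sup>2 * u s) - integral {a..b} u) {a..b}"
    by (intro has_integral_diff has_integral_mult_right integrable_integral u_int q_int)
  from has_integral_unique[OF this ftc] have parts: "\<beta> * integral {a..b} (\<lambda>s. (s - m)\<^sup>2 * u s) - integral {a..b} u
      = - ((b - m) * u b + (m - a) * u a)"
    by (simp add: algebra_simps)
  have le1: "u s \<le> 1" for s using \<beta> by (simp add: u_def)
  have ge: "\<epsilon> \<le> u s" if "s \<in> {a..b}" for s
  proof -
    have "(s - m)\<^sup>2 \<le> (b - a)\<^sup>2" using that m by (intro abs_le_square_iff[THEN iffD1]) auto
    then show ?thesis using \<beta> by (simp add: u_def \<epsilon>_def)
  qed
  have "integral {a..b} u \<le> integral {a..b} (\<lambda>s. 1)"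
    by (intro integral_le u_int) (auto simp: le1)
  then have "integral {a..b} u \<le> b - a" using ab by simp
  then have "\<epsilon> * integral {a..b} u \<le> \<epsilon> * (b - a)" by (intro mult_left_mono) (auto simp: \<epsilon>_def)
  also have "\<dots> = (b - m) * \<epsilon> + (m - a) * \<epsilon>" by (simp add: algebra_simps)
  also have "\<dots> \<le> (b - m) * u b + (m - a) * u a"
    using m ab by (intro add_mono mult_left_mono ge) auto
  finally show ?thesis using parts unfolding \<epsilon>_def by (simp add: algebra_simps)
qed

lemma truncated_gaussian_mass_pos:
  fixes a b m \<beta> :: real
  assumes "a < b"
  shows "0 < integral {a..b} (\<lambda>s. exp (- (\<beta> / 2) * (s - m)\<^sup>2))" (is "0 < integral _ ?u")
proof -
  have cont: "continuous_on {a..b} ?u" by (intro continuous_intros)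
  have "\<exists>s0\<in>{a..b}. \<forall>s\<in>{a..b}. ?u s0 \<le> ?u s"
    using assms by (intro continuous_attains_inf cont) auto
  then obtain s0 where s0: "\<And>s. s \<in> {a..b} \<Longrightarrow> ?u s0 \<le> ?u s" by blast
  have "0 < ?u s0 * (b - a)" using assms by (intro mult_pos_pos) auto
  also have "\<dots> = integral {a..b} (\<lambda>s. ?u s0)" using assms by simp
  also have "\<dots> \<le> integral {a..b} ?u"
    by (intro integral_le integrable_continuous_interval cont s0) auto
  finally show ?thesis .
qed

text \<open>
  The left-hand side is \<open>Z\<^sup>2\<close> times the absolute covariance of \<open>f\<close> and \<open>s\<close> under the normalised density.
  In the covariance \<open>f\<close> may be recentred by \<open>f m\<close>, so the integrand is at most
  \<open>K * \<bar>s - m\<bar> * \<bar>s - mean\<bar>\<close>. The arithmetic-geometric mean inequality separates the two factors,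
  and the second moment about the mean does not exceed the one about \<open>m\<close>.
\<close>
lemma truncated_gaussian_covariance:
  fixes a b m \<beta> K :: real and f :: "real \<Rightarrow> real"
  assumes ab: "a < b" and m: "m \<in> {a..b}"
    and cont: "continuous_on {a..b} f"
    and lip: "\<And>s. s \<in> {a..b} \<Longrightarrow> \<bar>f s - f m\<bar> \<le> K * \<bar>s - m\<bar>"
    and K: "0 \<le> K"
  defines "u \<equiv> \<lambda>s. exp (- (\<beta> / 2) * (s - m)\<^sup>2)"
  defines "Z \<equiv> integral {a..b} u"
  shows "\<bar>integral {a..b} (\<lambda>s. f s * ((s - m) * u s)) * Z
     - integral {a..b} (\<lambda>s. f s * u s) * integral {a..b} (\<lambda>s. (s - m) * u s)\<bar>
    \<le> K * integral {a..b} (\<lambda>s. (s - m)\<^sup>2 * u s) * Z"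
proof -
  let ?I = "integral {a..b}"
  have u_cont: "continuous_on {a..b} u" unfolding u_def by (intro continuous_intros)
  have u_pos: "0 < u s" for s by (simp add: u_def)
  have has: "(g has_integral ?I g) {a..b}" if "continuous_on {a..b} g" for g :: "real \<Rightarrow> real"
    using that by (intro integrable_integral integrable_continuous_interval)
  define A1 where "A1 = ?I (\<lambda>s. (s - m) * u s)"
  define A2 where "A2 = ?I (\<lambda>s. (s - m)\<^sup>2 * u s)"
  define N where "N = ?I (\<lambda>s. f s * u s)"
  define N1 where "N1 = ?I (\<lambda>s. f s * ((s - m) * u s))"
  have hZ: "(u has_integral Z) {a..b}" unfolding Z_def by (intro has u_cont)
  have h1: "((\<lambda>s. (s - m) * u s) has_integral A1) {a..b}"
    unfolding A1_def by (intro has continuous_intros u_cont)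
  have h2: "((\<lambda>s. (s - m)\<^sup>2 * u s) has_integral A2) {a..b}"
    unfolding A2_def by (intro has continuous_intros u_cont)
  have hN: "((\<lambda>s. f s * u s) has_integral N) {a..b}"
    unfolding N_def by (intro has continuous_intros u_cont cont)
  have hN1: "((\<lambda>s. f s * ((s - m) * u s)) has_integral N1) {a..b}"
    unfolding N1_def by (intro has continuous_intros u_cont cont)
  have Z_pos: "0 < Z" unfolding Z_def u_def by (rule truncated_gaussian_mass_pos[OF ab])
  \<comment> \<open>\<open>t\<close> is the displacement of the mean of the normalised density \<open>u\<close> from \<open>m\<close>.\<close>
  define t where "t = A1 / Z"
  have A1: "A1 = t * Z" using Z_pos by (simp add: t_def)
  have "((\<lambda>s. (f s * ((s - m) * u s) - t * (f s * u s)) - (f m * ((s - m) * u s) - (f m * t) * u s))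
      has_integral (N1 - t * N) - (f m * A1 - (f m * t) * Z)) {a..b}"
    by (intro has_integral_diff has_integral_mult_right hN1 hN h1 hZ)
  then have centred: "((\<lambda>s. (f s - f m) * (s - m - t) * u s) has_integral (N1 - t * N)) {a..b}"
    by (rule has_integral_eq_rhs[OF has_integral_eq, rotated]) (auto simp: A1 algebra_simps)
  have "((\<lambda>s. K * ((s - m)\<^sup>2 * u s) - (K * t) * ((s - m) * u s) + (K * t\<^sup>2 / 2) * u s)
      has_integral K * A2 - (K * t) * A1 + (K * t\<^sup>2 / 2) * Z) {a..b}"
    by (intro has_integral_diff has_integral_add has_integral_mult_right h1 h2 hZ)
  moreover have "K * ((s - m)\<^sup>2 * u s) - (K * t) * ((s - m) * u s) + (K * t\<^sup>2 / 2) * u s =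
      K * (((s - m)\<^sup>2 + (s - m - t)\<^sup>2) / 2) * u s" for s
  proof -
    have "((s - m)\<^sup>2 + (s - m - t)\<^sup>2) / 2 = (s - m)\<^sup>2 - t * (s - m) + t\<^sup>2 / 2"
      by (simp add: power2_eq_square field_simps)
    then show ?thesis by (simp only: ) (simp add: algebra_simps)
  qed
  moreover have "K * A2 - (K * t) * A1 + (K * t\<^sup>2 / 2) * Z = K * A2 - K * t\<^sup>2 * Z / 2"
    by (simp add: A1 power2_eq_square field_simps)
  ultimately have square: "((\<lambda>s. K * (((s - m)\<^sup>2 + (s - m - t)\<^sup>2) / 2) * u s)
      has_integral K * A2 - K * t\<^sup>2 * Z / 2) {a..b}"
    by (simp only:)
  have "\<bar>N1 - t * N\<bar> \<le> K * A2 - K * t\<^sup>2 * Z / 2"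
  proof -
    have "\<bar>f s - f m\<bar> * \<bar>s - m - t\<bar> * u s \<le> K * (((s - m)\<^sup>2 + (s - m - t)\<^sup>2) / 2) * u s"
      if "s \<in> {a..b}" for s
    proof (rule mult_right_mono)
      have "\<bar>f s - f m\<bar> * \<bar>s - m - t\<bar> \<le> (K * \<bar>s - m\<bar>) * \<bar>s - m - t\<bar>"
        by (intro mult_right_mono lip that) simp
      also have "\<dots> = K * (\<bar>s - m\<bar> * \<bar>s - m - t\<bar>)" by simp
      also have "\<dots> \<le> K * (((s - m)\<^sup>2 + (s - m - t)\<^sup>2) / 2)"
      proof (rule mult_left_mono[OF _ K])
        have "0 \<le> (\<bar>s - m\<bar> - \<bar>s - m - t\<bar>)\<^sup>2" by simp
        then show "\<bar>s - m\<bar> * \<bar>s - m - t\<bar> \<le> ((s - m)\<^sup>2 + (s - m - t)\<^sup>2) / 2"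
          unfolding power2_diff[of "\<bar>s - m\<bar>"] by simp
      qed
      finally show "\<bar>f s - f m\<bar> * \<bar>s - m - t\<bar> \<le> K * (((s - m)\<^sup>2 + (s - m - t)\<^sup>2) / 2)" .
    qed (simp add: u_pos less_imp_le)
    then have "norm ((f s - f m) * (s - m - t) * u s) \<le> (K * (((s - m)\<^sup>2 + (s - m - t)\<^sup>2) / 2) * u s) \<bullet> 1"
      if "s \<in> {a..b}" for s
      using that u_pos[of s] by (simp add: abs_mult)
    from has_integral_norm_bound_integral_component[OF centred square this]
    show ?thesis by simp
  qed
  also have "\<dots> \<le> K * A2" using K Z_pos by simp
  finally have "\<bar>N1 - t * N\<bar> * Z \<le> K * A2 * Z" using Z_pos by (intro mult_right_mono) auto
  also have "\<bar>N1 - t * N\<bar> * Z = \<bar>(N1 - t * N) * Z\<bar>" using Z_pos by (simp add: abs_mult)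
  also have "(N1 - t * N) * Z = N1 * Z - N * A1" by (simp add: A1 algebra_simps)
  finally show ?thesis unfolding N1_def N_def A1_def A2_def .
qed

text \<open>
  The derivative in \<open>m\<close> of the mean of \<open>f\<close> is \<open>\<beta>\<close> times the covariance of \<open>f\<close> with the identity,
  so the two previous bounds combine to a bound on the derivative, uniformly over \<open>m \<in> {a..b}\<close>.
\<close>
lemma truncated_gaussian_mean_contraction:
  fixes a b m m' \<beta> K :: real and f :: "real \<Rightarrow> real"
  assumes ab: "a < b" and \<beta>: "0 < \<beta>" and m: "m \<in> {a..b}" "m' \<in> {a..b}"
    and lip: "\<And>s t. s \<in> {a..b} \<Longrightarrow> t \<in> {a..b} \<Longrightarrow> \<bar>f s - f t\<bar> \<le> K * \<bar>s - t\<bar>"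
    and K: "0 \<le> K"
  defines "u \<equiv> \<lambda>m s. exp (- (\<beta> / 2) * (s - m)\<^sup>2)"
  shows "\<bar>integral {a..b} (\<lambda>s. f s * u m s) / integral {a..b} (u m)
     - integral {a..b} (\<lambda>s. f s * u m' s) / integral {a..b} (u m')\<bar>
    \<le> (1 - exp (- \<beta> * (b - a)\<^sup>2 / 2)) * K * \<bar>m - m'\<bar>"
proof -
  let ?I = "integral {a..b}" and ?c = "1 - exp (- \<beta> * (b - a)\<^sup>2 / 2)"
  have cont: "continuous_on {a..b} f"
    by (rule lipschitz_on_continuous_on[of K])
       (auto intro!: lipschitz_onI simp: dist_real_def lip K)
  have u_cont: "continuous_on S (u m)" for S m unfolding u_def by (intro continuous_intros)
  have deriv: "((\<lambda>m. ?I (\<lambda>s. g s * u m s)) has_real_derivative ?I (\<lambda>s. g s * (u m s * (\<beta> * (s - m)))))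
      (at m within UNIV)" if g: "continuous_on {a..b} g" for g m
    unfolding box_real(2)[symmetric]
  proof (rule leibniz_rule_field_derivative)
    fix x t
    show "((\<lambda>x. g t * u x t) has_real_derivative g t * (u x t * (\<beta> * (t - x)))) (at x within UNIV)"
      unfolding u_def by (rule derivative_eq_intros refl | simp add: power2_eq_square algebra_simps)+
    show "(\<lambda>s. g s * u x s) integrable_on cbox a b"
      unfolding box_real(2) by (intro integrable_continuous_interval continuous_intros g u_cont)
    show "continuous_on (UNIV \<times> cbox a b) (\<lambda>(x, t). g t * (u x t * (\<beta> * (t - x))))"
      unfolding u_def split_beta
      by (intro continuous_intros continuous_on_compose2[OF g]) (auto simp: box_real)
  qed auto
  define Z where "Z m = ?I (u m)" for m
  define N where "N m = ?I (\<lambda>s. f s * u m s)" for m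
  define N1 where "N1 m = ?I (\<lambda>s. f s * ((s - m) * u m s))" for m
  define A1 where "A1 m = ?I (\<lambda>s. (s - m) * u m s)" for m
  have Z_pos: "0 < Z m" for m
    unfolding Z_def u_def by (rule truncated_gaussian_mass_pos[OF ab])
  have dN: "(N has_real_derivative \<beta> * N1 m) (at m within UNIV)" for m
    using deriv[OF cont, of m] unfolding N_def N1_def
    by (auto simp flip: integral_mult_right elim!: DERIV_cong intro!: integral_cong)
  have dZ: "(Z has_real_derivative \<beta> * A1 m) (at m within UNIV)" for m
    using deriv[of "\<lambda>_. 1" m] unfolding Z_def A1_def
    by (auto simp flip: integral_mult_right elim!: DERIV_cong intro!: integral_cong)
  have "norm (N m / Z m - N m' / Z m') \<le> (?c * K) * norm (m - m')"
  proof (rule field_differentiable_bound[of "{a..b}"])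
    fix x assume x: "x \<in> {a..b}"
    have "((\<lambda>m. N m / Z m) has_real_derivative (\<beta> * N1 x * Z x - N x * (\<beta> * A1 x)) / (Z x * Z x)) (at x within UNIV)"
      using Z_pos[of x] by (intro DERIV_divide dN dZ) auto
    then show "((\<lambda>m. N m / Z m) has_real_derivative (\<beta> * N1 x * Z x - N x * (\<beta> * A1 x)) / (Z x * Z x)) (at x within {a..b})"
      by (rule DERIV_subset) simp
    have "\<beta> * N1 x * Z x - N x * (\<beta> * A1 x) = \<beta> * (N1 x * Z x - N x * A1 x)"
      by (simp add: algebra_simps)
    then have "\<bar>\<beta> * N1 x * Z x - N x * (\<beta> * A1 x)\<bar> = \<beta> * \<bar>N1 x * Z x - N x * A1 x\<bar>"
      using \<beta> by (simp add: abs_mult)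
    also have "\<dots> \<le> \<beta> * (K * ?I (\<lambda>s. (s - x)\<^sup>2 * u x s) * Z x)"
      using truncated_gaussian_covariance[OF ab x cont lip[OF _ x] K, of \<beta>] \<beta>
      unfolding N1_def Z_def N_def A1_def u_def by (intro mult_left_mono) auto
    also have "\<dots> = K * Z x * (\<beta> * ?I (\<lambda>s. (s - x)\<^sup>2 * u x s))" by (simp add: algebra_simps)
    also have "\<dots> \<le> K * Z x * (?c * Z x)"
      using truncated_gaussian_second_moment[OF ab \<beta> x] K Z_pos[of x]
      unfolding Z_def u_def by (intro mult_left_mono) auto
    finally show "norm ((\<beta> * N1 x * Z x - N x * (\<beta> * A1 x)) / (Z x * Z x)) \<le> ?c * K"
      using Z_pos[of x] by (simp add: field_simps)
  qed (use m in auto)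
  then show ?thesis unfolding N_def Z_def by simp
qed

section \<open>The Hamiltonian\<close>

context harmonic_crystal
begin

definition \<beta> :: real where "\<beta> = (\<Sum>\<^sub>\<infinity>x. J x)"

lemma \<beta>_pos: "0 < \<beta>"
  unfolding \<beta>_def by (rule J_mass_pos)

lemma bij_translate: "bij_betw (\<lambda>y. y - x) UNIV (UNIV :: 'd site set)"
  by (rule bij_betw_byWitness[of _ "\<lambda>y. y + x"]) auto

lemma J_translate_summable: "(\<lambda>y. J (y - x)) summable_on A"
  using summable_on_reindex_bij_betw[OF bij_translate, of J x] J_summable
  by (auto intro: summable_on_subset)

lemma J_translate_mass: "(\<Sum>\<^sub>\<infinity>y. J (y - x)) = \<beta>"
  unfolding \<beta>_def by (rule infsum_reindex_bij_betw[OF bij_translate])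

lemma J_bounded_summable:
  fixes g :: "'d site \<Rightarrow> real"
  assumes "\<And>y. \<bar>g y\<bar> \<le> B"
  shows "(\<lambda>y. J (y - x) * g y) summable_on A"
proof -
  have "(\<lambda>y. B * J (y - x)) summable_on A"
    by (intro summable_on_cmult_right J_translate_summable)
  then have "(\<lambda>y. norm (J (y - x) * g y)) summable_on A"
    by (rule summable_on_comparison_test)
       (auto simp: abs_mult J_nonneg mult.commute intro!: mult_right_mono assms)
  then show ?thesis by (rule abs_summable_summable)
qed

text \<open>
  The energy that the site \<open>x\<close> adds when it joins a volume \<open>\<Lambda>\<close> not containing it. The term
  \<open>y = x\<close> of the sum vanishes, so it need not be excluded.
\<close>
definition bond_energy :: "'d site \<Rightarrow> 'd site set \<Rightarrow> 'd configuration \<Rightarrow> real" where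
  "bond_energy x \<Lambda> \<eta> = 1 / 2 * (\<Sum>\<^sub>\<infinity>y\<in>-\<Lambda>. J (y - x) * (\<eta> x - \<eta> y)\<^sup>2)"

lemma square_diff_le: "\<eta> \<in> \<Omega> \<Longrightarrow> \<bar>(\<eta> x - \<eta> y)\<^sup>2\<bar> \<le> (b - a)\<^sup>2"
  by (auto simp: configurations_iff abs_le_square_iff[symmetric]) (smt (verit, best))+

lemma square_summable:
  assumes "\<eta> \<in> \<Omega>"
  shows "(\<lambda>y. J (y - x) * (\<eta> x - \<eta> y)\<^sup>2) summable_on A"
  by (rule J_bounded_summable[where B = "(b - a)\<^sup>2"]) (rule square_diff_le[OF assms])

lemma hamiltonian_empty: "hamiltonian J {} \<eta> = 0"
  by (simp add: hamiltonian_def)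

lemma bonds_insert:
  "{e. card e = 2 \<and> \<not> e \<subseteq> - insert x \<Lambda>} =
   {e. card e = 2 \<and> \<not> e \<subseteq> - \<Lambda>} \<union> (\<lambda>y. {x, y}) ` (- insert x \<Lambda>)"
  if "x \<notin> \<Lambda>" for x :: 'a
proof -
  have "e \<in> (\<lambda>y. {x, y}) ` (- insert x \<Lambda>)"
    if "card e = 2" "e \<subseteq> -\<Lambda>" "\<not> e \<subseteq> - insert x \<Lambda>" for e
  proof -
    obtain u v where e: "e = {u, v}" "u \<noteq> v" using \<open>card e = 2\<close> by (auto simp: card_2_iff)
    with that have "u = x \<or> v = x" by auto
    then show ?thesis using e that \<open>x \<notin> \<Lambda>\<close> by (auto simp: image_iff doubleton_eq_iff)
  qed
  then show ?thesis using that by (auto simp: card_2_iff)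
qed

text \<open>
  The bonds meeting \<open>insert x \<Lambda>\<close> but not \<open>\<Lambda>\<close> are those joining \<open>x\<close> to the complement of
  \<open>insert x \<Lambda>\<close>. Building a volume up site by site in this way lets the properties of the
  Hamiltonian be proved for one star of bonds at a time.
\<close>
lemma hamiltonian_insert_aux:
  assumes "finite \<Lambda>" "\<eta> \<in> \<Omega>"
  shows "pair_interaction J \<eta> summable_on {e. card e = 2 \<and> \<not> e \<subseteq> - \<Lambda>}"
    and "x \<notin> \<Lambda> \<Longrightarrow> hamiltonian J (insert x \<Lambda>) \<eta> = hamiltonian J \<Lambda> \<eta> + bond_energy x \<Lambda> \<eta>"
proof -
  have inj: "inj_on (\<lambda>y. {x, y}) A" for x :: "'d site" and A
    by (auto simp: inj_on_def doubleton_eq_iff)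
  have pair: "pair_interaction J \<eta> {x, y} = J (y - x) * (\<eta> x - \<eta> y)\<^sup>2" for x y
    by (rule pair_interaction_eq) (rule J_even)
  have star: "pair_interaction J \<eta> summable_on (\<lambda>y. {x, y}) ` A" for x A
    using square_summable[OF assms(2), of x A]
    by (subst summable_on_reindex[OF inj]) (simp add: o_def pair)
  show sm: "pair_interaction J \<eta> summable_on {e. card e = 2 \<and> \<not> e \<subseteq> - \<Lambda>}"
    using \<open>finite \<Lambda>\<close>
  proof (induction \<Lambda>)
    case (insert x \<Lambda>)
    show ?case unfolding bonds_insert[OF insert.hyps(2)]
      by (intro summable_on_union insert star)
  qed simp
  assume x: "x \<notin> \<Lambda>"
  have "infsum (pair_interaction J \<eta>) {e. card e = 2 \<and> \<not> e \<subseteq> - insert x \<Lambda>} =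
    infsum (pair_interaction J \<eta>) {e. card e = 2 \<and> \<not> e \<subseteq> - \<Lambda>} +
    infsum (pair_interaction J \<eta>) ((\<lambda>y. {x, y}) ` (- insert x \<Lambda>))"
    unfolding bonds_insert[OF x] using x by (intro infsum_Un_disjoint sm star) auto
  also have "infsum (pair_interaction J \<eta>) ((\<lambda>y. {x, y}) ` (- insert x \<Lambda>)) =
    (\<Sum>\<^sub>\<infinity>y\<in>- insert x \<Lambda>. J (y - x) * (\<eta> x - \<eta> y)\<^sup>2)"
    by (subst infsum_reindex[OF inj]) (simp add: o_def pair)
  also have "\<dots> = (\<Sum>\<^sub>\<infinity>y\<in>-\<Lambda>. J (y - x) * (\<eta> x - \<eta> y)\<^sup>2)"
    by (rule infsum_cong_neutral) auto
  finally show "hamiltonian J (insert x \<Lambda>) \<eta> = hamiltonian J \<Lambda> \<eta> + bond_energy x \<Lambda> \<eta>"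
    by (simp add: hamiltonian_def bond_energy_def distrib_left)
qed

lemmas hamiltonian_insert = hamiltonian_insert_aux(2)

text \<open>
  Each bond energy is Lipschitz in its two endpoints with constant \<open>(b - a) * J (y - x)\<close>. Summing over
  the star of \<open>x\<close>, the endpoint \<open>x\<close> accumulates the weight \<open>(b - a) * \<beta>\<close>.
\<close>
lemma quasilocal_bond_energy: "quasilocal (bond_energy x \<Lambda>)"
proof -
  define L where "L z = (b - a) * (J (z - x) + (if z = x then \<beta> else 0))" for z
  have L0: "0 \<le> L z" for z using a_less_b J_nonneg \<beta>_pos by (auto simp: L_def)
  have one: "(\<lambda>z. if z = x then \<beta> else 0) summable_on UNIV"
    by (rule finite_nonzero_values_imp_summable_on) auto
  have L1: "L summable_on UNIV"
    unfolding L_def by (intro summable_on_cmult_right summable_on_add J_translate_summable one)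
  have "weighted_lipschitz L (bond_energy x \<Lambda>)"
  proof (rule weighted_lipschitzI[OF L0 L1])
    fix \<eta> \<eta>' assume \<eta>: "\<eta> \<in> \<Omega>" "\<eta>' \<in> \<Omega>"
    define D where "D z = \<bar>\<eta> z - \<eta>' z\<bar>" for z
    have D: "\<bar>D z\<bar> \<le> b - a" for z unfolding D_def using diff_le[OF \<eta>] by simp
    have bound: "(b - a) * (D x + D y) \<ge> \<bar>(\<eta> x - \<eta> y)\<^sup>2 / 2 - (\<eta>' x - \<eta>' y)\<^sup>2 / 2\<bar>" for y
    proof -
      have "(\<eta> x - \<eta> y)\<^sup>2 / 2 - (\<eta>' x - \<eta>' y)\<^sup>2 / 2 =
        ((\<eta> x - \<eta> y + (\<eta>' x - \<eta>' y)) / 2) * ((\<eta> x - \<eta>' x) - (\<eta> y - \<eta>' y))"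
        by (simp add: power2_eq_square field_simps)
      also have "\<bar>\<dots>\<bar> \<le> (b - a) * (D x + D y)"
        unfolding abs_mult
      proof (rule mult_mono)
        show "\<bar>(\<eta> x - \<eta> y + (\<eta>' x - \<eta>' y)) / 2\<bar> \<le> b - a"
          using \<eta>[unfolded configurations_iff, rule_format, of x]
            \<eta>[unfolded configurations_iff, rule_format, of y] by (simp add: abs_le_iff)
      qed (use a_less_b in \<open>auto simp: D_def\<close>)
      finally show ?thesis .
    qed
    have s1: "(\<lambda>y. J (y - x) * ((\<eta> x - \<eta> y)\<^sup>2 / 2 - (\<eta>' x - \<eta>' y)\<^sup>2 / 2)) summable_on A" for A
    proof (rule J_bounded_summable)
      show "\<bar>(\<eta> x - \<eta> y)\<^sup>2 / 2 - (\<eta>' x - \<eta>' y)\<^sup>2 / 2\<bar> \<le> (b - a)\<^sup>2" for y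
        using square_diff_le[OF \<eta>(1), of x y] square_diff_le[OF \<eta>(2), of x y]
          zero_le_power2[of "\<eta> x - \<eta> y"] zero_le_power2[of "\<eta>' x - \<eta>' y"] by linarith
    qed
    have s2: "(\<lambda>y. J (y - x) * ((b - a) * (D x + D y))) summable_on A" for A
    proof (rule J_bounded_summable)
      have "\<bar>D x + D y\<bar> \<le> 2 * (b - a)" for y
        using abs_triangle_ineq[of "D x" "D y"] D[of x] D[of y] by simp
      then show "\<bar>(b - a) * (D x + D y)\<bar> \<le> (b - a) * (2 * (b - a))" for y
        using a_less_b by (simp only: abs_mult) (auto intro: mult_left_mono)
    qed
    have "bond_energy x \<Lambda> \<eta> - bond_energy x \<Lambda> \<eta>' =
      (\<Sum>\<^sub>\<infinity>y\<in>-\<Lambda>. J (y - x) * ((\<eta> x - \<eta> y)\<^sup>2 / 2 - (\<eta>' x - \<eta>' y)\<^sup>2 / 2))"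
    proof -
      have "(\<Sum>\<^sub>\<infinity>y\<in>-\<Lambda>. J (y - x) * ((\<eta> x - \<eta> y)\<^sup>2 / 2 - (\<eta>' x - \<eta>' y)\<^sup>2 / 2)) =
        (\<Sum>\<^sub>\<infinity>y\<in>-\<Lambda>. 1 / 2 * (J (y - x) * (\<eta> x - \<eta> y)\<^sup>2) + (- 1 / 2) * (J (y - x) * (\<eta>' x - \<eta>' y)\<^sup>2))"
        by (rule infsum_cong) (simp add: algebra_simps)
      also have "\<dots> = 1 / 2 * (\<Sum>\<^sub>\<infinity>y\<in>-\<Lambda>. J (y - x) * (\<eta> x - \<eta> y)\<^sup>2)
          + (- 1 / 2) * (\<Sum>\<^sub>\<infinity>y\<in>-\<Lambda>. J (y - x) * (\<eta>' x - \<eta>' y)\<^sup>2)"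
        by (intro infsumI has_sum_add has_sum_cmult_right has_sum_infsum square_summable \<eta>)
      finally show ?thesis by (simp add: bond_energy_def)
    qed
    also have "\<bar>\<dots>\<bar> \<le> (\<Sum>\<^sub>\<infinity>y\<in>-\<Lambda>. J (y - x) * ((b - a) * (D x + D y)))"
      using norm_infsum_le[OF has_sum_infsum[OF s1] has_sum_infsum[OF s2], of "-\<Lambda>"] bound J_nonneg
      by (auto simp: abs_mult intro!: mult_left_mono)
    also have "\<dots> \<le> (\<Sum>\<^sub>\<infinity>y. J (y - x) * ((b - a) * (D x + D y)))"
      using J_nonneg a_less_b by (intro infsum_mono2 s2) (auto simp: D_def)
    also have "\<dots> = (\<Sum>\<^sub>\<infinity>y. (b - a) * D x * J (y - x) + (b - a) * (J (y - x) * D y))"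
      by (rule infsum_cong) (simp add: algebra_simps)
    also have "\<dots> = (b - a) * D x * \<beta> + (b - a) * (\<Sum>\<^sub>\<infinity>y. J (y - x) * D y)"
      by (subst infsum_add)
         (auto simp: infsum_cmult_right' J_translate_mass
           intro!: summable_on_cmult_right J_translate_summable J_bounded_summable D)
    also have "\<dots> = (b - a) * ((\<Sum>\<^sub>\<infinity>z. J (z - x) * D z) + (\<Sum>\<^sub>\<infinity>z. (if z = x then \<beta> else 0) * D z))"
    proof -
      have "(\<Sum>\<^sub>\<infinity>z. (if z = x then \<beta> else 0) * D z) = (\<Sum>\<^sub>\<infinity>z\<in>{x}. \<beta> * D z)"
        by (rule infsum_cong_neutral) auto
      then show ?thesis by (simp add: algebra_simps)
    qed
    also have "\<dots> = (\<Sum>\<^sub>\<infinity>z. L z * \<bar>\<eta> z - \<eta>' z\<bar>)"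
      using \<beta>_pos J_nonneg unfolding L_def D_def weighted_sum_cmult
      by (subst weighted_sum_add[OF \<eta>]) (auto intro: J_translate_summable one)
    finally show "\<bar>bond_energy x \<Lambda> \<eta> - bond_energy x \<Lambda> \<eta>'\<bar> \<le> (\<Sum>\<^sub>\<infinity>z. L z * \<bar>\<eta> z - \<eta>' z\<bar>)" .
  qed
  then show ?thesis unfolding quasilocal_def by auto
qed

lemma quasilocal_hamiltonian: "finite \<Lambda> \<Longrightarrow> quasilocal (hamiltonian J \<Lambda>)"
proof (induction \<Lambda> rule: finite_induct)
  case empty
  show ?case by (simp add: hamiltonian_empty quasilocal_const)
next
  case (insert x \<Lambda>)
  show ?case
    by (rule quasilocal_cong[OF quasilocal_add[OF insert.IH quasilocal_bond_energy[of x \<Lambda>]]])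
       (rule hamiltonian_insert[OF insert.hyps(1) _ insert.hyps(2)])
qed

text \<open>
  The energy of the bonds that avoid \<open>\<Lambda>\<close> depends only on the spins off \<open>\<Lambda>\<close>. Consistency of the
  specification rests on this.
\<close>
lemma hamiltonian_boundary_part:
  assumes "finite \<Delta>" "finite \<Lambda>" "\<Lambda> \<inter> \<Delta> = {}" "\<eta> \<in> \<Omega>" "\<eta>' \<in> \<Omega>" "\<And>x. x \<notin> \<Lambda> \<Longrightarrow> \<eta> x = \<eta>' x"
  shows "hamiltonian J (\<Lambda> \<union> \<Delta>) \<eta> - hamiltonian J \<Lambda> \<eta> = hamiltonian J (\<Lambda> \<union> \<Delta>) \<eta>' - hamiltonian J \<Lambda> \<eta>'"
  using assms(1,3)
proof (induction \<Delta> rule: finite_induct)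
  case (insert x \<Delta>)
  have "bond_energy x (\<Lambda> \<union> \<Delta>) \<eta> = bond_energy x (\<Lambda> \<union> \<Delta>) \<eta>'"
    using insert.prems assms(6) by (auto simp: bond_energy_def intro!: infsum_cong)
  moreover have "hamiltonian J (\<Lambda> \<union> insert x \<Delta>) \<xi> = hamiltonian J (\<Lambda> \<union> \<Delta>) \<xi> + bond_energy x (\<Lambda> \<union> \<Delta>) \<xi>"
    if "\<xi> \<in> \<Omega>" for \<xi>
    using hamiltonian_insert[of "\<Lambda> \<union> \<Delta>" \<xi> x] insert assms(2) that by auto
  ultimately show ?case using insert assms(4,5) by auto
qed simp

definition local_mean :: "'d site \<Rightarrow> 'd configuration \<Rightarrow> real" where
  "local_mean x \<gamma> = (\<Sum>\<^sub>\<infinity>y. J (y - x) / \<beta> * \<gamma> y)"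

lemma configuration_abs_le: "\<gamma> \<in> \<Omega> \<Longrightarrow> \<bar>\<gamma> y\<bar> \<le> \<bar>a\<bar> + \<bar>b\<bar>"
  by (auto simp: configurations_iff abs_le_iff) (smt (verit, best))+

lemma local_mean_mem:
  assumes "\<gamma> \<in> \<Omega>"
  shows "local_mean x \<gamma> \<in> {a..b}"
proof -
  have s: "(\<lambda>y. J (y - x) * \<gamma> y) summable_on UNIV"
    by (rule J_bounded_summable) (rule configuration_abs_le[OF assms])
  have "(\<Sum>\<^sub>\<infinity>y. J (y - x) * \<gamma> y) = \<beta> * local_mean x \<gamma>"
    unfolding local_mean_def using \<beta>_pos by (simp flip: infsum_cmult_right' add: field_simps)
  then have eq: "local_mean x \<gamma> = (\<Sum>\<^sub>\<infinity>y. J (y - x) * \<gamma> y) / \<beta>" using \<beta>_pos by simp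
  have "(\<Sum>\<^sub>\<infinity>y. J (y - x) * a) \<le> (\<Sum>\<^sub>\<infinity>y. J (y - x) * \<gamma> y)"
    using assms J_nonneg
    by (intro infsum_mono s summable_on_cmult_left J_translate_summable)
       (auto simp: configurations_iff intro!: mult_left_mono)
  moreover have "(\<Sum>\<^sub>\<infinity>y. J (y - x) * \<gamma> y) \<le> (\<Sum>\<^sub>\<infinity>y. J (y - x) * b)"
    using assms J_nonneg
    by (intro infsum_mono s summable_on_cmult_left J_translate_summable)
       (auto simp: configurations_iff intro!: mult_left_mono)
  ultimately show ?thesis
    using \<beta>_pos unfolding infsum_cmult_left' J_translate_mass by (simp add: eq pos_le_divide_eq pos_divide_le_eq mult.commute)
qed

text \<open>
  Completing the square in \<open>s\<close>: the conditional law of one spin is a Gaussian of precision \<open>\<beta>\<close> around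
  the local mean, restricted to the interval.
\<close>
lemma hamiltonian_single:
  assumes "\<gamma> \<in> \<Omega>"
  obtains C where "\<And>s. s \<in> {a..b} \<Longrightarrow>
    hamiltonian J {x} (\<gamma>(x := s)) = \<beta> / 2 * (s - local_mean x \<gamma>)\<^sup>2 + C"
proof (rule that)
  fix s assume s: "s \<in> {a..b}"
  let ?m = "local_mean x \<gamma>"
  define Q where "Q = (\<Sum>\<^sub>\<infinity>y. J (y - x) * (\<gamma> y)\<^sup>2)"
  have \<gamma>s: "\<gamma>(x := s) \<in> \<Omega>" using assms s by (auto simp: configurations_iff)
  have s1: "(\<lambda>y. J (y - x) * \<gamma> y) summable_on UNIV"
    by (rule J_bounded_summable) (rule configuration_abs_le[OF assms])
  have s2: "(\<lambda>y. J (y - x) * (\<gamma> y)\<^sup>2) summable_on UNIV"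
    using configuration_abs_le[OF assms]
    by (intro J_bounded_summable[where B = "(\<bar>a\<bar> + \<bar>b\<bar>)\<^sup>2"])
       (auto simp: abs_le_square_iff[symmetric])
  have m: "(\<Sum>\<^sub>\<infinity>y. J (y - x) * \<gamma> y) = \<beta> * ?m"
    unfolding local_mean_def using \<beta>_pos by (simp flip: infsum_cmult_right' add: field_simps)
  have "hamiltonian J {x} (\<gamma>(x := s)) = bond_energy x {} (\<gamma>(x := s))"
    using hamiltonian_insert[of "{}" "\<gamma>(x := s)" x] \<gamma>s by (simp add: hamiltonian_empty)
  also have "\<dots> = 1 / 2 * (\<Sum>\<^sub>\<infinity>y. (s\<^sup>2 * J (y - x) + (- 2 * s) * (J (y - x) * \<gamma> y)) + J (y - x) * (\<gamma> y)\<^sup>2)"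
    unfolding bond_energy_def
    by (intro arg_cong[of _ _ "(*) (1/2)"] infsum_cong_neutral)
       (auto simp: J_zero power2_eq_square algebra_simps)
  also have "\<dots> = 1 / 2 * (s\<^sup>2 * \<beta> + (- 2 * s) * (\<beta> * ?m) + Q)"
  proof -
    have mass: "((\<lambda>y. J (y - x)) has_sum \<beta>) UNIV"
      unfolding has_sum_iff by (simp add: J_translate_summable J_translate_mass)
    have "((\<lambda>y. (s\<^sup>2 * J (y - x) + (- 2 * s) * (J (y - x) * \<gamma> y)) + J (y - x) * (\<gamma> y)\<^sup>2)
        has_sum (s\<^sup>2 * \<beta> + (- 2 * s) * (\<beta> * ?m)) + Q) UNIV"
      unfolding Q_def m[symmetric]
      by (intro has_sum_add has_sum_cmult_right has_sum_infsum s1 s2 mass)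
    then show ?thesis by (simp only: infsumI)
  qed
  also have "\<dots> = \<beta> / 2 * (s - ?m)\<^sup>2 + (Q / 2 - \<beta> / 2 * ?m\<^sup>2)"
    by (simp add: power2_eq_square field_simps)
  finally show "hamiltonian J {x} (\<gamma>(x := s)) = \<beta> / 2 * (s - ?m)\<^sup>2 +
    ((\<Sum>\<^sub>\<infinity>y. J (y - x) * (\<gamma> y)\<^sup>2) / 2 - \<beta> / 2 * ?m\<^sup>2)" unfolding Q_def .
qed

lemma local_mean_diff:
  assumes \<eta>: "\<eta> \<in> \<Omega>" "\<eta>' \<in> \<Omega>"
  shows "\<bar>local_mean x \<eta> - local_mean x \<eta>'\<bar> \<le> (\<Sum>\<^sub>\<infinity>y. J (y - x) / \<beta> * \<bar>\<eta> y - \<eta>' y\<bar>)"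
proof -
  have s: "(\<lambda>y. J (y - x) / \<beta> * g y) summable_on UNIV" if "\<And>y. \<bar>g y\<bar> \<le> B" for B g
    using summable_on_cmult_right[OF J_bounded_summable[of g B x UNIV, OF that], of "1 / \<beta>"] by simp
  note s1 = s[of \<eta>, OF configuration_abs_le[OF \<eta>(1)]] s[of \<eta>', OF configuration_abs_le[OF \<eta>(2)]]
  have sum_diff: "((\<lambda>y. J (y - x) / \<beta> * \<eta> y + - (J (y - x) / \<beta> * \<eta>' y)) has_sum
      local_mean x \<eta> + - local_mean x \<eta>') UNIV"
    unfolding local_mean_def by (intro has_sum_add has_sum_uminusI has_sum_infsum s1)
  have "((\<lambda>y. J (y - x) / \<beta> * \<bar>\<eta> y - \<eta>' y\<bar>) has_sum (\<Sum>\<^sub>\<infinity>y. J (y - x) / \<beta> * \<bar>\<eta> y - \<eta>' y\<bar>)) UNIV"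
    by (intro has_sum_infsum s[of _ "b - a"]) (use diff_le[OF \<eta>] in auto)
  moreover have "norm (J (y - x) / \<beta> * \<eta> y + - (J (y - x) / \<beta> * \<eta>' y)) \<le> J (y - x) / \<beta> * \<bar>\<eta> y - \<eta>' y\<bar>" for y
  proof -
    have "J (y - x) / \<beta> * \<eta> y + - (J (y - x) / \<beta> * \<eta>' y) = J (y - x) / \<beta> * (\<eta> y - \<eta>' y)"
      by (simp add: right_diff_distrib)
    then show ?thesis using \<beta>_pos J_nonneg by (simp add: abs_mult)
  qed
  ultimately show ?thesis using norm_infsum_le[OF sum_diff] by fastforce
qed

section \<open>Integration over finitely many spins\<close>

abbreviation \<B> :: "'d configuration measure" where
  "\<B> \<equiv> restrict_space borel \<Omega>"

text \<open>
  Quasilocal functions do not include the indicators needed for the marginals, hence this larger class.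
\<close>
definition observable :: "('d configuration \<Rightarrow> real) \<Rightarrow> bool" where
  "observable f \<longleftrightarrow> f \<in> borel_measurable \<B> \<and> (\<exists>B. \<forall>\<eta>\<in>\<Omega>. \<bar>f \<eta>\<bar> \<le> B)"

lemma observableI:
  "f \<in> borel_measurable \<B> \<Longrightarrow> (\<And>\<eta>. \<eta> \<in> \<Omega> \<Longrightarrow> \<bar>f \<eta>\<bar> \<le> B) \<Longrightarrow> observable f"
  unfolding observable_def by auto

lemma observable_measurable: "observable f \<Longrightarrow> f \<in> borel_measurable \<B>"
  unfolding observable_def by simp

lemma observable_bound:
  assumes "observable f"
  obtains B where "0 \<le> B" "\<And>\<eta>. \<eta> \<in> \<Omega> \<Longrightarrow> \<bar>f \<eta>\<bar> \<le> B"
proof -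
  obtain B where "\<forall>\<eta>\<in>\<Omega>. \<bar>f \<eta>\<bar> \<le> B" using assms unfolding observable_def by auto
  then show ?thesis by (intro that[of "max 0 B"]) auto
qed

lemma quasilocal_observable:
  assumes "quasilocal f"
  shows "observable f"
proof -
  obtain B where "\<And>\<eta>. \<eta> \<in> \<Omega> \<Longrightarrow> \<bar>f \<eta>\<bar> \<le> B" using quasilocal_bounded[OF assms] by blast
  then show ?thesis by (intro observableI quasilocal_measurable assms)
qed

lemma observable_mult:
  assumes "observable f" "observable g"
  shows "observable (\<lambda>\<eta>. f \<eta> * g \<eta>)"
proof -
  obtain B C where "0 \<le> B" "0 \<le> C" "\<And>\<eta>. \<eta> \<in> \<Omega> \<Longrightarrow> \<bar>f \<eta>\<bar> \<le> B" "\<And>\<eta>. \<eta> \<in> \<Omega> \<Longrightarrow> \<bar>g \<eta>\<bar> \<le> C"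
    using assms by (metis observable_bound)
  then show ?thesis
    using assms[THEN observable_measurable]
    by (intro observableI[where B = "B * C"]) (auto simp: abs_mult intro!: mult_mono)
qed

lemma observable_diff:
  assumes "observable f" "observable g"
  shows "observable (\<lambda>\<eta>. f \<eta> - g \<eta>)"
proof -
  obtain B C where BC: "\<And>\<eta>. \<eta> \<in> \<Omega> \<Longrightarrow> \<bar>f \<eta>\<bar> \<le> B" "\<And>\<eta>. \<eta> \<in> \<Omega> \<Longrightarrow> \<bar>g \<eta>\<bar> \<le> C"
    using assms by (metis observable_bound)
  show ?thesis
    using assms[THEN observable_measurable] BC
    by (intro observableI[where B = "B + C"]) (auto, smt (verit))
qed

lemma space_\<B>: "space \<B> = \<Omega>"
  by (simp add: space_restrict_space)

lemma measurable_into_\<B>: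
  assumes "\<And>\<omega>. \<omega> \<in> space M \<Longrightarrow> f \<omega> \<in> \<Omega>" "\<And>x. (\<lambda>\<omega>. f \<omega> x) \<in> borel_measurable M"
  shows "f \<in> M \<rightarrow>\<^sub>M \<B>"
  using assms by (intro measurable_restrict_space2 measurable_coordinatewise_then_product) auto

lemma measurable_coordinate: "(\<lambda>\<eta>. \<eta> x) \<in> borel_measurable \<B>"
  using quasilocal_measurable[OF quasilocal_coordinate] .

abbreviation spin_box :: "'d site set \<Rightarrow> 'd configuration measure" where
  "spin_box \<equiv> lebesgue_box a b"

lemma space_box: "space (spin_box \<Lambda>) = \<Lambda> \<rightarrow>\<^sub>E {a..b}"
  by (simp add: lebesgue_box_def space_PiM space_restrict_space)

lemma interval_measure: "emeasure (restrict_space lborel {a..b}) {a..b} = ennreal (b - a)"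
  using a_less_b by (subst emeasure_restrict_space) auto

lemma finite_measure_interval: "finite_measure (restrict_space lborel {a..b})"
  using interval_measure by (intro finite_measureI) (auto simp: space_restrict_space)

lemma product_sigma_finite_interval:
  "product_sigma_finite (\<lambda>_ :: 'd site. restrict_space lborel {a..b})"
  using finite_measure_interval by (simp add: product_sigma_finite_def finite_measure.axioms)

lemma box_total: "finite \<Lambda> \<Longrightarrow> emeasure (spin_box \<Lambda>) (space (spin_box \<Lambda>)) = ennreal ((b - a) ^ card \<Lambda>)"
  using product_sigma_finite.emeasure_PiM[OF product_sigma_finite_interval, of \<Lambda> "\<lambda>_. {a..b}"] a_less_b
    sets.top[of "restrict_space lborel {a..b}"]
  unfolding space_box
  by (simp add: lebesgue_box_def interval_measure prod_constant ennreal_power space_restrict_space)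

lemma finite_measure_box: "finite \<Lambda> \<Longrightarrow> finite_measure (spin_box \<Lambda>)"
  by (intro finite_measureI) (simp add: box_total)

lemma measure_box: "finite \<Lambda> \<Longrightarrow> measure (spin_box \<Lambda>) (space (spin_box \<Lambda>)) = (b - a) ^ card \<Lambda>"
  using a_less_b by (simp add: measure_def box_total)

lemma override_mem:
  "\<gamma> \<in> \<Omega> \<Longrightarrow> \<eta> \<in> space (spin_box \<Lambda>) \<Longrightarrow> override_on \<gamma> \<eta> \<Lambda> \<in> \<Omega>"
  by (auto simp: configurations_iff space_box override_on_def PiE_def Pi_def)

lemma measurable_box_component: "x \<in> \<Lambda> \<Longrightarrow> (\<lambda>\<eta>. \<eta> x) \<in> borel_measurable (spin_box \<Lambda>)"
  unfolding lebesgue_box_def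
  by (rule measurable_compose[OF measurable_component_singleton, where g = "\<lambda>s. s"])
     (auto intro!: measurable_restrict_space1)

lemma measurable_override:
  "(\<lambda>(\<gamma>, \<eta>). override_on \<gamma> \<eta> \<Lambda>) \<in> \<B> \<Otimes>\<^sub>M spin_box \<Lambda> \<rightarrow>\<^sub>M \<B>"
proof (rule measurable_into_\<B>)
  fix x
  show "(\<lambda>\<omega>. (case \<omega> of (\<gamma>, \<eta>) \<Rightarrow> override_on \<gamma> \<eta> \<Lambda>) x) \<in> borel_measurable (\<B> \<Otimes>\<^sub>M spin_box \<Lambda>)"
  proof (cases "x \<in> \<Lambda>")
    case True
    have "(\<lambda>\<omega>. snd \<omega> x) \<in> borel_measurable (\<B> \<Otimes>\<^sub>M spin_box \<Lambda>)"
      by (rule measurable_compose[OF measurable_snd measurable_box_component[OF True]])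
    then show ?thesis using True by (simp add: override_on_def split_beta)
  next
    case False
    have "(\<lambda>\<omega>. fst \<omega> x) \<in> borel_measurable (\<B> \<Otimes>\<^sub>M spin_box \<Lambda>)"
      by (rule measurable_compose[OF measurable_fst measurable_coordinate])
    then show ?thesis using False by (simp add: override_on_def split_beta)
  qed
qed (auto simp: space_pair_measure space_\<B> override_mem)

lemma measurable_override_right:
  "\<gamma> \<in> \<Omega> \<Longrightarrow> (\<lambda>\<eta>. override_on \<gamma> \<eta> \<Lambda>) \<in> spin_box \<Lambda> \<rightarrow>\<^sub>M \<B>"
  using measurable_compose[OF measurable_Pair1' measurable_override, of \<gamma> \<Lambda>]
  by (simp add: space_\<B>)

lemma observable_override_measurable:
  assumes "observable g" "\<gamma> \<in> \<Omega>"
  shows "(\<lambda>\<eta>. g (override_on \<gamma> \<eta> \<Lambda>)) \<in> borel_measurable (spin_box \<Lambda>)"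
  using measurable_compose[OF measurable_override_right observable_measurable] assms by blast

lemma observable_override_integrable:
  assumes "observable g" "\<gamma> \<in> \<Omega>" "finite \<Lambda>"
  shows "integrable (spin_box \<Lambda>) (\<lambda>\<eta>. g (override_on \<gamma> \<eta> \<Lambda>))"
proof -
  obtain B where B: "\<And>\<eta>. \<eta> \<in> \<Omega> \<Longrightarrow> \<bar>g \<eta>\<bar> \<le> B" using observable_bound[OF assms(1)] by blast
  show ?thesis
    using B override_mem[OF assms(2)]
    by (intro finite_measure.integrable_const_bound[OF finite_measure_box[OF assms(3)], of _ B]
          observable_override_measurable[OF assms(1,2)]) auto
qed

definition box_integral :: "'d site set \<Rightarrow> ('d configuration \<Rightarrow> real) \<Rightarrow> 'd configuration \<Rightarrow> real" where
  "box_integral \<Lambda> g \<gamma> = (\<integral>\<eta>. g (override_on \<gamma> \<eta> \<Lambda>) \<partial>spin_box \<Lambda>)"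

lemma box_integral_cong:
  assumes "\<gamma> \<in> \<Omega>" "\<And>\<eta>. \<eta> \<in> space (spin_box \<Lambda>) \<Longrightarrow> f (override_on \<gamma> \<eta> \<Lambda>) = g (override_on \<gamma> \<eta> \<Lambda>)"
  shows "box_integral \<Lambda> f \<gamma> = box_integral \<Lambda> g \<gamma>"
  unfolding box_integral_def using assms by (intro Bochner_Integration.integral_cong) auto

lemma box_integral_mono:
  assumes "observable f" "observable g" "\<gamma> \<in> \<Omega>" "finite \<Lambda>"
    "\<And>\<eta>. \<eta> \<in> space (spin_box \<Lambda>) \<Longrightarrow> f (override_on \<gamma> \<eta> \<Lambda>) \<le> g (override_on \<gamma> \<eta> \<Lambda>)"
  shows "box_integral \<Lambda> f \<gamma> \<le> box_integral \<Lambda> g \<gamma>"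
  unfolding box_integral_def using assms
  by (intro integral_mono observable_override_integrable) auto

lemma box_integral_const: "finite \<Lambda> \<Longrightarrow> box_integral \<Lambda> (\<lambda>_. c) \<gamma> = (b - a) ^ card \<Lambda> * c"
  unfolding box_integral_def by (simp add: measure_box)

lemma observable_const: "observable (\<lambda>_. c)"
  by (rule quasilocal_observable[OF quasilocal_const])

lemma box_integral_bound:
  assumes "observable f" "\<gamma> \<in> \<Omega>" "finite \<Lambda>"
    "\<And>\<eta>. \<eta> \<in> space (spin_box \<Lambda>) \<Longrightarrow> \<bar>f (override_on \<gamma> \<eta> \<Lambda>)\<bar> \<le> B"
  shows "\<bar>box_integral \<Lambda> f \<gamma>\<bar> \<le> (b - a) ^ card \<Lambda> * B"
proof -
  have "\<bar>box_integral \<Lambda> f \<gamma>\<bar> \<le> (\<integral>\<eta>. \<bar>f (override_on \<gamma> \<eta> \<Lambda>)\<bar> \<partial>spin_box \<Lambda>)"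
    unfolding box_integral_def by (rule integral_abs_bound)
  also have "\<dots> \<le> (\<integral>\<eta>. B \<partial>spin_box \<Lambda>)"
    using assms
    by (intro integral_mono integrable_abs observable_override_integrable
          finite_measure.integrable_const finite_measure_box) auto
  finally show ?thesis using assms(3) by (simp add: measure_box)
qed

lemma observable_box_integral:
  assumes "observable f" "finite \<Lambda>"
  shows "observable (box_integral \<Lambda> f)"
proof -
  obtain B where B: "\<And>\<eta>. \<eta> \<in> \<Omega> \<Longrightarrow> \<bar>f \<eta>\<bar> \<le> B" using observable_bound[OF assms(1)] by blast
  show ?thesis
  proof (rule observableI)
    interpret finite_measure "spin_box \<Lambda>" using assms(2) by (rule finite_measure_box)
    show "box_integral \<Lambda> f \<in> borel_measurable \<B>"
      unfolding box_integral_def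
      using measurable_compose[OF measurable_override observable_measurable[OF assms(1)]]
      by (intro borel_measurable_lebesgue_integral) (simp add: split_beta')
    show "\<bar>box_integral \<Lambda> f \<eta>\<bar> \<le> (b - a) ^ card \<Lambda> * B" if "\<eta> \<in> \<Omega>" for \<eta>
      using B that assms override_mem by (intro box_integral_bound) auto
  qed
qed

text \<open>
  Fubini's theorem for the spins in two disjoint volumes.
\<close>
lemma box_integral_Un:
  assumes "observable g" "\<gamma> \<in> \<Omega>" "finite \<Lambda>" "finite \<Delta>" "\<Lambda> \<inter> \<Delta> = {}"
  shows "box_integral (\<Lambda> \<union> \<Delta>) g \<gamma> = box_integral \<Delta> (box_integral \<Lambda> g) \<gamma>"
proof -
  let ?M = "\<lambda>_ :: 'd site. restrict_space lborel {a..b}"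
  have "integrable (Pi\<^sub>M (\<Delta> \<union> \<Lambda>) ?M) (\<lambda>\<eta>. g (override_on \<gamma> \<eta> (\<Delta> \<union> \<Lambda>)))"
    using observable_override_integrable[OF assms(1,2), of "\<Delta> \<union> \<Lambda>"] assms(3,4)
    by (simp add: lebesgue_box_def)
  then have "box_integral (\<Delta> \<union> \<Lambda>) g \<gamma> =
    (\<integral>\<xi>. \<integral>\<zeta>. g (override_on \<gamma> (merge \<Delta> \<Lambda> (\<xi>, \<zeta>)) (\<Delta> \<union> \<Lambda>)) \<partial>Pi\<^sub>M \<Lambda> ?M \<partial>Pi\<^sub>M \<Delta> ?M)"
    unfolding box_integral_def lebesgue_box_def using assms
    by (intro product_sigma_finite.product_integral_fold[OF product_sigma_finite_interval]) auto
  moreover have "override_on \<gamma> (merge \<Delta> \<Lambda> (\<xi>, \<zeta>)) (\<Delta> \<union> \<Lambda>) = override_on (override_on \<gamma> \<xi> \<Delta>) \<zeta> \<Lambda>" for \<xi> \<zeta>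
    using assms(5) by (auto simp: override_on_def merge_def fun_eq_iff)
  ultimately show ?thesis by (simp add: box_integral_def lebesgue_box_def Un_commute)
qed

lemma box_integral_mult_invariant:
  assumes "\<gamma> \<in> \<Omega>" "\<And>\<eta>. \<eta> \<in> space (spin_box \<Lambda>) \<Longrightarrow> h (override_on \<gamma> \<eta> \<Lambda>) = h \<gamma>"
  shows "box_integral \<Lambda> (\<lambda>\<eta>. h \<eta> * g \<eta>) \<gamma> = h \<gamma> * box_integral \<Lambda> g \<gamma>"
proof -
  have "box_integral \<Lambda> (\<lambda>\<eta>. h \<eta> * g \<eta>) \<gamma> = box_integral \<Lambda> (\<lambda>\<eta>. h \<gamma> * g \<eta>) \<gamma>"
    using assms by (intro box_integral_cong) auto
  then show ?thesis by (simp add: box_integral_def)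
qed

lemma box_integral_singleton:
  assumes "quasilocal g" "\<gamma> \<in> \<Omega>"
  shows "box_integral {x} g \<gamma> = integral {a..b} (\<lambda>s. g (\<gamma>(x := s)))"
proof -
  have ov: "override_on \<gamma> \<eta> {x} = \<gamma>(x := \<eta> x)" for \<eta> by (auto simp: override_on_def)
  have mem: "\<gamma>(x := s) \<in> \<Omega>" if "s \<in> {a..b}" for s
    using assms that by (auto simp: configurations_iff)
  have upd: "continuous_on {a..b} (\<lambda>s. \<gamma>(x := s))"
  proof (rule continuous_on_coordinatewise_then_product)
    show "continuous_on {a..b} (\<lambda>s. (\<gamma>(x := s)) i)" for i
      by (cases "i = x") (auto intro!: continuous_intros)
  qed
  have cont: "continuous_on {a..b} (\<lambda>s. g (\<gamma>(x := s)))"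
    using mem by (intro continuous_on_compose2[OF quasilocal_continuous[OF assms(1)] upd]) auto
  then have "(\<lambda>s. g (\<gamma>(x := s))) \<in> borel_measurable (restrict_space lborel {a..b})"
    using borel_measurable_continuous_on_restrict[OF cont] by (simp cong: measurable_cong_sets sets_restrict_space_cong)
  then have "box_integral {x} g \<gamma> = (\<integral>s. g (\<gamma>(x := s)) \<partial>restrict_space lborel {a..b})"
    unfolding box_integral_def lebesgue_box_def ov
    by (rule product_sigma_finite.product_integral_singleton[OF product_sigma_finite_interval])
  also have "\<dots> = (LINT s:{a..b}|lborel. g (\<gamma>(x := s)))"
    by (subst integral_restrict_space) (auto simp: set_lebesgue_integral_def)
  also have "\<dots> = integral {a..b} (\<lambda>s. g (\<gamma>(x := s)))"
    by (intro set_borel_integral_eq_integral borel_integrable_atLeastAtMost' cont)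
  finally show ?thesis .
qed

lemma weighted_lipschitz_override:
  assumes L: "weighted_lipschitz L g" and \<eta>: "\<eta> \<in> \<Omega>" "\<eta>' \<in> \<Omega>" and \<zeta>: "\<zeta> \<in> space (spin_box \<Lambda>)"
  shows "\<bar>g (override_on \<eta> \<zeta> \<Lambda>) - g (override_on \<eta>' \<zeta> \<Lambda>)\<bar>
    \<le> (\<Sum>\<^sub>\<infinity>z. (if z \<in> \<Lambda> then 0 else L z) * \<bar>\<eta> z - \<eta>' z\<bar>)"
proof -
  have "\<bar>g (override_on \<eta> \<zeta> \<Lambda>) - g (override_on \<eta>' \<zeta> \<Lambda>)\<bar>
    \<le> (\<Sum>\<^sub>\<infinity>z. L z * \<bar>override_on \<eta> \<zeta> \<Lambda> z - override_on \<eta>' \<zeta> \<Lambda> z\<bar>)"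
    by (rule weighted_lipschitzD(3)[OF L override_mem[OF \<eta>(1) \<zeta>] override_mem[OF \<eta>(2) \<zeta>]])
  also have "\<dots> = (\<Sum>\<^sub>\<infinity>z. (if z \<in> \<Lambda> then 0 else L z) * \<bar>\<eta> z - \<eta>' z\<bar>)"
    by (rule infsum_cong) (auto simp: override_on_def)
  finally show ?thesis .
qed

lemma quasilocal_box_integral:
  assumes "quasilocal g" "finite \<Lambda>"
  shows "quasilocal (box_integral \<Lambda> g)"
proof -
  obtain L where L: "weighted_lipschitz L g" using assms(1) unfolding quasilocal_def by auto
  note L' = weighted_lipschitzD[OF L]
  let ?v = "(b - a) ^ card \<Lambda>"
  have v: "0 < ?v" using a_less_b by simp
  note int = observable_override_integrable[OF quasilocal_observable[OF assms(1)] _ assms(2)]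
  interpret finite_measure "spin_box \<Lambda>" by (rule finite_measure_box[OF assms(2)])
  have "weighted_lipschitz (\<lambda>z. ?v * L z) (box_integral \<Lambda> g)"
  proof (rule weighted_lipschitzI)
    fix \<eta> \<eta>' assume \<eta>: "\<eta> \<in> \<Omega>" "\<eta>' \<in> \<Omega>"
    let ?S = "\<Sum>\<^sub>\<infinity>z. L z * \<bar>\<eta> z - \<eta>' z\<bar>"
    have le: "\<bar>g (override_on \<eta> \<zeta> \<Lambda>) - g (override_on \<eta>' \<zeta> \<Lambda>)\<bar> \<le> ?S" if "\<zeta> \<in> space (spin_box \<Lambda>)" for \<zeta>
    proof -
      have "(\<Sum>\<^sub>\<infinity>z. (if z \<in> \<Lambda> then 0 else L z) * \<bar>\<eta> z - \<eta>' z\<bar>) \<le> ?S"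
        using L' by (intro weighted_sum_mono \<eta>) auto
      then show ?thesis using weighted_lipschitz_override[OF L \<eta> that] by linarith
    qed
    have "box_integral \<Lambda> g \<eta> - box_integral \<Lambda> g \<eta>' =
      (\<integral>\<zeta>. g (override_on \<eta> \<zeta> \<Lambda>) - g (override_on \<eta>' \<zeta> \<Lambda>) \<partial>spin_box \<Lambda>)"
      unfolding box_integral_def by (rule Bochner_Integration.integral_diff[symmetric]) (intro int \<eta>)+
    also have "\<bar>\<dots>\<bar> \<le> (\<integral>\<zeta>. \<bar>g (override_on \<eta> \<zeta> \<Lambda>) - g (override_on \<eta>' \<zeta> \<Lambda>)\<bar> \<partial>spin_box \<Lambda>)"
      by (rule integral_abs_bound)
    also have "\<dots> \<le> (\<integral>\<zeta>. ?S \<partial>spin_box \<Lambda>)"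
      using le by (intro integral_mono integrable_abs Bochner_Integration.integrable_diff int \<eta> integrable_const)
    also have "\<dots> = ?v * ?S" using assms(2) by (simp add: measure_box)
    finally show "\<bar>box_integral \<Lambda> g \<eta> - box_integral \<Lambda> g \<eta>'\<bar> \<le> (\<Sum>\<^sub>\<infinity>z. (?v * L z) * \<bar>\<eta> z - \<eta>' z\<bar>)"
      by (simp only: weighted_sum_cmult)
  qed (use L' v in \<open>auto intro: summable_on_cmult_right\<close>)
  then show ?thesis unfolding quasilocal_def by auto
qed

section \<open>Finite-volume averages and their consistency\<close>

definition boltzmann :: "'d site set \<Rightarrow> 'd configuration \<Rightarrow> real" where
  "boltzmann \<Lambda> \<eta> = exp (- hamiltonian J \<Lambda> \<eta>)"

lemma boltzmann_pos: "0 < boltzmann \<Lambda> \<eta>"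
  by (simp add: boltzmann_def)

lemma exp_lipschitz:
  fixes p q B :: real
  assumes "\<bar>p\<bar> \<le> B" "\<bar>q\<bar> \<le> B"
  shows "\<bar>exp p - exp q\<bar> \<le> exp B * \<bar>p - q\<bar>"
proof -
  have "norm (exp p - exp q) \<le> exp B * norm (p - q)"
    by (rule field_differentiable_bound[of "{-B..B}" exp exp])
       (use assms in \<open>auto intro!: derivative_eq_intros\<close>)
  then show ?thesis by simp
qed

lemma quasilocal_boltzmann: "finite \<Lambda> \<Longrightarrow> quasilocal (boltzmann \<Lambda>)"
proof -
  assume \<Lambda>: "finite \<Lambda>"
  obtain B where B: "\<And>\<eta>. \<eta> \<in> \<Omega> \<Longrightarrow> \<bar>hamiltonian J \<Lambda> \<eta>\<bar> \<le> B"
    using quasilocal_bounded[OF quasilocal_hamiltonian[OF \<Lambda>]] by blast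
  show ?thesis unfolding boltzmann_def
  proof (rule quasilocal_compose[OF quasilocal_hamiltonian[OF \<Lambda>], of "exp B"])
    fix \<eta> \<eta>' assume "\<eta> \<in> \<Omega>" "\<eta>' \<in> \<Omega>"
    then show "\<bar>exp (- hamiltonian J \<Lambda> \<eta>) - exp (- hamiltonian J \<Lambda> \<eta>')\<bar>
        \<le> exp B * \<bar>hamiltonian J \<Lambda> \<eta> - hamiltonian J \<Lambda> \<eta>'\<bar>"
      using exp_lipschitz[of "- hamiltonian J \<Lambda> \<eta>" B "- hamiltonian J \<Lambda> \<eta>'"] B by (simp add: abs_minus_commute)
  qed simp
qed

lemma boltzmann_lower:
  assumes "finite \<Lambda>"
  obtains \<delta> where "0 < \<delta>" "\<And>\<eta>. \<eta> \<in> \<Omega> \<Longrightarrow> \<delta> \<le> boltzmann \<Lambda> \<eta>"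
proof -
  obtain B where B: "\<And>\<eta>. \<eta> \<in> \<Omega> \<Longrightarrow> \<bar>hamiltonian J \<Lambda> \<eta>\<bar> \<le> B"
    using quasilocal_bounded[OF quasilocal_hamiltonian[OF assms]] by blast
  show ?thesis
    by (rule that[of "exp (- B)"]) (use B in \<open>force simp: boltzmann_def abs_le_iff\<close>)+
qed

definition normaliser :: "'d site set \<Rightarrow> 'd configuration \<Rightarrow> real" where
  "normaliser \<Lambda> = box_integral \<Lambda> (boltzmann \<Lambda>)"

lemma normaliser_lower:
  assumes "finite \<Lambda>"
  obtains \<delta> where "0 < \<delta>" "\<And>\<eta>. \<eta> \<in> \<Omega> \<Longrightarrow> \<delta> \<le> normaliser \<Lambda> \<eta>"
proof -
  obtain \<delta> where \<delta>: "0 < \<delta>" "\<And>\<eta>. \<eta> \<in> \<Omega> \<Longrightarrow> \<delta> \<le> boltzmann \<Lambda> \<eta>" using boltzmann_lower[OF assms] by blast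
  show ?thesis
  proof (rule that[of "(b - a) ^ card \<Lambda> * \<delta>"])
    show "0 < (b - a) ^ card \<Lambda> * \<delta>" using \<delta> a_less_b by simp
    fix \<eta> assume "\<eta> \<in> \<Omega>"
    then have "box_integral \<Lambda> (\<lambda>_. \<delta>) \<eta> \<le> normaliser \<Lambda> \<eta>" unfolding normaliser_def
      using assms \<delta> override_mem
      by (intro box_integral_mono observable_const quasilocal_observable quasilocal_boltzmann) auto
    then show "(b - a) ^ card \<Lambda> * \<delta> \<le> normaliser \<Lambda> \<eta>" using assms by (simp add: box_integral_const)
  qed
qed

lemma normaliser_pos: "finite \<Lambda> \<Longrightarrow> \<eta> \<in> \<Omega> \<Longrightarrow> 0 < normaliser \<Lambda> \<eta>"
  by (metis normaliser_lower less_le_trans)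

lemma quasilocal_inverse_normaliser:
  assumes "finite \<Lambda>"
  shows "quasilocal (\<lambda>\<eta>. inverse (normaliser \<Lambda> \<eta>))"
proof -
  obtain \<delta> where \<delta>: "0 < \<delta>" "\<And>\<eta>. \<eta> \<in> \<Omega> \<Longrightarrow> \<delta> \<le> normaliser \<Lambda> \<eta>" using normaliser_lower[OF assms] by blast
  have "quasilocal (normaliser \<Lambda>)" unfolding normaliser_def
    using assms by (intro quasilocal_box_integral quasilocal_boltzmann)
  then show ?thesis
  proof (rule quasilocal_compose)
    fix \<eta> \<eta>' assume \<eta>: "\<eta> \<in> \<Omega>" "\<eta>' \<in> \<Omega>"
    let ?p = "normaliser \<Lambda> \<eta>" and ?q = "normaliser \<Lambda> \<eta>'"
    have p: "\<delta> \<le> ?p" "\<delta> \<le> ?q" "0 < ?p" "0 < ?q" using \<delta> \<eta> by (auto intro: less_le_trans)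
    have "inverse ?p - inverse ?q = inverse (?p * ?q) * (?q - ?p)" using p by (simp add: field_simps)
    then have "\<bar>inverse ?p - inverse ?q\<bar> = inverse (?p * ?q) * \<bar>?p - ?q\<bar>"
      using p by (simp add: abs_mult abs_minus_commute)
    also have "\<dots> \<le> inverse (\<delta> * \<delta>) * \<bar>?p - ?q\<bar>"
      using p \<delta> by (intro mult_right_mono le_imp_inverse_le mult_mono) auto
    finally show "\<bar>inverse ?p - inverse ?q\<bar> \<le> inverse (\<delta> * \<delta>) * \<bar>?p - ?q\<bar>" .
  qed (use \<delta> in simp)
qed

text \<open>
  The mean of \<open>f\<close> under the specification in \<open>\<Lambda>\<close>, as a function of the boundary condition; the
  identification with the specification is the lemma \<open>gibbs_specification_integral\<close>.
\<close>
definition gibbs_average :: "'d site set \<Rightarrow> ('d configuration \<Rightarrow> real) \<Rightarrow> 'd configuration \<Rightarrow> real" where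
  "gibbs_average \<Lambda> f \<gamma> = box_integral \<Lambda> (\<lambda>\<eta>. f \<eta> * boltzmann \<Lambda> \<eta>) \<gamma> / normaliser \<Lambda> \<gamma>"

lemma quasilocal_gibbs_average: "quasilocal f \<Longrightarrow> finite \<Lambda> \<Longrightarrow> quasilocal (gibbs_average \<Lambda> f)"
  unfolding gibbs_average_def divide_inverse
  by (intro quasilocal_mult quasilocal_inverse_normaliser quasilocal_box_integral quasilocal_boltzmann)

lemma observable_boltzmann: "finite \<Lambda> \<Longrightarrow> observable (boltzmann \<Lambda>)"
  by (intro quasilocal_observable quasilocal_boltzmann)

lemma observable_gibbs_average: "observable f \<Longrightarrow> finite \<Lambda> \<Longrightarrow> observable (gibbs_average \<Lambda> f)"
  unfolding gibbs_average_def divide_inverse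
  by (intro observable_mult quasilocal_observable[OF quasilocal_inverse_normaliser]
        observable_box_integral observable_boltzmann)

lemma gibbs_average_diff_le:
  assumes "observable f" "observable g" "finite \<Lambda>" "\<gamma> \<in> \<Omega>"
    "\<And>\<eta>. \<eta> \<in> space (spin_box \<Lambda>) \<Longrightarrow> \<bar>f (override_on \<gamma> \<eta> \<Lambda>) - g (override_on \<gamma> \<eta> \<Lambda>)\<bar> \<le> \<epsilon>"
  shows "\<bar>gibbs_average \<Lambda> f \<gamma> - gibbs_average \<Lambda> g \<gamma>\<bar> \<le> \<epsilon>"
proof -
  note ob = observable_mult[OF _ observable_boltzmann[OF assms(3)]]
  have "gibbs_average \<Lambda> f \<gamma> - gibbs_average \<Lambda> g \<gamma>
     = box_integral \<Lambda> (\<lambda>\<eta>. (f \<eta> - g \<eta>) * boltzmann \<Lambda> \<eta>) \<gamma> / normaliser \<Lambda> \<gamma>"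
    unfolding gibbs_average_def box_integral_def diff_divide_distrib[symmetric] left_diff_distrib
    using observable_override_integrable[OF ob] assms
    by (subst Bochner_Integration.integral_diff) auto
  also have "\<bar>\<dots>\<bar> \<le> \<epsilon>"
  proof -
    have obd: "observable (\<lambda>\<eta>. (f \<eta> - g \<eta>) * boltzmann \<Lambda> \<eta>)" "observable (\<lambda>\<eta>. \<epsilon> * boltzmann \<Lambda> \<eta>)"
      "observable (\<lambda>\<eta>. - \<epsilon> * boltzmann \<Lambda> \<eta>)"
      by (intro ob observable_diff observable_const assms)+
    have "box_integral \<Lambda> (\<lambda>\<eta>. (f \<eta> - g \<eta>) * boltzmann \<Lambda> \<eta>) \<gamma> \<le> box_integral \<Lambda> (\<lambda>\<eta>. \<epsilon> * boltzmann \<Lambda> \<eta>) \<gamma>"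
      using assms boltzmann_pos
      by (intro box_integral_mono obd) (auto intro!: mult_right_mono simp: less_imp_le abs_le_iff)
    moreover have "box_integral \<Lambda> (\<lambda>\<eta>. - \<epsilon> * boltzmann \<Lambda> \<eta>) \<gamma> \<le> box_integral \<Lambda> (\<lambda>\<eta>. (f \<eta> - g \<eta>) * boltzmann \<Lambda> \<eta>) \<gamma>"
      using assms boltzmann_pos
      by (intro box_integral_mono obd mult_right_mono) (auto simp: less_imp_le abs_le_iff, smt (verit))
    ultimately show ?thesis
      using normaliser_pos[OF assms(3,4)]
      by (simp add: box_integral_def normaliser_def abs_le_iff divide_le_eq minus_divide_left)
  qed
  finally show ?thesis .
qed

text \<open>
  The Boltzmann factor of \<open>\<Lambda>'\<close> is that of \<open>\<Lambda>\<close> times a factor \<open>R\<close> that does not see the spins in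
  \<open>\<Lambda>\<close>. The same holds for the average over \<open>\<Lambda>\<close>, so after integrating out the spins in \<open>\<Lambda>\<close> first,
  the normaliser of \<open>\<Lambda>\<close> cancels.
\<close>
lemma gibbs_average_consistent:
  assumes f: "observable f" and \<gamma>: "\<gamma> \<in> \<Omega>" and \<Lambda>: "finite \<Lambda>'" "\<Lambda> \<subseteq> \<Lambda>'"
  shows "gibbs_average \<Lambda>' (gibbs_average \<Lambda> f) \<gamma> = gibbs_average \<Lambda>' f \<gamma>"
proof -
  define \<Delta> where "\<Delta> = \<Lambda>' - \<Lambda>"
  have fin: "finite \<Lambda>" "finite \<Delta>" "\<Lambda> \<inter> \<Delta> = {}" "\<Lambda>' = \<Lambda> \<union> \<Delta>"
    using \<Lambda> by (auto simp: \<Delta>_def intro: finite_subset)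
  \<comment> \<open>\<open>R\<close> is the Boltzmann factor of the bonds that meet \<open>\<Lambda>'\<close> but avoid \<open>\<Lambda>\<close>.\<close>
  define R where "R \<eta> = boltzmann \<Lambda>' \<eta> / boltzmann \<Lambda> \<eta>" for \<eta>
  have R: "boltzmann \<Lambda>' \<eta> = R \<eta> * boltzmann \<Lambda> \<eta>" for \<eta>
    using boltzmann_pos[of \<Lambda> \<eta>] by (simp add: R_def)
  have R_inv: "R (override_on \<xi> \<zeta> \<Lambda>) = R \<xi>" if "\<xi> \<in> \<Omega>" "\<zeta> \<in> space (spin_box \<Lambda>)" for \<xi> \<zeta>
  proof -
    have "R \<eta> = exp (- (hamiltonian J \<Lambda>' \<eta> - hamiltonian J \<Lambda> \<eta>))" for \<eta>
      by (simp add: R_def boltzmann_def flip: exp_diff)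
    then show ?thesis
      using hamiltonian_boundary_part[OF fin(2,1,3) override_mem[OF that] that(1)]
      by (auto simp: fin(4) override_on_def)
  qed
  have av_inv: "gibbs_average \<Lambda> f (override_on \<xi> \<zeta> \<Lambda>) = gibbs_average \<Lambda> f \<xi>" for \<xi> \<zeta>
  proof -
    have "override_on (override_on \<xi> \<zeta> \<Lambda>) \<zeta>' \<Lambda> = override_on \<xi> \<zeta>' \<Lambda>" for \<zeta>'
      by (auto simp: override_on_def)
    then show ?thesis by (simp add: gibbs_average_def normaliser_def box_integral_def)
  qed
  note ob = observable_mult[OF _ observable_boltzmann]
  have "box_integral \<Lambda> (\<lambda>\<eta>. gibbs_average \<Lambda> f \<eta> * boltzmann \<Lambda>' \<eta>) \<xi> =
    box_integral \<Lambda> (\<lambda>\<eta>. f \<eta> * boltzmann \<Lambda>' \<eta>) \<xi>" if \<xi>: "\<xi> \<in> \<Omega>" for \<xi>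
  proof -
    have "box_integral \<Lambda> (\<lambda>\<eta>. gibbs_average \<Lambda> f \<eta> * boltzmann \<Lambda>' \<eta>) \<xi> =
      box_integral \<Lambda> (\<lambda>\<eta>. (R \<eta> * gibbs_average \<Lambda> f \<eta>) * boltzmann \<Lambda> \<eta>) \<xi>"
      by (simp add: R mult_ac)
    also have "\<dots> = (R \<xi> * gibbs_average \<Lambda> f \<xi>) * normaliser \<Lambda> \<xi>"
      unfolding normaliser_def by (rule box_integral_mult_invariant[OF \<xi>]) (simp add: R_inv[OF \<xi>] av_inv)
    also have "\<dots> = R \<xi> * box_integral \<Lambda> (\<lambda>\<eta>. f \<eta> * boltzmann \<Lambda> \<eta>) \<xi>"
      using normaliser_pos[OF fin(1) \<xi>] by (simp add: gibbs_average_def)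
    also have "\<dots> = box_integral \<Lambda> (\<lambda>\<eta>. R \<eta> * (f \<eta> * boltzmann \<Lambda> \<eta>)) \<xi>"
      by (rule box_integral_mult_invariant[OF \<xi>, symmetric]) (rule R_inv[OF \<xi>])
    also have "\<dots> = box_integral \<Lambda> (\<lambda>\<eta>. f \<eta> * boltzmann \<Lambda>' \<eta>) \<xi>"
      by (simp add: R mult_ac)
    finally show ?thesis .
  qed
  then have "box_integral \<Delta> (box_integral \<Lambda> (\<lambda>\<eta>. gibbs_average \<Lambda> f \<eta> * boltzmann \<Lambda>' \<eta>)) \<gamma> =
    box_integral \<Delta> (box_integral \<Lambda> (\<lambda>\<eta>. f \<eta> * boltzmann \<Lambda>' \<eta>)) \<gamma>"
    by (intro box_integral_cong[OF \<gamma>]) (simp add: override_mem[OF \<gamma>])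
  then have "box_integral \<Lambda>' (\<lambda>\<eta>. gibbs_average \<Lambda> f \<eta> * boltzmann \<Lambda>' \<eta>) \<gamma> =
    box_integral \<Lambda>' (\<lambda>\<eta>. f \<eta> * boltzmann \<Lambda>' \<eta>) \<gamma>"
    using box_integral_Un[OF ob[OF observable_gibbs_average[OF f fin(1)] \<Lambda>(1)] \<gamma> fin(1-3)]
      box_integral_Un[OF ob[OF f \<Lambda>(1)] \<gamma> fin(1-3)] fin(4) by simp
  then show ?thesis unfolding gibbs_average_def[of \<Lambda>'] by simp
qed

lemma partition_function_eq: "partition_function a b J \<Lambda> \<gamma> = normaliser \<Lambda> \<gamma>"
  by (simp add: partition_function_def normaliser_def box_integral_def boltzmann_def)

lemma gibbs_specification_integral:
  assumes "observable f" "finite \<Lambda>" "\<gamma> \<in> \<Omega>"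
  shows "(\<integral>\<eta>. f (override_on \<gamma> \<eta> \<Lambda>) \<partial>gibbs_specification a b J \<Lambda> \<gamma>) = gibbs_average \<Lambda> f \<gamma>"
proof -
  have "(\<integral>\<eta>. f (override_on \<gamma> \<eta> \<Lambda>) \<partial>gibbs_specification a b J \<Lambda> \<gamma>)
    = (\<integral>\<eta>. (boltzmann \<Lambda> (override_on \<gamma> \<eta> \<Lambda>) / normaliser \<Lambda> \<gamma>) *\<^sub>R f (override_on \<gamma> \<eta> \<Lambda>) \<partial>spin_box \<Lambda>)"
    unfolding gibbs_specification_def partition_function_eq boltzmann_def[symmetric]
    using assms normaliser_pos[of \<Lambda> \<gamma>] boltzmann_pos
    by (intro integral_density borel_measurable_divide borel_measurable_const
          observable_override_measurable[OF observable_boltzmann]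
          observable_override_measurable[OF assms(1)])
       (auto intro!: AE_I2 divide_nonneg_nonneg simp: less_imp_le)
  also have "\<dots> = (\<integral>\<eta>. f (override_on \<gamma> \<eta> \<Lambda>) * boltzmann \<Lambda> (override_on \<gamma> \<eta> \<Lambda>) / normaliser \<Lambda> \<gamma> \<partial>spin_box \<Lambda>)"
    by (simp add: mult.commute)
  finally show ?thesis by (simp add: gibbs_average_def box_integral_def)
qed

lemma sets_gibbs_specification: "sets (gibbs_specification a b J \<Lambda> \<gamma>) = sets (spin_box \<Lambda>)"
  by (simp add: gibbs_specification_def)

lemma prob_space_gibbs_specification:
  assumes "finite \<Lambda>" "\<gamma> \<in> \<Omega>"
  shows "prob_space (gibbs_specification a b J \<Lambda> \<gamma>)"
proof
  let ?w = "\<lambda>\<eta>. boltzmann \<Lambda> (override_on \<gamma> \<eta> \<Lambda>) / normaliser \<Lambda> \<gamma>"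
  have m: "?w \<in> borel_measurable (spin_box \<Lambda>)"
    using assms 
    by (intro borel_measurable_divide borel_measurable_const
          observable_override_measurable[OF observable_boltzmann])
  have "emeasure (gibbs_specification a b J \<Lambda> \<gamma>) (space (gibbs_specification a b J \<Lambda> \<gamma>)) = (\<integral>\<^sup>+\<eta>. ennreal (?w \<eta>) \<partial>spin_box \<Lambda>)"
    unfolding gibbs_specification_def partition_function_eq boltzmann_def[symmetric] space_density
    using m by (subst emeasure_density) (auto intro!: nn_integral_cong)
  also have "\<dots> = ennreal (\<integral>\<eta>. ?w \<eta> \<partial>spin_box \<Lambda>)"
    using assms normaliser_pos[OF assms] boltzmann_pos observable_override_integrable[OF observable_boltzmann]
    by (intro nn_integral_eq_integral) (auto intro!: AE_I2 divide_nonneg_nonneg simp: less_imp_le)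
  also have "(\<integral>\<eta>. ?w \<eta> \<partial>spin_box \<Lambda>) = 1"
    using normaliser_pos[OF assms] by (simp add: normaliser_def box_integral_def)
  finally show "emeasure (gibbs_specification a b J \<Lambda> \<gamma>) (space (gibbs_specification a b J \<Lambda> \<gamma>)) = 1" by simp
qed

section \<open>Resampling one spin\<close>

text \<open>
  Dobrushin's constant: an upper bound for the total influence of all other sites on one site.
\<close>
definition influence :: real where
  "influence = 1 - exp (- \<beta> * (b - a)\<^sup>2 / 2)"

lemma influence_bounds: "0 \<le> influence" "influence < 1"
  using \<beta>_pos by (auto simp: influence_def)

text \<open>
  The weights after the spin at \<open>x\<close> is resampled. The weight at \<open>x\<close> disappears and is redistributed
  over the sites that enter the local mean; as \<open>J 0 = 0\<close>, nothing returns to \<open>x\<close>.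
\<close>
definition update_weights :: "'d site \<Rightarrow> ('d site \<Rightarrow> real) \<Rightarrow> 'd site \<Rightarrow> real" where
  "update_weights x L z = (if z = x then 0 else L z) + influence * L x * (J (z - x) / \<beta>)"

lemma gibbs_average_single:
  assumes f: "quasilocal f" and \<gamma>: "\<gamma> \<in> \<Omega>"
  defines "u \<equiv> \<lambda>m s. exp (- (\<beta> / 2) * (s - m)\<^sup>2)"
  shows "gibbs_average {x} f \<gamma> = integral {a..b} (\<lambda>s. f (\<gamma>(x := s)) * u (local_mean x \<gamma>) s)
     / integral {a..b} (u (local_mean x \<gamma>))"
proof -
  let ?m = "local_mean x \<gamma>"
  obtain C where C: "\<And>s. s \<in> {a..b} \<Longrightarrow> hamiltonian J {x} (\<gamma>(x := s)) = \<beta> / 2 * (s - ?m)\<^sup>2 + C"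
    using hamiltonian_single[OF \<gamma>] by blast
  have w: "boltzmann {x} (\<gamma>(x := s)) = u ?m s * exp (- C)" if "s \<in> {a..b}" for s
    using C[OF that] by (simp add: boltzmann_def u_def flip: exp_add)
  have bz: "quasilocal (boltzmann {x})" by (rule quasilocal_boltzmann) simp
  have "box_integral {x} (\<lambda>\<eta>. f \<eta> * boltzmann {x} \<eta>) \<gamma> =
      integral {a..b} (\<lambda>s. f (\<gamma>(x := s)) * u ?m s * exp (- C))"
    unfolding box_integral_singleton[OF quasilocal_mult[OF f bz] \<gamma>]
    by (rule integral_cong) (simp add: w)
  moreover have "normaliser {x} \<gamma> = integral {a..b} (\<lambda>s. u ?m s * exp (- C))"
    unfolding normaliser_def box_integral_singleton[OF bz \<gamma>] by (rule integral_cong) (rule w)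
  ultimately show ?thesis by (simp add: gibbs_average_def)
qed

text \<open>
  The boundary condition enters an average at \<open>x\<close> in two ways. It is an argument of \<open>f\<close>, which costs
  the weights of \<open>f\<close> off \<open>x\<close>; and it moves the centre of the truncated Gaussian, which costs
  \<open>influence * L x\<close> times the change of the local mean by the contraction estimate.
\<close>
lemma weighted_lipschitz_gibbs_average:
  assumes L: "weighted_lipschitz L f"
  shows "weighted_lipschitz (update_weights x L) (gibbs_average {x} f)"
proof (rule weighted_lipschitzI)
  note L' = weighted_lipschitzD[OF L]
  have f: "quasilocal f" using L unfolding quasilocal_def by auto
  have s0: "(\<lambda>z. if z = x then 0 else L z) summable_on UNIV"
    using L' by (intro summable_on_comparison_test[OF L'(2)]) auto
  have sJ: "(\<lambda>z. J (z - x) / \<beta>) summable_on UNIV"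
    using summable_on_cmult_right[OF J_translate_summable[of x UNIV], of "1 / \<beta>"] by simp
  show "0 \<le> update_weights x L z" for z
    using L' influence_bounds \<beta>_pos J_nonneg by (auto simp: update_weights_def)
  show "update_weights x L summable_on UNIV"
    unfolding update_weights_def by (intro summable_on_add summable_on_cmult_right s0 sJ)
  fix \<eta> \<eta>' assume \<eta>: "\<eta> \<in> \<Omega>" "\<eta>' \<in> \<Omega>"
  let ?m = "local_mean x \<eta>" and ?m' = "local_mean x \<eta>'"
  let ?S = "\<Sum>\<^sub>\<infinity>z. (if z = x then 0 else L z) * \<bar>\<eta> z - \<eta>' z\<bar>"
  \<comment> \<open>\<open>g\<close> follows the boundary \<open>\<eta>'\<close> but is averaged with the local mean of \<open>\<eta>\<close>.\<close>
  define g where "g \<xi> = f (\<eta>'(x := \<xi> x))" for \<xi>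
  have upd: "\<xi>(x := s) \<in> \<Omega>" if "\<xi> \<in> \<Omega>" "s \<in> {a..b}" for \<xi> s
    using that by (auto simp: configurations_iff)
  have lip: "\<bar>f (\<eta>'(x := s)) - f (\<eta>'(x := t))\<bar> \<le> L x * \<bar>s - t\<bar>" if "s \<in> {a..b}" "t \<in> {a..b}" for s t
  proof -
    have "(\<Sum>\<^sub>\<infinity>z. L z * \<bar>(\<eta>'(x := s)) z - (\<eta>'(x := t)) z\<bar>) = (\<Sum>\<^sub>\<infinity>z\<in>{x}. L z * \<bar>s - t\<bar>)"
      by (rule infsum_cong_neutral) auto
    then show ?thesis using L'(3)[OF upd[OF \<eta>(2) that(1)] upd[OF \<eta>(2) that(2)]] by simp
  qed
  have g: "quasilocal g" unfolding g_def
  proof (rule quasilocal_compose[OF quasilocal_coordinate])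
    show "\<bar>f (\<eta>'(x := \<xi> x)) - f (\<eta>'(x := \<xi>' x))\<bar> \<le> L x * \<bar>\<xi> x - \<xi>' x\<bar>" if "\<xi> \<in> \<Omega>" "\<xi>' \<in> \<Omega>" for \<xi> \<xi>'
      using that by (intro lip) (auto simp: configurations_iff)
  qed (rule L')
  have "\<bar>gibbs_average {x} f \<eta> - gibbs_average {x} g \<eta>\<bar> \<le> ?S"
  proof (rule gibbs_average_diff_le[OF quasilocal_observable[OF f] quasilocal_observable[OF g] _ \<eta>(1)])
    fix \<zeta> assume \<zeta>: "\<zeta> \<in> space (spin_box {x})"
    have "g (override_on \<eta> \<zeta> {x}) = f (override_on \<eta>' \<zeta> {x})"
      unfolding g_def by (rule arg_cong[of _ _ f]) (auto simp: override_on_def)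
    then show "\<bar>f (override_on \<eta> \<zeta> {x}) - g (override_on \<eta> \<zeta> {x})\<bar> \<le> ?S"
      using weighted_lipschitz_override[OF L \<eta> \<zeta>] by simp
  qed simp
  moreover have "\<bar>gibbs_average {x} g \<eta> - gibbs_average {x} f \<eta>'\<bar> \<le> influence * L x * \<bar>?m - ?m'\<bar>"
    unfolding gibbs_average_single[OF g \<eta>(1)] gibbs_average_single[OF f \<eta>(2)] influence_def
    unfolding g_def fun_upd_same
    by (rule truncated_gaussian_mean_contraction[OF a_less_b \<beta>_pos
          local_mean_mem[OF \<eta>(1)] local_mean_mem[OF \<eta>(2)] lip L'(1)])
  moreover have "influence * L x * \<bar>?m - ?m'\<bar> \<le> influence * L x * (\<Sum>\<^sub>\<infinity>z. J (z - x) / \<beta> * \<bar>\<eta> z - \<eta>' z\<bar>)"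
    using influence_bounds L' by (intro mult_left_mono local_mean_diff \<eta>) auto
  moreover have "(\<Sum>\<^sub>\<infinity>z. update_weights x L z * \<bar>\<eta> z - \<eta>' z\<bar>) =
      ?S + influence * L x * (\<Sum>\<^sub>\<infinity>z. J (z - x) / \<beta> * \<bar>\<eta> z - \<eta>' z\<bar>)"
    unfolding update_weights_def
    using L' influence_bounds \<beta>_pos J_nonneg
    by (subst weighted_sum_add[OF \<eta> _ s0 _ summable_on_cmult_right[OF sJ]])
       (auto simp only: weighted_sum_cmult, auto)
  ultimately show "\<bar>gibbs_average {x} f \<eta> - gibbs_average {x} f \<eta>'\<bar>
      \<le> (\<Sum>\<^sub>\<infinity>z. update_weights x L z * \<bar>\<eta> z - \<eta>' z\<bar>)" by linarith
qed

section \<open>Asymptotic agreement of invariant states\<close>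

lemma summable_bounded_mult:
  fixes r L :: "'d site \<Rightarrow> real"
  assumes "\<And>z. 0 \<le> r z" "\<And>z. r z \<le> K" "\<And>z. 0 \<le> L z" "L summable_on UNIV"
  shows "(\<lambda>z. r z * L z) summable_on UNIV"
  by (rule summable_on_comparison_test[OF summable_on_cmult_right[OF assms(4), of K]])
     (use assms in \<open>auto intro!: mult_right_mono\<close>)

text \<open>
  In a bound \<open>\<Sum> r z * L z\<close>, resampling at \<open>x\<close> replaces the coefficient \<open>r x\<close> by an average of the
  coefficients of the other sites, multiplied by the influence.
\<close>
lemma control_update:
  fixes r L :: "'d site \<Rightarrow> real"
  assumes r: "\<And>z. 0 \<le> r z" "\<And>z. r z \<le> K" and L: "\<And>z. 0 \<le> L z" "L summable_on UNIV"
  shows "(\<Sum>\<^sub>\<infinity>z. r z * update_weights x L z) \<le> (\<Sum>\<^sub>\<infinity>z. (r(x := influence * K)) z * L z)"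
proof -
  define L0 where "L0 z = (if z = x then 0 else L z)" for z
  have L0: "0 \<le> L0 z" for z using L by (simp add: L0_def)
  have s0: "L0 summable_on UNIV"
    unfolding L0_def using L by (intro summable_on_comparison_test[OF L(2)]) auto
  have sJ: "(\<lambda>z. J (z - x) / \<beta>) summable_on UNIV"
    using summable_on_cmult_right[OF J_translate_summable[of x UNIV], of "1 / \<beta>"] by simp
  have J0: "0 \<le> J (z - x) / \<beta>" for z using \<beta>_pos J_nonneg by simp
  have K: "0 \<le> K" using r[of x] by simp
  note h0 = has_sum_infsum[OF summable_bounded_mult[OF r L0 s0]]
  note hJ = has_sum_infsum[OF summable_bounded_mult[OF r J0 sJ]]
  have "(\<Sum>\<^sub>\<infinity>z. r z * update_weights x L z) =
    (\<Sum>\<^sub>\<infinity>z. r z * L0 z + (influence * L x) * (r z * (J (z - x) / \<beta>)))"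
    by (rule infsum_cong) (simp add: update_weights_def L0_def algebra_simps)
  also have "\<dots> = (\<Sum>\<^sub>\<infinity>z. r z * L0 z) + (influence * L x) * (\<Sum>\<^sub>\<infinity>z. r z * (J (z - x) / \<beta>))"
    by (intro infsumI has_sum_add has_sum_cmult_right h0 hJ)
  also have "(\<Sum>\<^sub>\<infinity>z. r z * (J (z - x) / \<beta>)) \<le> (\<Sum>\<^sub>\<infinity>z. K * (J (z - x) / \<beta>))"
    by (intro infsum_mono summable_bounded_mult[OF r J0 sJ] summable_on_cmult_right sJ)
       (intro mult_right_mono r J0)
  also have "(\<Sum>\<^sub>\<infinity>z. K * (J (z - x) / \<beta>)) = K"
    using infsum_cmult_right'[of "K / \<beta>" "\<lambda>z. J (z - x)" UNIV] \<beta>_pos by (simp add: J_translate_mass)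
  finally have "(\<Sum>\<^sub>\<infinity>z. r z * update_weights x L z) \<le> (\<Sum>\<^sub>\<infinity>z. r z * L0 z) + influence * L x * K"
    using influence_bounds L(1) by (simp add: mult_left_mono)
  also have "\<dots> = (\<Sum>\<^sub>\<infinity>z. r z * L0 z + (if z = x then influence * L x * K else 0))"
  proof -
    have "((\<lambda>z. if z = x then influence * L x * K else 0) has_sum influence * L x * K) UNIV"
      by (rule has_sum_finite_neutralI[of "{x}"]) auto
    then show ?thesis by (intro infsumI[symmetric] has_sum_add h0)
  qed
  also have "\<dots> = (\<Sum>\<^sub>\<infinity>z. (r(x := influence * K)) z * L z)"
    by (rule infsum_cong) (simp add: L0_def)
  finally show ?thesis .
qed

text \<open>
  If the discrepancy of the two states is bounded by \<open>K\<close> times the total weight, resampling the sites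
  of a large finite set one after the other improves the coefficient to \<open>influence * K\<close> on that set,
  while the weight outside it is negligible. So the constant \<open>K\<close> itself improves to \<open>influence * K\<close>, and
  this can be iterated. Each step uses finitely many resamplings, which is why eventual invariance is
  enough.
\<close>
lemma asymptotic_agreement:
  fixes \<phi> \<psi> :: "'i \<Rightarrow> ('d configuration \<Rightarrow> real) \<Rightarrow> real" and F :: "'i filter"
  assumes osc: "\<And>L f i. weighted_lipschitz L f \<Longrightarrow> \<bar>\<phi> i f - \<psi> i f\<bar> \<le> (b - a) * (\<Sum>\<^sub>\<infinity>z. L z)"
    and inv: "\<And>x. \<forall>\<^sub>F i in F. \<forall>f. quasilocal f \<longrightarrow>
      \<phi> i (gibbs_average {x} f) = \<phi> i f \<and> \<psi> i (gibbs_average {x} f) = \<psi> i f"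
    and f: "quasilocal f"
  shows "((\<lambda>i. \<phi> i f - \<psi> i f) \<longlongrightarrow> 0) F"
proof -
  \<comment> \<open>The slack \<open>\<epsilon>\<close> absorbs the weight outside a finite set of resampled sites.\<close>
  define controls where "controls r \<longleftrightarrow> (\<forall>L f \<epsilon>. weighted_lipschitz L f \<longrightarrow> 0 < \<epsilon> \<longrightarrow>
    (\<forall>\<^sub>F i in F. \<bar>\<phi> i f - \<psi> i f\<bar> \<le> (\<Sum>\<^sub>\<infinity>z. r z * L z) + \<epsilon>))" for r :: "'d site \<Rightarrow> real"
  have update: "controls (r(x := influence * K))"
    if r: "\<And>z. 0 \<le> r z" "\<And>z. r z \<le> K" and c: "controls r" for r x K
    unfolding controls_def
  proof (intro allI impI)
    fix L f and \<epsilon> :: real assume L: "weighted_lipschitz L f" and \<epsilon>: "0 < \<epsilon>"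
    have q: "quasilocal f" using L unfolding quasilocal_def by auto
    have "\<forall>\<^sub>F i in F. \<bar>\<phi> i (gibbs_average {x} f) - \<psi> i (gibbs_average {x} f)\<bar>
        \<le> (\<Sum>\<^sub>\<infinity>z. r z * update_weights x L z) + \<epsilon>"
      using c weighted_lipschitz_gibbs_average[OF L] \<epsilon> unfolding controls_def by blast
    with inv[of x] show "\<forall>\<^sub>F i in F. \<bar>\<phi> i f - \<psi> i f\<bar> \<le> (\<Sum>\<^sub>\<infinity>z. (r(x := influence * K)) z * L z) + \<epsilon>"
    proof eventually_elim
      case (elim i)
      then show ?case using q control_update[of r K L x, OF r weighted_lipschitzD(1,2)[OF L]] by auto
    qed
  qed
  have finite_update: "controls (\<lambda>z. if z \<in> \<Lambda> then influence * K else K)"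
    if "finite \<Lambda>" "0 \<le> K" "controls (\<lambda>_. K)" for \<Lambda> K
    using that(1)
  proof (induction \<Lambda> rule: finite_induct)
    case (insert x \<Lambda>)
    have "influence * K \<le> 1 * K" using influence_bounds that(2) by (intro mult_right_mono) auto
    then have "controls ((\<lambda>z. if z \<in> \<Lambda> then influence * K else K)(x := influence * K))"
      using influence_bounds that(2) by (intro update insert.IH) auto
    also have "(\<lambda>z. if z \<in> \<Lambda> then influence * K else K)(x := influence * K) =
      (\<lambda>z. if z \<in> insert x \<Lambda> then influence * K else K)" by (auto simp: fun_eq_iff)
    finally show ?case .
  qed (use that in simp)
  have contract: "controls (\<lambda>_. influence * K)" if K: "0 \<le> K" "controls (\<lambda>_. K)" for K
    unfolding controls_def
  proof (intro allI impI)
    fix L f and \<epsilon> :: real assume L: "weighted_lipschitz L f" and \<epsilon>: "0 < \<epsilon>"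
    note L' = weighted_lipschitzD[OF L]
    have cK: "0 \<le> influence * K" using influence_bounds K by simp
    obtain \<Lambda> where \<Lambda>: "finite \<Lambda>" "(\<Sum>\<^sub>\<infinity>z\<in>-\<Lambda>. L z) \<le> \<epsilon> / (2 * (K + 1))"
      using summable_tail[OF L'(1,2), of "\<epsilon> / (2 * (K + 1))"] \<epsilon> K by auto
    have "K * (\<Sum>\<^sub>\<infinity>z\<in>-\<Lambda>. L z) \<le> (K + 1) * (\<epsilon> / (2 * (K + 1)))"
      using \<Lambda> K L'(1) by (intro mult_mono infsum_nonneg) auto
    also have "\<dots> = \<epsilon> / 2" using K by (simp add: field_simps)
    finally have tail: "K * (\<Sum>\<^sub>\<infinity>z\<in>-\<Lambda>. L z) \<le> \<epsilon> / 2" .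
    have sL: "L summable_on A" for A using L'(2) by (rule summable_on_subset) simp
    have "(\<Sum>\<^sub>\<infinity>z\<in>\<Lambda> \<union> -\<Lambda>. (if z \<in> \<Lambda> then influence * K else K) * L z) =
      (\<Sum>\<^sub>\<infinity>z\<in>\<Lambda>. (if z \<in> \<Lambda> then influence * K else K) * L z) + (\<Sum>\<^sub>\<infinity>z\<in>-\<Lambda>. (if z \<in> \<Lambda> then influence * K else K) * L z)"
    proof (rule infsum_Un_disjoint)
      show "(\<lambda>z. (if z \<in> \<Lambda> then influence * K else K) * L z) summable_on - \<Lambda>"
        using summable_on_cmult_right[OF sL, of K "-\<Lambda>"] by (rule summable_on_cong[THEN iffD1, rotated]) auto
    qed (use \<Lambda> in auto)
    also have "(\<Sum>\<^sub>\<infinity>z\<in>\<Lambda>. (if z \<in> \<Lambda> then influence * K else K) * L z) = influence * K * (\<Sum>\<^sub>\<infinity>z\<in>\<Lambda>. L z)"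
      by (subst infsum_cmult_right'[symmetric]) (rule infsum_cong, simp)
    also have "(\<Sum>\<^sub>\<infinity>z\<in>-\<Lambda>. (if z \<in> \<Lambda> then influence * K else K) * L z) = K * (\<Sum>\<^sub>\<infinity>z\<in>-\<Lambda>. L z)"
      by (subst infsum_cmult_right'[symmetric]) (rule infsum_cong, simp)
    also have "influence * K * (\<Sum>\<^sub>\<infinity>z\<in>\<Lambda>. L z) \<le> influence * K * (\<Sum>\<^sub>\<infinity>z. L z)"
      using cK L'(1) by (intro mult_left_mono infsum_mono2 sL) auto
    also have "influence * K * (\<Sum>\<^sub>\<infinity>z. L z) = (\<Sum>\<^sub>\<infinity>z. influence * K * L z)"
      by (rule infsum_cmult_right'[symmetric])
    finally have "(\<Sum>\<^sub>\<infinity>z. (if z \<in> \<Lambda> then influence * K else K) * L z) \<le> (\<Sum>\<^sub>\<infinity>z. influence * K * L z) + \<epsilon> / 2"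
      using tail by simp
    moreover have "\<forall>\<^sub>F i in F. \<bar>\<phi> i f - \<psi> i f\<bar> \<le> (\<Sum>\<^sub>\<infinity>z. (if z \<in> \<Lambda> then influence * K else K) * L z) + \<epsilon> / 2"
      using finite_update[OF \<Lambda>(1) K] L half_gt_zero[OF \<epsilon>] unfolding controls_def by blast
    ultimately show "\<forall>\<^sub>F i in F. \<bar>\<phi> i f - \<psi> i f\<bar> \<le> (\<Sum>\<^sub>\<infinity>z. influence * K * L z) + \<epsilon>"
      by (auto elim!: eventually_mono)
  qed
  have "controls (\<lambda>_. b - a)"
    unfolding controls_def infsum_cmult_right'
    by (intro allI impI always_eventually add_increasing2 osc) auto
  then have all: "controls (\<lambda>_. influence ^ n * (b - a))" for n
  proof (induction n)
    case (Suc n)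
    then show ?case using contract[of "influence ^ n * (b - a)"] influence_bounds a_less_b by (simp add: mult.assoc)
  qed simp
  obtain L where L: "weighted_lipschitz L f" using f unfolding quasilocal_def by auto
  show ?thesis
  proof (rule tendstoI)
    fix \<epsilon> :: real assume \<epsilon>: "0 < \<epsilon>"
    have "(\<lambda>n. influence ^ n * (b - a) * (\<Sum>\<^sub>\<infinity>z. L z)) \<longlonglongrightarrow> 0 * (b - a) * (\<Sum>\<^sub>\<infinity>z. L z)"
      using influence_bounds by (intro tendsto_mult tendsto_const LIMSEQ_realpow_zero)
    then have "\<forall>\<^sub>F n in sequentially. influence ^ n * (b - a) * (\<Sum>\<^sub>\<infinity>z. L z) < \<epsilon> / 2"
      using \<epsilon> by (intro order_tendstoD(2)[where y = 0]) auto
    then obtain n where n: "influence ^ n * (b - a) * (\<Sum>\<^sub>\<infinity>z. L z) < \<epsilon> / 2"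
      by (auto simp: eventually_sequentially)
    have "\<epsilon> / 4 > 0" using \<epsilon> by simp
    then have "\<forall>\<^sub>F i in F. \<bar>\<phi> i f - \<psi> i f\<bar> \<le> (\<Sum>\<^sub>\<infinity>z. influence ^ n * (b - a) * L z) + \<epsilon> / 4"
      using all[of n] L unfolding controls_def by blast
    then show "\<forall>\<^sub>F i in F. dist (\<phi> i f - \<psi> i f) 0 < \<epsilon>"
      using n \<epsilon> by (auto simp: infsum_cmult_right' dist_real_def elim!: eventually_mono)
  qed
qed

section \<open>Uniqueness\<close>

lemma integrable_observable:
  assumes "prob_space \<mu>" "sets \<mu> = sets \<B>" "observable f"
  shows "integrable \<mu> f"
proof -
  interpret prob_space \<mu> by fact
  have sp: "space \<mu> = \<Omega>" using sets_eq_imp_space_eq[OF assms(2)] by (simp add: space_\<B>)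
  obtain B where B: "\<And>\<eta>. \<eta> \<in> \<Omega> \<Longrightarrow> \<bar>f \<eta>\<bar> \<le> B" using observable_bound[OF assms(3)] by blast
  show ?thesis
    using B sp observable_measurable[OF assms(3)]
    by (intro integrable_const_bound[of _ B]) (auto simp: measurable_cong_sets[OF assms(2) refl])
qed

lemma integral_difference_le_oscillation:
  assumes \<mu>: "prob_space \<mu>" "sets \<mu> = sets \<B>" and \<nu>: "prob_space \<nu>" "sets \<nu> = sets \<B>"
    and L: "weighted_lipschitz L f"
  shows "\<bar>(\<integral>\<eta>. f \<eta> \<partial>\<mu>) - (\<integral>\<eta>. f \<eta> \<partial>\<nu>)\<bar> \<le> (b - a) * (\<Sum>\<^sub>\<infinity>z. L z)"
proof -
  let ?D = "(b - a) * (\<Sum>\<^sub>\<infinity>z. L z)"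
  have "observable f" using L quasilocal_observable unfolding quasilocal_def by blast
  note int = integrable_observable[OF _ _ this]
  have one: "(\<integral>\<eta>. f \<eta> \<partial>M) \<le> (\<integral>\<eta>. f \<eta> \<partial>N) + ?D"
    if M: "prob_space M" "sets M = sets \<B>" and N: "prob_space N" "sets N = sets \<B>" for M N
  proof -
    interpret M: prob_space M by fact
    interpret N: prob_space N by fact
    have sp: "space M = \<Omega>" "space N = \<Omega>" using M N sets_eq_imp_space_eq space_\<B> by metis+
    have "(\<integral>\<eta>. f \<eta> \<partial>M) - ?D \<le> f \<eta>'" if "\<eta>' \<in> \<Omega>" for \<eta>'
    proof -
      have "(\<integral>\<eta>. f \<eta> \<partial>M) \<le> (\<integral>\<eta>. f \<eta>' + ?D \<partial>M)"
        using weighted_lipschitz_oscillation[OF L _ that] sp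
        by (intro integral_mono int M) (auto simp: abs_le_iff, smt (verit))
      then show ?thesis by (simp add: M.prob_space)
    qed
    then have "(\<integral>\<eta>'. (\<integral>\<eta>. f \<eta> \<partial>M) - ?D \<partial>N) \<le> (\<integral>\<eta>'. f \<eta>' \<partial>N)"
      using sp by (intro integral_mono int N) auto
    then show ?thesis by (simp add: N.prob_space)
  qed
  show ?thesis using one[OF \<mu> \<nu>] one[OF \<nu> \<mu>] by linarith
qed

lemma quasilocal_prod: "finite F \<Longrightarrow> (\<And>x. x \<in> F \<Longrightarrow> quasilocal (g x)) \<Longrightarrow> quasilocal (\<lambda>\<eta>. \<Prod>x\<in>F. g x \<eta>)"
  by (induction F rule: finite_induct) (auto intro: quasilocal_const quasilocal_mult)

definition cylinder :: "'d site set \<Rightarrow> ('d site \<Rightarrow> real) \<Rightarrow> 'd configuration set" where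
  "cylinder F t = {\<eta> \<in> \<Omega>. \<forall>x\<in>F. \<eta> x \<le> t x}"

lemma cylinder_measurable: "finite F \<Longrightarrow> cylinder F t \<in> sets \<B>"
proof -
  assume F: "finite F"
  have "{\<eta> \<in> space \<B>. \<eta> x \<le> t x} \<in> sets \<B>" for x
    using measurable_coordinate[of x] by (simp add: borel_measurable_iff_le)
  then have "{\<eta> \<in> space \<B>. \<forall>x\<in>F. \<eta> x \<le> t x} \<in> sets \<B>"
    using F by (intro sets.sets_Collect_finite_All) auto
  then show ?thesis by (simp add: cylinder_def space_\<B>)
qed

text \<open>
  Half-line cylinders suffice because they make every coordinate measurable. They are convenient as
  their indicators are limits of quasilocal functions.
\<close>
lemma sets_\<B>_generated: "sets \<B> = sigma_sets \<Omega> {cylinder F t |F t. finite F}" (is "_ = sigma_sets \<Omega> ?E")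
proof
  have E: "?E \<subseteq> Pow \<Omega>" by (auto simp: cylinder_def)
  have "(\<lambda>\<eta>. \<eta>) \<in> sigma \<Omega> ?E \<rightarrow>\<^sub>M \<B>"
  proof (rule measurable_into_\<B>)
    fix x
    have "{\<eta> \<in> space (sigma \<Omega> ?E). \<eta> x \<le> s} \<in> sets (sigma \<Omega> ?E)" for s
    proof -
      have "{\<eta> \<in> space (sigma \<Omega> ?E). \<eta> x \<le> s} = cylinder {x} (\<lambda>_. s)"
        using E by (auto simp: cylinder_def space_measure_of)
      moreover have "cylinder {x} (\<lambda>_. s) \<in> sigma_sets \<Omega> ?E"
        by (rule sigma_sets.Basic) auto
      ultimately show ?thesis using E by simp
    qed
    then show "(\<lambda>\<eta>. \<eta> x) \<in> borel_measurable (sigma \<Omega> ?E)" by (simp add: borel_measurable_iff_le)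
  qed (use E in simp)
  from measurable_sets[OF this] show "sets \<B> \<subseteq> sigma_sets \<Omega> ?E"
    using E sets.sets_into_space[of _ \<B>] by (force simp: space_\<B> Int_absorb2)
  show "sigma_sets \<Omega> ?E \<subseteq> sets \<B>"
    using sets.sigma_sets_subset[of ?E \<B>] cylinder_measurable by (auto simp: space_\<B>)
qed

text \<open>
  The indicator of a half-line is the pointwise limit of Lipschitz functions of increasing slope.
\<close>
lemma measure_cylinder_limit:
  fixes t :: "'d site \<Rightarrow> real"
  assumes \<mu>: "prob_space \<mu>" "sets \<mu> = sets \<B>" and F: "finite F"
  defines "g \<equiv> \<lambda>(k::nat) \<eta>. \<Prod>x\<in>F. max 0 (1 - real k * max 0 (\<eta> x - t x))"
  shows "quasilocal (g k)" "(\<lambda>k. \<integral>\<eta>. g k \<eta> \<partial>\<mu>) \<longlonglongrightarrow> measure \<mu> (cylinder F t)"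
proof -
  interpret prob_space \<mu> by fact
  have sp: "space \<mu> = \<Omega>" using \<mu> sets_eq_imp_space_eq space_\<B> by metis
  show q: "quasilocal (g k)" for k unfolding g_def
  proof (rule quasilocal_prod[OF F], rule quasilocal_compose[OF quasilocal_coordinate])
    show "\<bar>max 0 (1 - real k * max 0 (\<eta> x - t x)) - max 0 (1 - real k * max 0 (\<eta>' x - t x))\<bar> \<le> real k * \<bar>\<eta> x - \<eta>' x\<bar>"
      for \<eta> \<eta>' :: "'d configuration" and x
    proof -
      have "\<bar>max 0 (1 - real k * max 0 (\<eta> x - t x)) - max 0 (1 - real k * max 0 (\<eta>' x - t x))\<bar>
        \<le> \<bar>real k * (max 0 (\<eta> x - t x) - max 0 (\<eta>' x - t x))\<bar>" unfolding right_diff_distrib by linarith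
      also have "\<dots> \<le> real k * \<bar>\<eta> x - \<eta>' x\<bar>" unfolding abs_mult by (intro mult_mono) auto
      finally show ?thesis .
    qed
  qed simp
  have cyl: "cylinder F t \<in> sets \<mu>" using cylinder_measurable[OF F] \<mu> by simp
  have "(\<lambda>k. \<integral>\<eta>. g k \<eta> \<partial>\<mu>) \<longlonglongrightarrow> (\<integral>\<eta>. indicator (cylinder F t) \<eta> \<partial>\<mu>)"
  proof (rule integral_dominated_convergence[where w = "\<lambda>_. 1"])
    show "g k \<in> borel_measurable \<mu>" for k
      using quasilocal_measurable[OF q] by (simp add: measurable_cong_sets[OF \<mu>(2) refl])
    show "AE \<eta> in \<mu>. norm (g k \<eta>) \<le> 1" for k
      by (rule AE_I2) (auto simp: g_def abs_prod intro!: prod_le_1)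
    show "AE \<eta> in \<mu>. (\<lambda>k. g k \<eta>) \<longlonglongrightarrow> indicator (cylinder F t) \<eta>"
    proof (rule AE_I2)
      fix \<eta> assume \<eta>: "\<eta> \<in> space \<mu>"
      have "(\<lambda>k. max 0 (1 - real k * max 0 (\<eta> x - t x))) \<longlonglongrightarrow> (if \<eta> x \<le> t x then 1 else 0)" for x
      proof (cases "\<eta> x \<le> t x")
        case False
        obtain N :: nat where N: "1 / (\<eta> x - t x) < real N" using reals_Archimedean2 by blast
        have "max 0 (1 - real k * max 0 (\<eta> x - t x)) = 0" if "N \<le> k" for k
        proof -
          \<comment> \<open>The slope \<open>k\<close> has reached zero at \<open>\<eta> x\<close> once \<open>k * (\<eta> x - t x)\<close> exceeds one.\<close>
          have "1 < real N * (\<eta> x - t x)" using N False by (simp add: divide_less_eq)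
          also have "\<dots> \<le> real k * (\<eta> x - t x)" using that False by (intro mult_right_mono) auto
          finally show ?thesis using False by simp
        qed
        then show ?thesis using False
          by (intro tendsto_eventually) (auto simp: eventually_sequentially)
      qed simp
      then have "(\<lambda>k. g k \<eta>) \<longlonglongrightarrow> (\<Prod>x\<in>F. if \<eta> x \<le> t x then 1 else 0)"
        unfolding g_def by (intro tendsto_prod)
      also have "(\<Prod>x\<in>F. if \<eta> x \<le> t x then 1 else 0) = (indicator (cylinder F t) \<eta> :: real)"
        using \<eta> F by (auto simp: cylinder_def sp indicator_def prod_zero_iff)
      finally show "(\<lambda>k. g k \<eta>) \<longlonglongrightarrow> indicator (cylinder F t) \<eta>" .
    qed
  qed (use cyl in auto)
  then show "(\<lambda>k. \<integral>\<eta>. g k \<eta> \<partial>\<mu>) \<longlonglongrightarrow> measure \<mu> (cylinder F t)"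
    using cyl by simp
qed

lemma quasilocal_determines_measure:
  assumes \<mu>: "prob_space \<mu>" "sets \<mu> = sets \<B>" and \<nu>: "prob_space \<nu>" "sets \<nu> = sets \<B>"
    and eq: "\<And>f. quasilocal f \<Longrightarrow> (\<integral>\<eta>. f \<eta> \<partial>\<mu>) = (\<integral>\<eta>. f \<eta> \<partial>\<nu>)"
  shows "\<mu> = \<nu>"
proof (rule measure_eqI_generator_eq[where \<Omega> = \<Omega> and E = "{cylinder F t |F t. finite F}" and A = "\<lambda>_. \<Omega>"])
  interpret \<mu>: prob_space \<mu> by fact
  interpret \<nu>: prob_space \<nu> by fact
  show "Int_stable {cylinder F t |F t. finite F}"
  proof (rule Int_stableI)
    fix A B assume "A \<in> {cylinder F t |F t. finite F}" "B \<in> {cylinder F t |F t. finite F}"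
    then obtain F t G s where FG: "finite F" "finite G" "A = cylinder F t" "B = cylinder G s" by auto
    \<comment> \<open>A site constrained by only one of the two cylinders keeps that constraint.\<close>
    define r where "r x = (if x \<in> F then if x \<in> G then min (t x) (s x) else t x else s x)" for x
    have "A \<inter> B = cylinder (F \<union> G) r"
      unfolding FG cylinder_def r_def by (auto split: if_splits)
    then show "A \<inter> B \<in> {cylinder F t |F t. finite F}" using FG by blast
  qed
  show "emeasure \<mu> X = emeasure \<nu> X" if X: "X \<in> {cylinder F t |F t. finite F}" for X
  proof -
    obtain F t where Ft: "finite F" "X = cylinder F t" using X by auto
    have "measure \<mu> X = measure \<nu> X" unfolding Ft(2)
      by (rule LIMSEQ_unique[OF measure_cylinder_limit(2)[OF \<mu> Ft(1)]])
         (use measure_cylinder_limit[OF \<nu> Ft(1)] eq in simp)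
    then show ?thesis by (simp add: \<mu>.emeasure_eq_measure \<nu>.emeasure_eq_measure)
  qed
  have "\<Omega> = cylinder {} (\<lambda>_. 0)" by (simp add: cylinder_def)
  then show "range (\<lambda>_. \<Omega>) \<subseteq> {cylinder F t |F t. finite F}" by auto
  show "emeasure \<mu> \<Omega> \<noteq> \<infinity>" by simp
qed (use sets_\<B>_generated \<mu> \<nu> in \<open>auto simp: cylinder_def\<close>)

lemma gibbs_measure_average:
  assumes "gibbs_measure a b (gibbs_specification a b J) \<mu>" "quasilocal f" "finite \<Lambda>"
  shows "(\<integral>\<eta>. gibbs_average \<Lambda> f \<eta> \<partial>\<mu>) = (\<integral>\<eta>. f \<eta> \<partial>\<mu>)"
proof -
  have \<mu>: "sets \<mu> = sets \<B>" using assms(1) unfolding gibbs_measure_def by simp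
  then have sp: "space \<mu> = \<Omega>" using sets_eq_imp_space_eq space_\<B> by metis
  have "(\<integral>\<eta>. f \<eta> \<partial>\<mu>) = (\<integral>\<gamma>. (\<integral>\<eta>. f (override_on \<gamma> \<eta> \<Lambda>) \<partial>gibbs_specification a b J \<Lambda> \<gamma>) \<partial>\<mu>)"
    using assms quasilocal_continuous[OF assms(2)] unfolding gibbs_measure_def by simp
  also have "\<dots> = (\<integral>\<eta>. gibbs_average \<Lambda> f \<eta> \<partial>\<mu>)"
    using sp assms(2,3)
    by (intro Bochner_Integration.integral_cong gibbs_specification_integral quasilocal_observable) auto
  finally show ?thesis by simp
qed

theorem gibbs_measure_unique:
  assumes \<mu>: "gibbs_measure a b (gibbs_specification a b J) \<mu>"
    and \<nu>: "gibbs_measure a b (gibbs_specification a b J) \<nu>"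
  shows "\<mu> = \<nu>"
proof (rule quasilocal_determines_measure)
  show m: "prob_space \<mu>" "sets \<mu> = sets \<B>" and n: "prob_space \<nu>" "sets \<nu> = sets \<B>"
    using \<mu> \<nu> unfolding gibbs_measure_def by auto
  fix f :: "'d configuration \<Rightarrow> real" assume "quasilocal f"
  then have "(\<lambda>i::nat. (\<integral>\<eta>. f \<eta> \<partial>\<mu>) - (\<integral>\<eta>. f \<eta> \<partial>\<nu>)) \<longlonglongrightarrow> 0"
    by (intro asymptotic_agreement[where \<phi> = "\<lambda>_ f. \<integral>\<eta>. f \<eta> \<partial>\<mu>" and \<psi> = "\<lambda>_ f. \<integral>\<eta>. f \<eta> \<partial>\<nu>"]
          integral_difference_le_oscillation m n always_eventually)
       (auto simp: gibbs_measure_average[OF \<mu>] gibbs_measure_average[OF \<nu>])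
  then show "(\<integral>\<eta>. f \<eta> \<partial>\<mu>) = (\<integral>\<eta>. f \<eta> \<partial>\<nu>)" by (simp add: LIMSEQ_const_iff)
qed

section \<open>Finite-volume distributions\<close>

definition exhaustion :: "nat \<Rightarrow> 'd site set" where
  "exhaustion n = {x. to_nat x < n}"

lemma finite_exhaustion: "finite (exhaustion n)"
proof -
  have "exhaustion n = to_nat -` {..<n}" by (auto simp: exhaustion_def)
  then show ?thesis by (simp add: finite_vimageI)
qed

lemma eventually_subset_exhaustion:
  assumes "finite \<Lambda>"
  shows "\<forall>\<^sub>F n in sequentially. \<Lambda> \<subseteq> exhaustion n"
  unfolding exhaustion_def subset_eq mem_Collect_eq
  by (rule eventually_ball_finite[OF assms]) (auto intro: eventually_gt_at_top)

text \<open>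
  Any boundary condition in \<open>\<Omega>\<close> would do in place of the constant \<open>a\<close>.
\<close>
definition finite_volume :: "nat \<Rightarrow> 'd configuration measure" where
  "finite_volume n = distr (gibbs_specification a b J (exhaustion n) (\<lambda>_. a)) \<B>
     (\<lambda>\<eta>. override_on (\<lambda>_. a) \<eta> (exhaustion n))"

lemma measurable_override_specification:
  "\<gamma> \<in> \<Omega> \<Longrightarrow> (\<lambda>\<eta>. override_on \<gamma> \<eta> \<Lambda>) \<in> gibbs_specification a b J \<Lambda> \<gamma>' \<rightarrow>\<^sub>M \<B>"
  using measurable_override_right by (simp add: measurable_cong_sets[OF sets_gibbs_specification refl])

lemma sets_finite_volume: "sets (finite_volume n) = sets \<B>"
  by (simp add: finite_volume_def)

lemma space_finite_volume: "space (finite_volume n) = \<Omega>"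
  by (simp add: finite_volume_def space_restrict_space)

lemma prob_space_finite_volume: "prob_space (finite_volume n)"
  unfolding finite_volume_def
  by (intro prob_space.prob_space_distr prob_space_gibbs_specification finite_exhaustion const_in
        measurable_override_specification)

lemma finite_volume_integral:
  assumes "observable f"
  shows "(\<integral>\<eta>. f \<eta> \<partial>finite_volume n) = gibbs_average (exhaustion n) f (\<lambda>_. a)"
  unfolding finite_volume_def
  using assms
  by (subst integral_distr)
     (auto intro!: measurable_override_specification const_in observable_measurable
       gibbs_specification_integral finite_exhaustion)

lemma finite_volume_consistent:
  assumes "observable f" "\<Lambda> \<subseteq> exhaustion n"
  shows "(\<integral>\<eta>. gibbs_average \<Lambda> f \<eta> \<partial>finite_volume n) = (\<integral>\<eta>. f \<eta> \<partial>finite_volume n)"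
proof -
  have "finite \<Lambda>" using assms(2) finite_exhaustion finite_subset by blast
  then show ?thesis
    using assms by (simp add: finite_volume_integral observable_gibbs_average gibbs_average_consistent
        const_in finite_exhaustion)
qed

text \<open>
  Two finite-volume distributions are both invariant under resampling at \<open>x\<close> once both volumes
  contain \<open>x\<close>, so \<open>asymptotic_agreement\<close> along pairs of volumes yields a Cauchy sequence.
\<close>
lemma finite_volume_convergent:
  assumes f: "quasilocal f"
  shows "convergent (\<lambda>n. \<integral>\<eta>. f \<eta> \<partial>finite_volume n)"
proof -
  let ?\<phi> = "\<lambda>(p :: nat \<times> nat) f. \<integral>\<eta>. f \<eta> \<partial>finite_volume (fst p)"
  let ?\<psi> = "\<lambda>(p :: nat \<times> nat) f. \<integral>\<eta>. f \<eta> \<partial>finite_volume (snd p)"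
  have "((\<lambda>p. ?\<phi> p f - ?\<psi> p f) \<longlongrightarrow> 0) (sequentially \<times>\<^sub>F sequentially)"
  proof (rule asymptotic_agreement[OF _ _ f])
    fix x
    obtain N where N: "\<And>n. n \<ge> N \<Longrightarrow> {x} \<subseteq> exhaustion n"
      using eventually_subset_exhaustion[of "{x}"] by (auto simp: eventually_sequentially)
    show "\<forall>\<^sub>F p in sequentially \<times>\<^sub>F sequentially. \<forall>f. quasilocal f \<longrightarrow>
        ?\<phi> p (gibbs_average {x} f) = ?\<phi> p f \<and> ?\<psi> p (gibbs_average {x} f) = ?\<psi> p f"
      unfolding eventually_prod_sequentially
      by (intro exI[of _ N] allI impI conjI) (simp_all add: finite_volume_consistent N quasilocal_observable del: insert_subset)
  qed (intro integral_difference_le_oscillation prob_space_finite_volume sets_finite_volume)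
  then have "\<forall>\<^sub>F p in sequentially \<times>\<^sub>F sequentially. dist (?\<phi> p f - ?\<psi> p f) 0 < e" if "0 < e" for e
    using that by (rule tendstoD)
  then have "Cauchy (\<lambda>n. \<integral>\<eta>. f \<eta> \<partial>finite_volume n)"
    unfolding eventually_prod_sequentially Cauchy_def by (force simp: dist_real_def)
  then show ?thesis by (rule Cauchy_convergent)
qed

section \<open>Limits of the finite-dimensional marginals\<close>

definition conditional_density :: "'d site set \<Rightarrow> 'd configuration \<Rightarrow> 'd configuration \<Rightarrow> real" where
  "conditional_density \<Lambda> \<zeta> \<gamma> = boltzmann \<Lambda> (override_on \<gamma> \<zeta> \<Lambda>) / normaliser \<Lambda> \<gamma>"

lemma quasilocal_override:
  assumes "quasilocal g" "\<zeta> \<in> space (spin_box \<Lambda>)"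
  shows "quasilocal (\<lambda>\<gamma>. g (override_on \<gamma> \<zeta> \<Lambda>))"
proof -
  obtain L where L: "weighted_lipschitz L g" using assms(1) unfolding quasilocal_def by auto
  note L' = weighted_lipschitzD[OF L]
  have "(\<lambda>z. if z \<in> \<Lambda> then 0 else L z) summable_on UNIV"
    using L' by (intro summable_on_comparison_test[OF L'(2)]) auto
  then have "weighted_lipschitz (\<lambda>z. if z \<in> \<Lambda> then 0 else L z) (\<lambda>\<gamma>. g (override_on \<gamma> \<zeta> \<Lambda>))"
    using L' weighted_lipschitz_override[OF L _ _ assms(2)] by (intro weighted_lipschitzI) auto
  then show ?thesis unfolding quasilocal_def by auto
qed

lemma quasilocal_conditional_density:
  "finite \<Lambda> \<Longrightarrow> \<zeta> \<in> space (spin_box \<Lambda>) \<Longrightarrow> quasilocal (conditional_density \<Lambda> \<zeta>)"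
  unfolding conditional_density_def divide_inverse
  by (intro quasilocal_mult quasilocal_override quasilocal_boltzmann quasilocal_inverse_normaliser)

lemma conditional_density_nonneg: "finite \<Lambda> \<Longrightarrow> \<gamma> \<in> \<Omega> \<Longrightarrow> 0 \<le> conditional_density \<Lambda> \<zeta> \<gamma>"
  using boltzmann_pos normaliser_pos by (simp add: conditional_density_def less_imp_le)

lemma conditional_density_bounded:
  assumes "finite \<Lambda>"
  obtains C where "\<And>\<zeta> \<gamma>. \<zeta> \<in> space (spin_box \<Lambda>) \<Longrightarrow> \<gamma> \<in> \<Omega> \<Longrightarrow> \<bar>conditional_density \<Lambda> \<zeta> \<gamma>\<bar> \<le> C"
proof -
  obtain B where B: "0 < B" "\<And>\<eta>. \<eta> \<in> \<Omega> \<Longrightarrow> \<bar>boltzmann \<Lambda> \<eta>\<bar> \<le> B"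
    using quasilocal_bounded[OF quasilocal_boltzmann[OF assms]] by blast
  obtain \<delta> where \<delta>: "0 < \<delta>" "\<And>\<eta>. \<eta> \<in> \<Omega> \<Longrightarrow> \<delta> \<le> normaliser \<Lambda> \<eta>" using normaliser_lower[OF assms] by blast
  show ?thesis
  proof (rule that[of "B / \<delta>"])
    fix \<zeta> \<gamma> assume "\<zeta> \<in> space (spin_box \<Lambda>)" "\<gamma> \<in> \<Omega>"
    then show "\<bar>conditional_density \<Lambda> \<zeta> \<gamma>\<bar> \<le> B / \<delta>"
      using B \<delta> override_mem normaliser_pos[OF assms, of \<gamma>]
      by (auto simp: conditional_density_def abs_divide intro!: frac_le)
  qed
qed

lemma measurable_conditional_density:
  assumes "finite \<Lambda>"
  shows "(\<lambda>(\<gamma>, \<zeta>). conditional_density \<Lambda> \<zeta> \<gamma>) \<in> borel_measurable (\<B> \<Otimes>\<^sub>M spin_box \<Lambda>)"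
proof -
  have 1: "(\<lambda>p. boltzmann \<Lambda> (case p of (\<gamma>, \<zeta>) \<Rightarrow> override_on \<gamma> \<zeta> \<Lambda>)) \<in> borel_measurable (\<B> \<Otimes>\<^sub>M spin_box \<Lambda>)"
    by (rule measurable_compose[OF measurable_override observable_measurable[OF observable_boltzmann[OF assms]]])
  have "normaliser \<Lambda> \<in> borel_measurable \<B>"
    unfolding normaliser_def by (intro observable_measurable observable_box_integral observable_boltzmann assms)
  from measurable_compose[OF measurable_fst this]
  have "(\<lambda>p. normaliser \<Lambda> (fst p)) \<in> borel_measurable (\<B> \<Otimes>\<^sub>M spin_box \<Lambda>)" .
  from borel_measurable_divide[OF 1 this] show ?thesis
    by (simp add: conditional_density_def split_beta')
qed

lemma measurable_restrict_box: "(\<lambda>\<eta>. restrict \<eta> \<Lambda>) \<in> \<B> \<rightarrow>\<^sub>M spin_box \<Lambda>"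
  unfolding lebesgue_box_def
proof (rule measurable_restrict)
  fix x
  show "(\<lambda>\<eta>. \<eta> x) \<in> \<B> \<rightarrow>\<^sub>M restrict_space lborel {a..b}"
    using measurable_coordinate[of x]
    by (intro measurable_restrict_space2) (auto simp: space_\<B> configurations_iff)
qed

text \<open>
  By consistency the spins in \<open>\<Lambda>\<close> may be resampled, so that their law has a density with respect to
  Lebesgue measure. This density is the mean of a quasilocal function and therefore converges.
\<close>
lemma finite_volume_local:
  assumes \<Lambda>: "finite \<Lambda>" "\<Lambda> \<subseteq> exhaustion n"
    and h: "h \<in> borel_measurable (spin_box \<Lambda>)" "\<And>\<zeta>. \<zeta> \<in> space (spin_box \<Lambda>) \<Longrightarrow> \<bar>h \<zeta>\<bar> \<le> B"
  shows "(\<integral>\<eta>. h (restrict \<eta> \<Lambda>) \<partial>finite_volume n) =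
    (\<integral>\<zeta>. h \<zeta> * (\<integral>\<gamma>. conditional_density \<Lambda> \<zeta> \<gamma> \<partial>finite_volume n) \<partial>spin_box \<Lambda>)"
proof -
  interpret \<mu>: prob_space "finite_volume n" by (rule prob_space_finite_volume)
  interpret box: finite_measure "spin_box \<Lambda>" by (rule finite_measure_box[OF \<Lambda>(1)])
  interpret pair_sigma_finite "finite_volume n" "spin_box \<Lambda>" ..
  obtain C where C: "\<And>\<zeta> \<gamma>. \<zeta> \<in> space (spin_box \<Lambda>) \<Longrightarrow> \<gamma> \<in> \<Omega> \<Longrightarrow> \<bar>conditional_density \<Lambda> \<zeta> \<gamma>\<bar> \<le> C"
    using conditional_density_bounded[OF \<Lambda>(1)] by blast
  have rest: "restrict \<eta> \<Lambda> \<in> space (spin_box \<Lambda>)" if "\<eta> \<in> \<Omega>" for \<eta>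
    using measurable_space[OF measurable_restrict_box] that by (simp add: space_\<B>)
  have ob: "observable (\<lambda>\<eta>. h (restrict \<eta> \<Lambda>))"
    using h rest by (intro observableI measurable_compose[OF measurable_restrict_box]) auto
  have int: "integrable (finite_volume n \<Otimes>\<^sub>M spin_box \<Lambda>) (\<lambda>(\<gamma>, \<zeta>). h \<zeta> * conditional_density \<Lambda> \<zeta> \<gamma>)"
  proof (rule finite_measure.integrable_const_bound[where B = "B * C"])
    show "finite_measure (finite_volume n \<Otimes>\<^sub>M spin_box \<Lambda>)"
      by (intro finite_measure_pair_measure \<mu>.finite_measure_axioms box.finite_measure_axioms)
    show "AE p in finite_volume n \<Otimes>\<^sub>M spin_box \<Lambda>. norm (case p of (\<gamma>, \<zeta>) \<Rightarrow> h \<zeta> * conditional_density \<Lambda> \<zeta> \<gamma>) \<le> B * C"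
    proof (rule AE_I2)
      fix p assume "p \<in> space (finite_volume n \<Otimes>\<^sub>M spin_box \<Lambda>)"
      then have "fst p \<in> \<Omega>" "snd p \<in> space (spin_box \<Lambda>)"
        by (auto simp: space_pair_measure space_finite_volume)
      moreover from h(2)[OF this(2)] have "0 \<le> B" by linarith
      ultimately show "norm (case p of (\<gamma>, \<zeta>) \<Rightarrow> h \<zeta> * conditional_density \<Lambda> \<zeta> \<gamma>) \<le> B * C"
        using h(2) C by (auto simp: split_beta abs_mult intro!: mult_mono)
    qed
    have "(\<lambda>p. h (snd p)) \<in> borel_measurable (finite_volume n \<Otimes>\<^sub>M spin_box \<Lambda>)"
      by (rule measurable_compose[OF measurable_snd h(1)])
    moreover have "(\<lambda>p. conditional_density \<Lambda> (snd p) (fst p)) \<in> borel_measurable (finite_volume n \<Otimes>\<^sub>M spin_box \<Lambda>)"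
      using measurable_conditional_density[OF \<Lambda>(1)]
      by (simp add: split_beta' measurable_cong_sets[OF sets_pair_measure_cong[OF sets_finite_volume refl] refl])
    ultimately show "(\<lambda>(\<gamma>, \<zeta>). h \<zeta> * conditional_density \<Lambda> \<zeta> \<gamma>) \<in> borel_measurable (finite_volume n \<Otimes>\<^sub>M spin_box \<Lambda>)"
      by (simp add: split_beta')
  qed
  have "(\<integral>\<eta>. h (restrict \<eta> \<Lambda>) \<partial>finite_volume n) = (\<integral>\<gamma>. gibbs_average \<Lambda> (\<lambda>\<eta>. h (restrict \<eta> \<Lambda>)) \<gamma> \<partial>finite_volume n)"
    by (rule finite_volume_consistent[OF ob \<Lambda>(2), symmetric])
  also have "\<dots> = (\<integral>\<gamma>. (\<integral>\<zeta>. h \<zeta> * conditional_density \<Lambda> \<zeta> \<gamma> \<partial>spin_box \<Lambda>) \<partial>finite_volume n)"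
  proof (rule Bochner_Integration.integral_cong[OF refl])
    fix \<gamma>
    have "restrict (override_on \<gamma> \<zeta> \<Lambda>) \<Lambda> = \<zeta>" if "\<zeta> \<in> space (spin_box \<Lambda>)" for \<zeta>
      using that by (auto simp: space_box restrict_def override_on_def PiE_def extensional_def fun_eq_iff)
    then have "(\<integral>\<zeta>. h (restrict (override_on \<gamma> \<zeta> \<Lambda>) \<Lambda>) * boltzmann \<Lambda> (override_on \<gamma> \<zeta> \<Lambda>) / normaliser \<Lambda> \<gamma> \<partial>spin_box \<Lambda>)
      = (\<integral>\<zeta>. h \<zeta> * conditional_density \<Lambda> \<zeta> \<gamma> \<partial>spin_box \<Lambda>)"
      by (intro Bochner_Integration.integral_cong refl) (simp add: conditional_density_def)
    then show "gibbs_average \<Lambda> (\<lambda>\<eta>. h (restrict \<eta> \<Lambda>)) \<gamma> = (\<integral>\<zeta>. h \<zeta> * conditional_density \<Lambda> \<zeta> \<gamma> \<partial>spin_box \<Lambda>)"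
      by (simp add: gibbs_average_def box_integral_def)
  qed
  also have "\<dots> = (\<integral>\<zeta>. (\<integral>\<gamma>. h \<zeta> * conditional_density \<Lambda> \<zeta> \<gamma> \<partial>finite_volume n) \<partial>spin_box \<Lambda>)"
    by (rule Fubini_integral[OF int, symmetric])
  finally show ?thesis by simp
qed

definition marginal_density :: "'d site set \<Rightarrow> 'd configuration \<Rightarrow> real" where
  "marginal_density \<Lambda> \<zeta> = lim (\<lambda>n. \<integral>\<gamma>. conditional_density \<Lambda> \<zeta> \<gamma> \<partial>finite_volume n)"

lemma marginal_density_limit:
  assumes "finite \<Lambda>" "\<zeta> \<in> space (spin_box \<Lambda>)"
  shows "(\<lambda>n. \<integral>\<gamma>. conditional_density \<Lambda> \<zeta> \<gamma> \<partial>finite_volume n) \<longlonglongrightarrow> marginal_density \<Lambda> \<zeta>"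
  unfolding marginal_density_def
  using finite_volume_convergent[OF quasilocal_conditional_density[OF assms]]
  by (simp add: convergent_LIMSEQ_iff)

lemma measurable_finite_volume_density:
  assumes "finite \<Lambda>"
  shows "(\<lambda>\<zeta>. \<integral>\<gamma>. conditional_density \<Lambda> \<zeta> \<gamma> \<partial>finite_volume n) \<in> borel_measurable (spin_box \<Lambda>)"
proof -
  interpret prob_space "finite_volume n" by (rule prob_space_finite_volume)
  have "(\<lambda>p. (fst p, snd p)) \<in> spin_box \<Lambda> \<Otimes>\<^sub>M finite_volume n \<rightarrow>\<^sub>M spin_box \<Lambda> \<Otimes>\<^sub>M \<B>"
    by (simp add: measurable_cong_sets[OF sets_pair_measure_cong[OF refl sets_finite_volume] refl])
  from measurable_compose[OF measurable_compose[OF this measurable_pair_swap'] measurable_conditional_density[OF assms]]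
  show ?thesis by (intro borel_measurable_lebesgue_integral) (simp add: split_beta')
qed

lemma measurable_marginal_density:
  assumes "finite \<Lambda>"
  shows "marginal_density \<Lambda> \<in> borel_measurable (spin_box \<Lambda>)"
  by (rule borel_measurable_LIMSEQ_real[OF marginal_density_limit measurable_finite_volume_density])
     (auto intro: assms)

lemma marginal_density_nonneg:
  assumes "finite \<Lambda>" "\<zeta> \<in> space (spin_box \<Lambda>)"
  shows "0 \<le> marginal_density \<Lambda> \<zeta>"
  using marginal_density_limit[OF assms]
  by (rule LIMSEQ_le_const)
     (auto intro!: integral_nonneg_AE AE_I2 conditional_density_nonneg assms simp: space_finite_volume)

text \<open>
  The conditional densities are bounded uniformly in the boundary condition, hence dominated
  convergence applies and gives convergence for every bounded measurable local function, not only for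
  continuous ones.
\<close>
lemma finite_volume_local_limit:
  assumes \<Lambda>: "finite \<Lambda>"
    and h: "h \<in> borel_measurable (spin_box \<Lambda>)" "\<And>\<zeta>. \<zeta> \<in> space (spin_box \<Lambda>) \<Longrightarrow> \<bar>h \<zeta>\<bar> \<le> B"
  shows "(\<lambda>n. \<integral>\<eta>. h (restrict \<eta> \<Lambda>) \<partial>finite_volume n) \<longlonglongrightarrow> (\<integral>\<zeta>. h \<zeta> * marginal_density \<Lambda> \<zeta> \<partial>spin_box \<Lambda>)"
proof -
  interpret box: finite_measure "spin_box \<Lambda>" by (rule finite_measure_box[OF \<Lambda>])
  obtain C where C: "\<And>\<zeta> \<gamma>. \<zeta> \<in> space (spin_box \<Lambda>) \<Longrightarrow> \<gamma> \<in> \<Omega> \<Longrightarrow> \<bar>conditional_density \<Lambda> \<zeta> \<gamma>\<bar> \<le> C"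
    using conditional_density_bounded[OF \<Lambda>] by blast
  have bound: "\<bar>\<integral>\<gamma>. conditional_density \<Lambda> \<zeta> \<gamma> \<partial>finite_volume n\<bar> \<le> C" if \<zeta>: "\<zeta> \<in> space (spin_box \<Lambda>)" for \<zeta> n
  proof -
    interpret \<mu>: prob_space "finite_volume n" by (rule prob_space_finite_volume)
    have "\<bar>\<integral>\<gamma>. conditional_density \<Lambda> \<zeta> \<gamma> \<partial>finite_volume n\<bar> \<le> (\<integral>\<gamma>. \<bar>conditional_density \<Lambda> \<zeta> \<gamma>\<bar> \<partial>finite_volume n)"
      by (rule integral_abs_bound)
    also have "\<dots> \<le> (\<integral>\<gamma>. C \<partial>finite_volume n)"
      using C[OF \<zeta>]
      by (intro integral_mono integrable_abs integrable_observable prob_space_finite_volume sets_finite_volume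
            quasilocal_observable quasilocal_conditional_density quasilocal_const \<Lambda> \<zeta>)
         (auto simp: space_finite_volume)
    finally show ?thesis by (simp add: \<mu>.prob_space)
  qed
  have "(\<lambda>n. \<integral>\<zeta>. h \<zeta> * (\<integral>\<gamma>. conditional_density \<Lambda> \<zeta> \<gamma> \<partial>finite_volume n) \<partial>spin_box \<Lambda>)
      \<longlonglongrightarrow> (\<integral>\<zeta>. h \<zeta> * marginal_density \<Lambda> \<zeta> \<partial>spin_box \<Lambda>)"
  proof (rule integral_dominated_convergence[where w = "\<lambda>_. B * C"])
    show "AE \<zeta> in spin_box \<Lambda>. (\<lambda>n. h \<zeta> * (\<integral>\<gamma>. conditional_density \<Lambda> \<zeta> \<gamma> \<partial>finite_volume n)) \<longlonglongrightarrow> h \<zeta> * marginal_density \<Lambda> \<zeta>"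
      by (intro AE_I2 tendsto_mult tendsto_const marginal_density_limit \<Lambda>)
    show "AE \<zeta> in spin_box \<Lambda>. norm (h \<zeta> * (\<integral>\<gamma>. conditional_density \<Lambda> \<zeta> \<gamma> \<partial>finite_volume n)) \<le> B * C" for n
    proof (rule AE_I2)
      fix \<zeta> assume \<zeta>: "\<zeta> \<in> space (spin_box \<Lambda>)"
      moreover from h(2)[OF this] have "0 \<le> B" by linarith
      ultimately show "norm (h \<zeta> * (\<integral>\<gamma>. conditional_density \<Lambda> \<zeta> \<gamma> \<partial>finite_volume n)) \<le> B * C"
        using h(2) bound by (auto simp: abs_mult intro!: mult_mono)
    qed
  qed (use h(1) measurable_marginal_density[OF \<Lambda>] measurable_finite_volume_density[OF \<Lambda>] in auto)
  then show ?thesis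
  proof (rule Lim_transform_eventually)
    show "\<forall>\<^sub>F n in sequentially. (\<integral>\<zeta>. h \<zeta> * (\<integral>\<gamma>. conditional_density \<Lambda> \<zeta> \<gamma> \<partial>finite_volume n) \<partial>spin_box \<Lambda>)
        = (\<integral>\<eta>. h (restrict \<eta> \<Lambda>) \<partial>finite_volume n)"
      using eventually_subset_exhaustion[OF \<Lambda>]
      by eventually_elim (rule finite_volume_local[OF \<Lambda> _ h, symmetric])
  qed
qed

text \<open>
  The limiting law of the spins in \<open>\<Lambda>\<close>, carried over from the interval to the real line, where
  Kolmogorov's extension theorem for Polish spaces applies.
\<close>
definition marginal :: "'d site set \<Rightarrow> 'd configuration measure" where
  "marginal \<Lambda> = distr (density (spin_box \<Lambda>) (\<lambda>\<zeta>. ennreal (marginal_density \<Lambda> \<zeta>)))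
     (\<Pi>\<^sub>M x\<in>\<Lambda>. borel) (\<lambda>\<zeta>. \<zeta>)"

lemma measurable_box_ident: "(\<lambda>\<zeta>. \<zeta>) \<in> spin_box \<Lambda> \<rightarrow>\<^sub>M (\<Pi>\<^sub>M x\<in>\<Lambda>. borel)"
proof (rule measurable_PiM_single')
  show "(\<lambda>\<zeta>. \<zeta> x) \<in> borel_measurable (spin_box \<Lambda>)" if "x \<in> \<Lambda>" for x
    by (rule measurable_box_component[OF that])
qed (auto simp: space_box PiE_def)

lemma marginal_limit:
  fixes h :: "'d configuration \<Rightarrow> real"
  assumes \<Lambda>: "finite \<Lambda>"
    and h: "h \<in> borel_measurable (\<Pi>\<^sub>M x\<in>\<Lambda>. borel)" "\<And>\<zeta>. \<bar>h \<zeta>\<bar> \<le> B"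
  shows "(\<lambda>n. \<integral>\<eta>. h (restrict \<eta> \<Lambda>) \<partial>finite_volume n) \<longlonglongrightarrow> (\<integral>\<zeta>. h \<zeta> \<partial>marginal \<Lambda>)"
proof -
  note h' = measurable_compose[OF measurable_box_ident h(1)]
  let ?D = "density (spin_box \<Lambda>) (\<lambda>\<zeta>. ennreal (marginal_density \<Lambda> \<zeta>))"
  have "(\<integral>\<zeta>. h \<zeta> \<partial>marginal \<Lambda>) = (\<integral>\<zeta>. h \<zeta> \<partial>?D)"
    unfolding marginal_def by (rule integral_distr[OF _ h(1)]) (simp add: measurable_box_ident)
  also have "\<dots> = (\<integral>\<zeta>. marginal_density \<Lambda> \<zeta> *\<^sub>R h \<zeta> \<partial>spin_box \<Lambda>)"
    by (intro integral_density h' measurable_marginal_density AE_I2 marginal_density_nonneg \<Lambda>)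
  also have "\<dots> = (\<integral>\<zeta>. h \<zeta> * marginal_density \<Lambda> \<zeta> \<partial>spin_box \<Lambda>)" by (simp add: mult.commute)
  finally show ?thesis using finite_volume_local_limit[OF \<Lambda> h' h(2)] by simp
qed

lemma sets_marginal: "sets (marginal \<Lambda>) = sets (\<Pi>\<^sub>M x\<in>\<Lambda>. borel)"
  by (simp add: marginal_def)

lemma prob_space_marginal:
  assumes "finite \<Lambda>"
  shows "prob_space (marginal \<Lambda>)"
proof -
  interpret box: finite_measure "spin_box \<Lambda>" by (rule finite_measure_box[OF assms])
  have "(\<lambda>n::nat. 1 :: real) \<longlonglongrightarrow> (\<integral>\<zeta>. 1 * marginal_density \<Lambda> \<zeta> \<partial>spin_box \<Lambda>)"
    using finite_volume_local_limit[OF assms, of "\<lambda>_. 1" 1] prob_space.prob_space[OF prob_space_finite_volume] by simp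
  then have one: "(\<integral>\<zeta>. marginal_density \<Lambda> \<zeta> \<partial>spin_box \<Lambda>) = 1" by (simp add: LIMSEQ_const_iff)
  then have int: "integrable (spin_box \<Lambda>) (marginal_density \<Lambda>)"
    using not_integrable_integral_eq by fastforce
  have "(\<integral>\<^sup>+\<zeta>. ennreal (marginal_density \<Lambda> \<zeta>) \<partial>spin_box \<Lambda>) = 1"
    using nn_integral_eq_integral[OF int] marginal_density_nonneg[OF assms] one by simp
  then have "prob_space (density (spin_box \<Lambda>) (\<lambda>\<zeta>. ennreal (marginal_density \<Lambda> \<zeta>)))"
    using measurable_marginal_density[OF assms]
    by (intro prob_spaceI) (simp add: emeasure_density cong: nn_integral_cong)
  then show ?thesis unfolding marginal_def
    by (rule prob_space.prob_space_distr) (simp add: measurable_box_ident)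
qed

text \<open>
  Both sides are limits of the same finite-volume probabilities.
\<close>
lemma marginal_consistent:
  assumes "\<Lambda> \<subseteq> \<Delta>" "finite \<Delta>"
  shows "marginal \<Lambda> = distr (marginal \<Delta>) (\<Pi>\<^sub>M x\<in>\<Lambda>. borel) (\<lambda>\<eta>. restrict \<eta> \<Lambda>)"
proof (rule measure_eqI)
  have fin: "finite \<Lambda>" using assms finite_subset by blast
  interpret l: prob_space "marginal \<Lambda>" by (rule prob_space_marginal[OF fin])
  interpret d: prob_space "marginal \<Delta>" by (rule prob_space_marginal[OF assms(2)])
  have r: "(\<lambda>\<eta>. restrict \<eta> \<Lambda>) \<in> (\<Pi>\<^sub>M x\<in>\<Delta>. borel) \<rightarrow>\<^sub>M (\<Pi>\<^sub>M x\<in>\<Lambda>. (borel :: real measure))"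
    by (rule measurable_restrict_subset[OF assms(1)])
  have r': "(\<lambda>\<eta>. restrict \<eta> \<Lambda>) \<in> marginal \<Delta> \<rightarrow>\<^sub>M (\<Pi>\<^sub>M x\<in>\<Lambda>. (borel :: real measure))"
    using r by (simp add: measurable_cong_sets[OF sets_marginal refl])
  interpret d': prob_space "distr (marginal \<Delta>) (\<Pi>\<^sub>M x\<in>\<Lambda>. borel) (\<lambda>\<eta>. restrict \<eta> \<Lambda>)"
    by (rule d.prob_space_distr[OF r'])
  show "sets (marginal \<Lambda>) = sets (distr (marginal \<Delta>) (\<Pi>\<^sub>M x\<in>\<Lambda>. borel) (\<lambda>\<eta>. restrict \<eta> \<Lambda>))"
    by (simp add: sets_marginal)
  fix A assume "A \<in> sets (marginal \<Lambda>)"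
  then have A: "A \<in> sets (\<Pi>\<^sub>M x\<in>\<Lambda>. borel)" by (simp add: sets_marginal)
  have h: "(indicator A :: _ \<Rightarrow> real) \<in> borel_measurable (\<Pi>\<^sub>M x\<in>\<Lambda>. borel)" using A by simp
  have "(\<lambda>n. \<integral>\<eta>. (indicator A (restrict (restrict \<eta> \<Delta>) \<Lambda>) :: real) \<partial>finite_volume n)
      \<longlonglongrightarrow> (\<integral>\<zeta>. indicator A (restrict \<zeta> \<Lambda>) \<partial>marginal \<Delta>)"
    by (rule marginal_limit[OF assms(2) measurable_compose[OF r h], of 1]) (simp add: indicator_def)
  moreover have "restrict (restrict \<eta> \<Delta>) \<Lambda> = restrict \<eta> \<Lambda>" for \<eta> :: "'d configuration"
    using assms(1) by (auto simp: restrict_def fun_eq_iff)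
  moreover have "(\<lambda>n. \<integral>\<eta>. (indicator A (restrict \<eta> \<Lambda>) :: real) \<partial>finite_volume n) \<longlonglongrightarrow> (\<integral>\<zeta>. indicator A \<zeta> \<partial>marginal \<Lambda>)"
    by (rule marginal_limit[OF fin h, of 1]) (simp add: indicator_def)
  ultimately have "(\<integral>\<zeta>. indicator A \<zeta> \<partial>marginal \<Lambda>) = (\<integral>\<zeta>. (indicator A (restrict \<zeta> \<Lambda>) :: real) \<partial>marginal \<Delta>)"
    using LIMSEQ_unique by fastforce
  also have "\<dots> = (\<integral>\<zeta>. indicator A \<zeta> \<partial>distr (marginal \<Delta>) (\<Pi>\<^sub>M x\<in>\<Lambda>. borel) (\<lambda>\<eta>. restrict \<eta> \<Lambda>))"
    by (rule integral_distr[OF r' h, symmetric])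
  finally show "emeasure (marginal \<Lambda>) A = emeasure (distr (marginal \<Delta>) (\<Pi>\<^sub>M x\<in>\<Lambda>. borel) (\<lambda>\<eta>. restrict \<eta> \<Lambda>)) A"
    using A by (simp add: l.emeasure_eq_measure d'.emeasure_eq_measure sets_marginal)
qed

section \<open>The infinite-volume limit\<close>

lemma projective_limit_exists:
  obtains \<nu> :: "'d configuration measure"
  where "prob_space \<nu>" "sets \<nu> = sets (\<Pi>\<^sub>M x\<in>UNIV. borel)"
    "\<And>\<Lambda>. finite \<Lambda> \<Longrightarrow> distr \<nu> (\<Pi>\<^sub>M x\<in>\<Lambda>. borel) (\<lambda>\<eta>. restrict \<eta> \<Lambda>) = marginal \<Lambda>"
proof -
  have "projective_family UNIV marginal (\<lambda>_. borel)"
    by (rule projective_family.intro) (rule marginal_consistent prob_space_marginal; assumption)+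
  then interpret Q: polish_projective UNIV marginal by (rule polish_projective.intro)
  show ?thesis
  proof (rule that[of Q.lim])
    show "prob_space Q.lim" by (rule Q.P.prob_space_axioms)
    fix \<Lambda> :: "'d site set" assume \<Lambda>: "finite \<Lambda>"
    show "distr Q.lim (\<Pi>\<^sub>M x\<in>\<Lambda>. borel) (\<lambda>\<eta>. restrict \<eta> \<Lambda>) = marginal \<Lambda>"
    proof (rule measure_eqI)
      fix A assume "A \<in> sets (distr Q.lim (\<Pi>\<^sub>M x\<in>\<Lambda>. borel) (\<lambda>\<eta>. restrict \<eta> \<Lambda>))"
      then have A: "A \<in> sets (\<Pi>\<^sub>M x\<in>\<Lambda>. borel)" by simp
      have "emeasure (distr Q.lim (\<Pi>\<^sub>M x\<in>\<Lambda>. borel) (\<lambda>\<eta>. restrict \<eta> \<Lambda>)) A = emeasure Q.lim (Q.emb UNIV \<Lambda> A)"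
        using A by (subst emeasure_distr)
          (auto simp: prod_emb_def space_PiM measurable_cong_sets[OF Q.sets_lim refl] intro!: measurable_restrict_subset)
      then show "emeasure (distr Q.lim (\<Pi>\<^sub>M x\<in>\<Lambda>. borel) (\<lambda>\<eta>. restrict \<eta> \<Lambda>)) A = emeasure (marginal \<Lambda>) A"
        using Q.emeasure_lim_emb[OF subset_UNIV \<Lambda> A] by simp
    qed (simp add: sets_marginal)
  qed simp
qed

text \<open>
  Projects an arbitrary real configuration into \<open>\<Omega>\<close>, keeping only what is visible in \<open>\<Lambda>\<close>. It serves
  both to bring the Kolmogorov measure back to \<open>\<Omega>\<close> and to approximate quasilocal functions by local ones.
\<close>
definition truncate :: "'d site set \<Rightarrow> 'd configuration \<Rightarrow> 'd configuration" where
  "truncate \<Lambda> \<eta> x = (if x \<in> \<Lambda> then max a (min b (\<eta> x)) else a)"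

lemma truncate_mem: "truncate \<Lambda> \<eta> \<in> \<Omega>"
  using a_less_b by (auto simp: truncate_def configurations_iff)

lemma measurable_truncate:
  assumes "\<Lambda> \<subseteq> \<Delta>"
  shows "truncate \<Lambda> \<in> (\<Pi>\<^sub>M x\<in>\<Delta>. borel) \<rightarrow>\<^sub>M \<B>"
proof (rule measurable_into_\<B>)
  show "(\<lambda>\<eta>. truncate \<Lambda> \<eta> x) \<in> borel_measurable (\<Pi>\<^sub>M x\<in>\<Delta>. borel)" for x
    using assms by (cases "x \<in> \<Lambda>") (auto simp: truncate_def intro!: borel_measurable_max borel_measurable_min)
qed (rule truncate_mem)

lemma truncate_error:
  assumes L: "weighted_lipschitz L f" and \<eta>: "\<eta> \<in> \<Omega>" and \<Lambda>: "finite \<Lambda>"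
  shows "\<bar>f \<eta> - f (truncate \<Lambda> \<eta>)\<bar> \<le> (b - a) * (\<Sum>\<^sub>\<infinity>z\<in>-\<Lambda>. L z)"
proof -
  have "(\<Sum>z\<in>\<Lambda>. L z * \<bar>\<eta> z - truncate \<Lambda> \<eta> z\<bar>) = 0"
    using \<eta> by (intro sum.neutral) (auto simp: truncate_def configurations_iff)
  then show ?thesis
    using weighted_lipschitzD(3)[OF L \<eta> truncate_mem[of \<Lambda> \<eta>]]
      weighted_sum_split[OF \<eta> truncate_mem weighted_lipschitzD(1,2)[OF L] \<Lambda>, of \<Lambda> \<eta>] by linarith
qed

lemma integral_close:
  assumes M: "prob_space M" "sets M = sets \<B>" and f: "observable f" and g: "observable g"
    and le: "\<And>\<eta>. \<eta> \<in> \<Omega> \<Longrightarrow> \<bar>f \<eta> - g \<eta>\<bar> \<le> \<epsilon>"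
  shows "\<bar>(\<integral>\<eta>. f \<eta> \<partial>M) - (\<integral>\<eta>. g \<eta> \<partial>M)\<bar> \<le> \<epsilon>"
proof -
  interpret M: prob_space M by fact
  have sp: "space M = \<Omega>" using M(2) sets_eq_imp_space_eq space_\<B> by metis
  note int = integrable_observable[OF M]
  have "(\<integral>\<eta>. f \<eta> \<partial>M) - (\<integral>\<eta>. g \<eta> \<partial>M) = (\<integral>\<eta>. f \<eta> - g \<eta> \<partial>M)"
    by (rule Bochner_Integration.integral_diff[symmetric]) (intro int f g)+
  also have "\<bar>\<dots>\<bar> \<le> (\<integral>\<eta>. \<bar>f \<eta> - g \<eta>\<bar> \<partial>M)" by (rule integral_abs_bound)
  also have "\<dots> \<le> (\<integral>\<eta>. \<epsilon> \<partial>M)"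
    using le sp
    by (intro integral_mono integrable_abs Bochner_Integration.integrable_diff int f g observable_const) auto
  finally show ?thesis by (simp add: M.prob_space)
qed

text \<open>
  The projective limit has the right integrals of local functions by construction; a quasilocal function
  is uniformly close to a local one.
\<close>
lemma weak_limit_exists:
  obtains \<mu> where "prob_space \<mu>" "sets \<mu> = sets \<B>"
    "\<And>f. quasilocal f \<Longrightarrow> (\<lambda>n. \<integral>\<eta>. f \<eta> \<partial>finite_volume n) \<longlonglongrightarrow> (\<integral>\<eta>. f \<eta> \<partial>\<mu>)"
proof -
  obtain \<nu> :: "'d configuration measure" where \<nu>: "prob_space \<nu>" "sets \<nu> = sets (\<Pi>\<^sub>M x\<in>UNIV. borel)"
    and proj: "\<And>\<Lambda>. finite \<Lambda> \<Longrightarrow> distr \<nu> (\<Pi>\<^sub>M x\<in>\<Lambda>. borel) (\<lambda>\<eta>. restrict \<eta> \<Lambda>) = marginal \<Lambda>"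
    using projective_limit_exists by blast
  have T: "truncate UNIV \<in> \<nu> \<rightarrow>\<^sub>M \<B>"
    using measurable_truncate[of UNIV UNIV] by (simp add: measurable_cong_sets[OF \<nu>(2) refl])
  define \<mu> where "\<mu> = distr \<nu> \<B> (truncate UNIV)"
  have \<mu>: "prob_space \<mu>" "sets \<mu> = sets \<B>"
    unfolding \<mu>_def using \<nu>(1) T by (auto intro: prob_space.prob_space_distr)
  have sp: "space \<mu> = \<Omega>" by (simp add: \<mu>_def space_\<B>)
  have local: "observable (\<lambda>\<eta>. f (truncate \<Lambda> \<eta>))"
    "(\<lambda>n. \<integral>\<eta>. f (truncate \<Lambda> \<eta>) \<partial>finite_volume n) \<longlonglongrightarrow> (\<integral>\<eta>. f (truncate \<Lambda> \<eta>) \<partial>\<mu>)"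
    if f: "observable f" and \<Lambda>: "finite \<Lambda>" for f \<Lambda>
  proof -
    obtain B where B: "\<And>\<eta>. \<eta> \<in> \<Omega> \<Longrightarrow> \<bar>f \<eta>\<bar> \<le> B" using observable_bound[OF f] by blast
    have t: "truncate \<Lambda> (restrict \<eta> \<Lambda>) = truncate \<Lambda> \<eta>" "truncate \<Lambda> (truncate UNIV \<eta>) = truncate \<Lambda> \<eta>" for \<eta>
      using a_less_b by (auto simp: truncate_def fun_eq_iff)
    have h: "(\<lambda>\<zeta>. f (truncate \<Lambda> \<zeta>)) \<in> borel_measurable (\<Pi>\<^sub>M x\<in>\<Lambda>. borel)"
      by (rule measurable_compose[OF measurable_truncate[OF subset_refl] observable_measurable[OF f]])
    have trB: "truncate \<Lambda> \<in> \<B> \<rightarrow>\<^sub>M \<B>"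
    proof (rule measurable_into_\<B>)
      show "(\<lambda>\<eta>. truncate \<Lambda> \<eta> x) \<in> borel_measurable \<B>" for x
        using measurable_coordinate[of x]
        by (cases "x \<in> \<Lambda>") (auto simp: truncate_def intro!: borel_measurable_max borel_measurable_min)
    qed (rule truncate_mem)
    have m: "(\<lambda>\<eta>. f (truncate \<Lambda> \<eta>)) \<in> borel_measurable \<B>"
      by (rule measurable_compose[OF trB observable_measurable[OF f]])
    then show "observable (\<lambda>\<eta>. f (truncate \<Lambda> \<eta>))"
      using B truncate_mem by (intro observableI) auto
    have "(\<integral>\<eta>. f (truncate \<Lambda> \<eta>) \<partial>\<mu>) = (\<integral>\<eta>. f (truncate \<Lambda> (restrict \<eta> \<Lambda>)) \<partial>\<nu>)"
      unfolding \<mu>_def by (subst integral_distr[OF T m]) (simp add: t)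
    also have "\<dots> = (\<integral>\<zeta>. f (truncate \<Lambda> \<zeta>) \<partial>marginal \<Lambda>)"
      unfolding proj[OF \<Lambda>, symmetric]
      by (rule integral_distr[symmetric, OF _ h])
         (simp add: measurable_cong_sets[OF \<nu>(2) refl] measurable_restrict_subset)
    finally have "(\<integral>\<eta>. f (truncate \<Lambda> \<eta>) \<partial>\<mu>) = (\<integral>\<zeta>. f (truncate \<Lambda> \<zeta>) \<partial>marginal \<Lambda>)" .
    then show "(\<lambda>n. \<integral>\<eta>. f (truncate \<Lambda> \<eta>) \<partial>finite_volume n) \<longlonglongrightarrow> (\<integral>\<eta>. f (truncate \<Lambda> \<eta>) \<partial>\<mu>)"
      using marginal_limit[OF \<Lambda> h, of B] B truncate_mem by (simp add: t)
  qed
  show ?thesis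
  proof (rule that[OF \<mu>])
    fix f :: "'d configuration \<Rightarrow> real" assume f: "quasilocal f"
    then obtain L where L: "weighted_lipschitz L f" unfolding quasilocal_def by auto
    note ob = quasilocal_observable[OF f]
    show "(\<lambda>n. \<integral>\<eta>. f \<eta> \<partial>finite_volume n) \<longlonglongrightarrow> (\<integral>\<eta>. f \<eta> \<partial>\<mu>)"
    proof (rule tendstoI)
      fix \<epsilon> :: real assume \<epsilon>: "0 < \<epsilon>"
      obtain \<Lambda> where \<Lambda>: "finite \<Lambda>" "(\<Sum>\<^sub>\<infinity>z\<in>-\<Lambda>. L z) \<le> \<epsilon> / (4 * (b - a))"
        using summable_tail[OF weighted_lipschitzD(1,2)[OF L], of "\<epsilon> / (4 * (b - a))"] \<epsilon> a_less_b by auto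
      have "(b - a) * (\<Sum>\<^sub>\<infinity>z\<in>-\<Lambda>. L z) \<le> (b - a) * (\<epsilon> / (4 * (b - a)))"
        using \<Lambda> a_less_b by (intro mult_left_mono) auto
      also have "\<dots> = \<epsilon> / 4" using a_less_b by (simp add: field_simps)
      finally have small: "\<bar>f \<eta> - f (truncate \<Lambda> \<eta>)\<bar> \<le> \<epsilon> / 4" if "\<eta> \<in> \<Omega>" for \<eta>
        using truncate_error[OF L that \<Lambda>(1)] by linarith
      have close: "\<bar>(\<integral>\<eta>. f \<eta> \<partial>M) - (\<integral>\<eta>. f (truncate \<Lambda> \<eta>) \<partial>M)\<bar> \<le> \<epsilon> / 4"
        if M: "prob_space M" "sets M = sets \<B>" for M
        using integral_close[OF M ob local(1)[OF ob \<Lambda>(1)] small] .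
      have "\<forall>\<^sub>F n in sequentially. dist (\<integral>\<eta>. f (truncate \<Lambda> \<eta>) \<partial>finite_volume n) (\<integral>\<eta>. f (truncate \<Lambda> \<eta>) \<partial>\<mu>) < \<epsilon> / 4"
        using local(2)[OF ob \<Lambda>(1)] \<epsilon> by (intro tendstoD) auto
      then show "\<forall>\<^sub>F n in sequentially. dist (\<integral>\<eta>. f \<eta> \<partial>finite_volume n) (\<integral>\<eta>. f \<eta> \<partial>\<mu>) < \<epsilon>"
      proof eventually_elim
        case (elim n)
        then show ?case
          using close[OF prob_space_finite_volume sets_finite_volume, of n] close[OF \<mu>] \<epsilon>
          unfolding dist_real_def by linarith
      qed
    qed
  qed
qed

section \<open>Existence\<close>

lemma compact_configurations: "compact \<Omega>"
proof -
  have "compactin (product_topology (\<lambda>_ :: 'd site. euclideanreal) UNIV) (UNIV \<rightarrow>\<^sub>E {a..b})"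
    by (metis compactin_PiE compactin_euclidean_iff compact_Icc)
  then have "compactin (euclidean :: 'd configuration topology) \<Omega>"
    by (metis euclidean_product_topology configurations_def)
  then show ?thesis by (metis compactin_euclidean_iff)
qed

lemma continuous_observable:
  assumes "continuous_on \<Omega> f"
  shows "observable (f :: 'd configuration \<Rightarrow> real)"
proof -
  have "bounded (f ` \<Omega>)"
    using compact_continuous_image[OF assms compact_configurations] by (rule compact_imp_bounded)
  then obtain B where "\<forall>y\<in>f ` \<Omega>. norm y \<le> B" by (auto simp: bounded_iff)
  then show ?thesis
    using assms by (intro observableI[of _ B] borel_measurable_continuous_on_restrict) auto
qed

text \<open>
  The quasilocal functions form an algebra that contains the constants and the coordinates.
\<close>
lemma quasilocal_dense:
  assumes "continuous_on \<Omega> f" "0 < \<epsilon>"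
  obtains g where "quasilocal g" "\<And>\<eta>. \<eta> \<in> \<Omega> \<Longrightarrow> \<bar>f \<eta> - g \<eta>\<bar> \<le> \<epsilon>"
proof -
  have "\<exists>g. quasilocal g \<and> (\<forall>\<eta>\<in>\<Omega>. \<bar>f \<eta> - g \<eta>\<bar> < \<epsilon>)"
  proof (rule Stone_Weierstrass_HOL[where P = quasilocal, OF compact_configurations])
    fix \<eta> \<eta>' assume "\<eta> \<in> \<Omega> \<and> \<eta>' \<in> \<Omega> \<and> \<eta> \<noteq> \<eta>'"
    then obtain x where "\<eta> x \<noteq> \<eta>' x" by (auto simp: fun_eq_iff)
    then show "\<exists>f. quasilocal f \<and> f \<eta> \<noteq> f \<eta>'" using quasilocal_coordinate by blast
  qed (use assms in \<open>auto intro: quasilocal_const quasilocal_continuous quasilocal_add quasilocal_mult\<close>)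
  then show ?thesis using that by (meson less_imp_le)
qed

theorem gibbs_measure_exists: "\<exists>\<mu>. gibbs_measure a b (gibbs_specification a b J) \<mu>"
proof -
  obtain \<mu> where \<mu>: "prob_space \<mu>" "sets \<mu> = sets \<B>"
    and lim: "\<And>f. quasilocal f \<Longrightarrow> (\<lambda>n. \<integral>\<eta>. f \<eta> \<partial>finite_volume n) \<longlonglongrightarrow> (\<integral>\<eta>. f \<eta> \<partial>\<mu>)"
    using weak_limit_exists by blast
  have sp: "space \<mu> = \<Omega>" using \<mu>(2) sets_eq_imp_space_eq space_\<B> by metis
  have invariant: "(\<integral>\<eta>. gibbs_average \<Lambda> f \<eta> \<partial>\<mu>) = (\<integral>\<eta>. f \<eta> \<partial>\<mu>)"
    if f: "quasilocal f" and \<Lambda>: "finite \<Lambda>" for f \<Lambda>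
  proof (rule LIMSEQ_unique[OF lim[OF quasilocal_gibbs_average[OF f \<Lambda>]]])
    show "(\<lambda>n. \<integral>\<eta>. gibbs_average \<Lambda> f \<eta> \<partial>finite_volume n) \<longlonglongrightarrow> (\<integral>\<eta>. f \<eta> \<partial>\<mu>)"
      using lim[OF f]
    proof (rule Lim_transform_eventually)
      show "\<forall>\<^sub>F n in sequentially. (\<integral>\<eta>. f \<eta> \<partial>finite_volume n) = (\<integral>\<eta>. gibbs_average \<Lambda> f \<eta> \<partial>finite_volume n)"
        using eventually_subset_exhaustion[OF \<Lambda>]
        by eventually_elim (rule finite_volume_consistent[OF quasilocal_observable[OF f], symmetric])
    qed
  qed
  have "(\<integral>\<gamma>. (\<integral>\<eta>. f (override_on \<gamma> \<eta> \<Lambda>) \<partial>gibbs_specification a b J \<Lambda> \<gamma>) \<partial>\<mu>) = (\<integral>\<eta>. f \<eta> \<partial>\<mu>)"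
    if \<Lambda>: "finite \<Lambda>" and f: "continuous_on \<Omega> f" for \<Lambda> and f :: "'d configuration \<Rightarrow> real"
  proof -
    note ob = continuous_observable[OF f]
    have "(\<integral>\<gamma>. (\<integral>\<eta>. f (override_on \<gamma> \<eta> \<Lambda>) \<partial>gibbs_specification a b J \<Lambda> \<gamma>) \<partial>\<mu>) = (\<integral>\<eta>. gibbs_average \<Lambda> f \<eta> \<partial>\<mu>)"
      using sp by (intro Bochner_Integration.integral_cong refl gibbs_specification_integral ob \<Lambda>) simp
    also have "\<dots> = (\<integral>\<eta>. f \<eta> \<partial>\<mu>)"
    proof -
      have "\<bar>(\<integral>\<eta>. gibbs_average \<Lambda> f \<eta> \<partial>\<mu>) - (\<integral>\<eta>. f \<eta> \<partial>\<mu>)\<bar> \<le> \<epsilon>" if \<epsilon>: "0 < \<epsilon>" for \<epsilon>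
      proof -
        obtain g where g: "quasilocal g" "\<And>\<eta>. \<eta> \<in> \<Omega> \<Longrightarrow> \<bar>f \<eta> - g \<eta>\<bar> \<le> \<epsilon> / 2"
          using quasilocal_dense[OF f, of "\<epsilon> / 2"] \<epsilon> by auto
        note og = quasilocal_observable[OF g(1)]
        have "\<bar>gibbs_average \<Lambda> f \<eta> - gibbs_average \<Lambda> g \<eta>\<bar> \<le> \<epsilon> / 2" if "\<eta> \<in> \<Omega>" for \<eta>
          using that by (intro gibbs_average_diff_le[OF ob og \<Lambda> that] g(2) override_mem)
        from integral_close[OF \<mu> observable_gibbs_average[OF ob \<Lambda>] observable_gibbs_average[OF og \<Lambda>] this]
        show ?thesis
          using integral_close[OF \<mu> ob og g(2)] invariant[OF g(1) \<Lambda>] by linarith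
      qed
      then show ?thesis using field_le_epsilon[of "\<bar>_\<bar>" 0] by (metis abs_le_zero_iff add.left_neutral right_minus_eq)
    qed
    finally show ?thesis .
  qed
  then have "gibbs_measure a b (gibbs_specification a b J) \<mu>"
    using \<mu> unfolding gibbs_measure_def by blast
  then show ?thesis by blast
qed

end

theorem theorem1:
  fixes a b :: real and J :: "int ^ 'd::finite \<Rightarrow> real"
  assumes "a < b"
    and "\<And>x. J x \<ge> 0"
    and "\<And>x. J x = J (- x)"
    and "J 0 = 0"
    and "J summable_on UNIV"
    and "0 < (\<Sum>\<^sub>\<infinity>x. J x)"
  shows "\<exists>!\<mu>. gibbs_measure a b (gibbs_specification a b J) \<mu>"
proof -
  interpret harmonic_crystal a b J by (unfold_locales) (fact assms)+
  obtain \<mu> where \<mu>: "gibbs_measure a b (gibbs_specification a b J) \<mu>"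
    using gibbs_measure_exists by blast
  then show ?thesis by (rule ex1I) (rule gibbs_measure_unique[OF _ \<mu>])
qed

end
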